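(* Let $\widetilde{\mathcal U}$ be a nonempty bounded subset of $\mathcal U_p=L^p(0,T;U)$ whose closed convex hull $\overline{\mathrm{co}}\,\widetilde{\mathcal U}$ has at least one interior point in $\mathcal U_p$. Set $$M=\big\{\, y(T)\in Y \ :\ y \text{ is the mild solution to } y_t(t)=Ay(t)+F(t)y(t)+B(t)u(t),\ t\in(0,T],\ y(0)=0,\ \text{ for some } u(\cdot)\in\widetilde{\mathcal U}\,\big\}.$$ Then the following three assertions are equivalent: (1) The control system $y_t(t)=Ay(t)+F(t)y(t)+B(t)u(t)$, $t\in(0,T]$, $y(0)=0$, with controls $u(\cdot)\in\mathcal U_p$, is finite codimensional approximately controllable in $Y$ (at time $T$). (2) $\mathrm{span}\,M$, the closed linear span of $M$, is a finite codimensional subspace of $Y$. (3) There is a finite dimensional subspace $\widehat Y$ of $Y'$ such that for any mild solution $\phi$ to $$\phi_t(t)=-A^*\phi(t)-F(t)^*\phi(t),\quad t\in(0,T),\qquad \phi(T)=\phi_T\in Y',$$ one has $B(\cdot)^*\phi=0$ (a.e. in $(0,T)$) if and only if $\phi_T\in\widehat Y$.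
   Context: $T>0$; $Y$ and $U$ are reflexive (real) Banach spaces with dual spaces $Y'$, $U'$; $p\in(1,\infty]$; $\mathcal U_p=L^p(0,T;U)$. $A:\mathcal D(A)\subseteq Y\to Y$ generates a $C_0$-semigroup on $Y$, $F(\cdot)\in L^\infty(0,T;\mathcal L(Y))$, $B(\cdot)\in L^\infty(0,T;\mathcal L(U;Y))$; $^*$ denotes adjoint operators. $A+F(\cdot)$ generates an evolution operator $\mathcal S(\cdot,\cdot)$ on $Y$, and the mild solution with $y(0)=0$ and control $u$ is $y(t)=\int_0^t\mathcal S(t,s)B(s)u(s)\,ds$. Finite codimensional subspace: a linear subspace $Y_0$ of a Banach space $Z$ is called finite codimensional (in $Z$) if there are $m\ge 0$ and linearly independent $z_1,\dots,z_m\in Z\setminus Y_0$ such that $Y_0$ and $z_1,\dots,z_m$ together linearly span $Z$. Finite codimensional approximate controllability: the system is finite codimensional approximately controllable at time $T$ if $\overline{\mathcal R(T;0)}$ is a finite codimensional subspace of $Y$, where $\mathcal R(T;0)=\{y(T): y \text{ is the mild solution with } y(0)=0 \text{ for some } u\in\mathcal U_p\}$ is the reachable set. *)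

theory Defs
  imports
    "HOL-Analysis.Analysis"
    "HOL-Library.Function_Algebras"
    "HOL-Probability.Essential_Supremum"
begin

section \<open>Functional-analytic notions\<close>

text \<open>The dual of a real normed space \<open>'a\<close> is the type \<open>'a \<Rightarrow>\<^sub>L real\<close>.\<close>

definition reflexive_space :: "'a::real_normed_vector itself \<Rightarrow> bool" where
  "reflexive_space _ \<longleftrightarrow>
     (\<forall>\<Phi> :: ('a \<Rightarrow>\<^sub>L real) \<Rightarrow>\<^sub>L real. \<exists>x. \<forall>\<phi>. blinfun_apply \<Phi> \<phi> = blinfun_apply \<phi> x)"

definition dual_adjoint ::
    "('a::real_normed_vector \<Rightarrow>\<^sub>L 'b::real_normed_vector) \<Rightarrow> ('b \<Rightarrow>\<^sub>L real) \<Rightarrow> ('a \<Rightarrow>\<^sub>L real)" where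
  "dual_adjoint L \<phi> = \<phi> o\<^sub>L L"

definition finite_dim_subspace :: "'a::real_vector set \<Rightarrow> bool" where
  "finite_dim_subspace V \<longleftrightarrow> subspace V \<and> (\<exists>b. finite b \<and> span b = V)"

definition finite_codim_subspace :: "'a::real_vector set \<Rightarrow> bool" where
  "finite_codim_subspace V \<longleftrightarrow> subspace V \<and>
     (\<exists>b. finite b \<and> independent b \<and> b \<subseteq> - V \<and> span (V \<union> b) = UNIV)"

section \<open>Bochner measurability, Bochner integral and Lebesgue-Bochner spaces\<close>

text \<open>The Bochner integral of the library is restricted to second countable (separable) target
  spaces.  The spaces occurring here need not be separable (and operator spaces rarely are),
  so the integral is defined in the same way, from the library's integral of simple functions, with
  Borel measurability replaced by strong measurability.\<close>

definition strongly_measurable :: "'a measure \<Rightarrow> ('a \<Rightarrow> 'b::real_normed_vector) \<Rightarrow> bool" where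
  "strongly_measurable M f \<longleftrightarrow>
     (\<exists>s. (\<forall>n::nat. simple_function M (s n)) \<and> (AE x in M. (\<lambda>n. s n x) \<longlonglongrightarrow> f x))"

definition has_strong_integral ::
    "'a measure \<Rightarrow> ('a \<Rightarrow> 'b::real_normed_vector) \<Rightarrow> 'b \<Rightarrow> bool" where
  "has_strong_integral M f x \<longleftrightarrow> strongly_measurable M f \<and>
     (\<exists>s. (\<forall>n::nat. Bochner_Integration.simple_bochner_integrable M (s n)) \<and>
          (\<lambda>n. \<integral>\<^sup>+ t. ennreal (norm (f t - s n t)) \<partial>M) \<longlonglongrightarrow> 0 \<and>
          (\<lambda>n. Bochner_Integration.simple_bochner_integral M (s n)) \<longlonglongrightarrow> x)"

text \<open>Elements of \<open>L\<^sup>p(0,T;X)\<close> are handled through representatives \<open>real \<Rightarrow> 'a\<close>; only their values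
  almost everywhere on \<open>(0,T)\<close> matter, and \<open>Lp_norm\<close> is accordingly a seminorm.\<close>

definition Lp_space :: "ennreal \<Rightarrow> real \<Rightarrow> (real \<Rightarrow> 'a::real_normed_vector) set" where
  "Lp_space p T = {u. strongly_measurable (lebesgue_on {0<..<T}) u \<and>
     (if p = \<infinity> then esssup (lebesgue_on {0<..<T}) (\<lambda>t. ereal (norm (u t))) < \<infinity>
      else integrable (lebesgue_on {0<..<T}) (\<lambda>t. norm (u t) powr enn2real p))}"

definition Lp_norm :: "ennreal \<Rightarrow> real \<Rightarrow> (real \<Rightarrow> 'a::real_normed_vector) \<Rightarrow> real" where
  "Lp_norm p T u =
     (if p = \<infinity> then real_of_ereal (esssup (lebesgue_on {0<..<T}) (\<lambda>t. ereal (norm (u t))))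
      else (LINT t|lebesgue_on {0<..<T}. norm (u t) powr enn2real p) powr (1 / enn2real p))"

definition Lp_bounded ::
    "ennreal \<Rightarrow> real \<Rightarrow> (real \<Rightarrow> 'a::real_normed_vector) set \<Rightarrow> bool" where
  "Lp_bounded p T W \<longleftrightarrow> (\<exists>C. \<forall>u\<in>W. Lp_norm p T u \<le> C)"

definition Lp_closure ::
    "ennreal \<Rightarrow> real \<Rightarrow> (real \<Rightarrow> 'a::real_normed_vector) set \<Rightarrow> (real \<Rightarrow> 'a) set" where
  "Lp_closure p T W =
     {u \<in> Lp_space p T. \<forall>\<epsilon>>0. \<exists>v\<in>W. Lp_norm p T (\<lambda>t. v t - u t) < \<epsilon>}"

definition Lp_interior ::
    "ennreal \<Rightarrow> real \<Rightarrow> (real \<Rightarrow> 'a::real_normed_vector) set \<Rightarrow> (real \<Rightarrow> 'a) set" where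
  "Lp_interior p T W =
     {u \<in> Lp_space p T. \<exists>\<epsilon>>0. \<forall>v\<in>Lp_space p T. Lp_norm p T (\<lambda>t. v t - u t) < \<epsilon> \<longrightarrow> v \<in> W}"

text \<open>Pointwise vector space structure on functions, so that \<open>convex hull\<close> applies to sets of
  controls.\<close>

instantiation "fun" :: (type, real_vector) real_vector
begin

definition scaleR_fun :: "real \<Rightarrow> ('a \<Rightarrow> 'b) \<Rightarrow> 'a \<Rightarrow> 'b" where
  "scaleR_fun c f = (\<lambda>x. c *\<^sub>R f x)"

instance
  by standard (auto simp: scaleR_fun_def fun_eq_iff algebra_simps)

end

section \<open>Semigroups, generators and evolution operators\<close>

definition C0_semigroup :: "(real \<Rightarrow> 'a::real_normed_vector \<Rightarrow>\<^sub>L 'a) \<Rightarrow> bool" where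
  "C0_semigroup G \<longleftrightarrow> G 0 = id_blinfun \<and>
     (\<forall>s\<ge>0. \<forall>t\<ge>0. G (s + t) = G s o\<^sub>L G t) \<and>
     (\<forall>x. ((\<lambda>t. G t x) \<longlongrightarrow> x) (at_right 0))"

text \<open>An unbounded operator is a pair of its domain \<open>D\<close> and a function \<open>A\<close>, whose values outside
  \<open>D\<close> are irrelevant.\<close>

definition generates_C0_semigroup ::
    "'a::real_normed_vector set \<Rightarrow> ('a \<Rightarrow> 'a) \<Rightarrow> (real \<Rightarrow> 'a \<Rightarrow>\<^sub>L 'a) \<Rightarrow> bool" where
  "generates_C0_semigroup D A G \<longleftrightarrow> C0_semigroup G \<and>
     D = {x. \<exists>y. ((\<lambda>h. (G h x - x) /\<^sub>R h) \<longlongrightarrow> y) (at_right 0)} \<and>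
     (\<forall>x\<in>D. ((\<lambda>h. (G h x - x) /\<^sub>R h) \<longlongrightarrow> A x) (at_right 0))"

text \<open>The adjoint of a densely defined operator; density makes the functional \<open>\<psi>\<close> unique.\<close>

definition adjoint_dom ::
    "'a::real_normed_vector set \<Rightarrow> ('a \<Rightarrow> 'a) \<Rightarrow> ('a \<Rightarrow>\<^sub>L real) set" where
  "adjoint_dom D A = {\<phi>. \<exists>\<psi>. \<forall>x\<in>D. blinfun_apply \<psi> x = blinfun_apply \<phi> (A x)}"

definition adjoint_op ::
    "'a::real_normed_vector set \<Rightarrow> ('a \<Rightarrow> 'a) \<Rightarrow> ('a \<Rightarrow>\<^sub>L real) \<Rightarrow> ('a \<Rightarrow>\<^sub>L real)" where
  "adjoint_op D A \<phi> = (THE \<psi>. \<forall>x\<in>D. blinfun_apply \<psi> x = blinfun_apply \<phi> (A x))"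

text \<open>The evolution operator \<open>S t s\<close>, \<open>0 \<le> s \<le> t \<le> T\<close>, generated by \<open>A + F(\<cdot>)\<close>: with
  \<open>G\<close> the semigroup generated by \<open>A\<close>,
  \<open>S t s x = G (t - s) x + \<integral>\<^sub>s\<^sup>t G (t - r) F(r) S r s x dr\<close>.\<close>

definition evolution_operator ::
    "real \<Rightarrow> 'a::real_normed_vector set \<Rightarrow> ('a \<Rightarrow> 'a) \<Rightarrow> (real \<Rightarrow> 'a \<Rightarrow>\<^sub>L 'a) \<Rightarrow>
     (real \<Rightarrow> real \<Rightarrow> 'a \<Rightarrow>\<^sub>L 'a) \<Rightarrow> bool" where
  "evolution_operator T D A F S \<longleftrightarrow>
     (\<forall>t\<in>{0..T}. S t t = id_blinfun) \<and>
     (\<forall>s r t. 0 \<le> s \<and> s \<le> r \<and> r \<le> t \<and> t \<le> T \<longrightarrow> S t s = S t r o\<^sub>L S r s) \<and>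
     (\<forall>x. continuous_on {(t, s). 0 \<le> s \<and> s \<le> t \<and> t \<le> T} (\<lambda>(t, s). S t s x)) \<and>
     (\<exists>G. generates_C0_semigroup D A G \<and>
        (\<forall>s t x. 0 \<le> s \<and> s \<le> t \<and> t \<le> T \<longrightarrow>
           has_strong_integral (lebesgue_on {s<..<t})
             (\<lambda>r. G (t - r) (F r (S r s x))) (S t s x - G (t - s) x)))"

section \<open>The control system and the adjoint equation\<close>

text \<open>Mild solution with zero initial datum: \<open>y t = \<integral>\<^sub>0\<^sup>t S t s B(s) u(s) ds\<close>.\<close>

definition mild_solution ::
    "real \<Rightarrow> (real \<Rightarrow> real \<Rightarrow> 'y::real_normed_vector \<Rightarrow>\<^sub>L 'y) \<Rightarrow>
     (real \<Rightarrow> 'u::real_normed_vector \<Rightarrow>\<^sub>L 'y) \<Rightarrow> (real \<Rightarrow> 'u) \<Rightarrow> (real \<Rightarrow> 'y) \<Rightarrow> bool" where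
  "mild_solution T S B u y \<longleftrightarrow>
     (\<forall>t\<in>{0..T}. has_strong_integral (lebesgue_on {0<..<t}) (\<lambda>s. S t s (B s (u s))) (y t))"

definition final_states ::
    "real \<Rightarrow> (real \<Rightarrow> real \<Rightarrow> 'y::real_normed_vector \<Rightarrow>\<^sub>L 'y) \<Rightarrow>
     (real \<Rightarrow> 'u::real_normed_vector \<Rightarrow>\<^sub>L 'y) \<Rightarrow> (real \<Rightarrow> 'u) set \<Rightarrow> 'y set" where
  "final_states T S B W = {y T | y u. u \<in> W \<and> mild_solution T S B u y}"

definition reachable_set ::
    "ennreal \<Rightarrow> real \<Rightarrow> (real \<Rightarrow> real \<Rightarrow> 'y::real_normed_vector \<Rightarrow>\<^sub>L 'y) \<Rightarrow>
     (real \<Rightarrow> 'u::real_normed_vector \<Rightarrow>\<^sub>L 'y) \<Rightarrow> 'y set" where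
  "reachable_set p T S B = final_states T S B (Lp_space p T)"

definition finite_codim_approx_controllable ::
    "ennreal \<Rightarrow> real \<Rightarrow> (real \<Rightarrow> real \<Rightarrow> 'y::real_normed_vector \<Rightarrow>\<^sub>L 'y) \<Rightarrow>
     (real \<Rightarrow> 'u::real_normed_vector \<Rightarrow>\<^sub>L 'y) \<Rightarrow> bool" where
  "finite_codim_approx_controllable p T S B \<longleftrightarrow>
     finite_codim_subspace (closure (reachable_set p T S B))"

text \<open>Mild solution of \<open>\<phi>\<^sub>t = - A\<^sup>* \<phi> - F(t)\<^sup>* \<phi>\<close> on \<open>(0,T)\<close>, \<open>\<phi>(T) = \<phi>T\<close>: with \<open>G\<close> the semigroup
  generated by \<open>A\<^sup>*\<close> on the dual space,
  \<open>\<phi> t = G (T - t) \<phi>T + \<integral>\<^sub>t\<^sup>T G (s - t) F(s)\<^sup>* \<phi>(s) ds\<close>.\<close>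

definition adjoint_mild_solution ::
    "real \<Rightarrow> 'y::real_normed_vector set \<Rightarrow> ('y \<Rightarrow> 'y) \<Rightarrow> (real \<Rightarrow> 'y \<Rightarrow>\<^sub>L 'y) \<Rightarrow>
     ('y \<Rightarrow>\<^sub>L real) \<Rightarrow> (real \<Rightarrow> 'y \<Rightarrow>\<^sub>L real) \<Rightarrow> bool" where
  "adjoint_mild_solution T D A F \<phi>T \<phi> \<longleftrightarrow>
     continuous_on {0..T} \<phi> \<and>
     (\<exists>G. generates_C0_semigroup (adjoint_dom D A) (adjoint_op D A) G \<and>
        (\<forall>t\<in>{0..T}. has_strong_integral (lebesgue_on {t<..<T})
           (\<lambda>s. G (s - t) (dual_adjoint (F s) (\<phi> s))) (\<phi> t - G (T - t) \<phi>T)))"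

end

theory Submission
  imports Defs
begin

text \<open>
  All three assertions say that one and the same space of functionals is finite dimensional: the
  annihilator \<open>R\<^sup>\<bottom>\<close> of the reachable set \<open>R\<close>.

  By the Hahn--Banach theorem a closed subspace is finite codimensional if and only if its
  annihilator is finite dimensional (\<open>finite_codim_iff_finite_dim_annihilator\<close>).  As closure and span
  do not change annihilators, the first assertion is about \<open>R\<^sup>\<bottom>\<close>, the second about \<open>M\<^sup>\<bottom>\<close>.

  A functional \<open>\<phi>\<close>, evaluated at the final state that belongs to a control \<open>u\<close>, gives the integral of
  \<open>B(t)\<^sup>* S(T,t)\<^sup>* \<phi>\<close> applied to \<open>u(t)\<close>.  This is linear and continuous in \<open>u\<close>.  If it vanishes for all
  \<open>u\<close> in the given set, it vanishes on the closed convex hull of this set, hence on a ball, hence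
  everywhere: \<open>M\<^sup>\<bottom> = R\<^sup>\<bottom>\<close> (\<open>annihilator_restricted_controls\<close>).  If it vanishes for all \<open>u\<close>, then
  \<open>B(t)\<^sup>* S(T,t)\<^sup>* \<phi> = 0\<close> almost everywhere, and conversely (\<open>annihilator_reachable_set\<close>).

  It remains to see that the adjoint equation has, for every final datum \<open>\<phi>T\<close>, the mild
  solution \<open>t \<mapsto> S(T,t)\<^sup>* \<phi>T\<close> and no other one; then the third assertion says that \<open>R\<^sup>\<bottom>\<close> is the required
  finite dimensional space (\<open>observability_iff\<close>).  On a reflexive space, the adjoints of a
  \<open>C\<^sub>0\<close>-semigroup are strongly continuous and are the only semigroup generated by the adjoint of the
  generator (\<open>adjoint_C0_semigroup\<close>, \<open>adjoint_semigroup_generator\<close>, \<open>adjoint_semigroup_unique\<close>).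
  Existence and uniqueness for the equation itself are shown without product integrals: the
  pairings that ought to be constant in time change by \<open>O(h * h)\<close> over each step of length \<open>h\<close>, so
  their derivative is zero (\<open>constant_if_small_increments\<close>, \<open>weak_adjoint_solution_unique\<close>,
  \<open>functional_dual_duhamel\<close>).
\<close>

section \<open>Hahn--Banach separation and uniform boundedness\<close>

definition sublinear_functional :: "('a::real_vector \<Rightarrow> real) \<Rightarrow> bool" where
  "sublinear_functional f \<longleftrightarrow>
     f 0 = 0 \<and> (\<forall>x y. f (x + y) \<le> f x + f y) \<and> (\<forall>c x. c > 0 \<longrightarrow> f (c *\<^sub>R x) = c * f x)"

lemma sublinear_functional_lower_bound:
  assumes "sublinear_functional f" shows "- f (- x) \<le> f x"
proof -
  have "f (x + (- x)) \<le> f x + f (- x)" "f 0 = 0"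
    using assms unfolding sublinear_functional_def by blast+
  then show ?thesis by simp
qed

text \<open>Removing from \<open>f (x + t y)\<close> the growth \<open>t * f y\<close> that is due to the ray alone, and taking the
  infimum, makes \<open>f\<close> smaller but keeps it sublinear.  The choice \<open>t = 1\<close> gives the last inequality,
  which is the missing half of additivity when \<open>f\<close> cannot be made smaller.\<close>

lemma sublinear_functional_ray:
  fixes f :: "'a::real_vector \<Rightarrow> real" and y :: 'a
  assumes f: "sublinear_functional f"
  defines "g \<equiv> \<lambda>x. INF t\<in>{0..}. f (x + t *\<^sub>R y) - t * f y"
  shows "sublinear_functional g" and "g x \<le> f x" and "g x \<le> f (x + y) - f y"
proof -
  have f0: "f 0 = 0" and fadd: "\<And>x y. f (x + y) \<le> f x + f y"
    and fsc: "\<And>c x. c > 0 \<Longrightarrow> f (c *\<^sub>R x) = c * f x"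
    using f by (auto simp: sublinear_functional_def)
  have fsc0: "f (c *\<^sub>R x) = c * f x" if "c \<ge> 0" for c x
    using fsc[of c x] f0 that by (cases "c = 0") auto
  have low: "- f (- x) \<le> f (x + t *\<^sub>R y) - t * f y" if "t \<ge> 0" for x t
  proof -
    have "f (t *\<^sub>R y) \<le> f (x + t *\<^sub>R y) + f (- x)"
      using fadd[of "x + t *\<^sub>R y" "- x"] by simp
    then show ?thesis using fsc0[OF that, of y] by simp
  qed
  have bdd: "bdd_below ((\<lambda>t. f (x + t *\<^sub>R y) - t * f y) ` {0..})" for x
    using low by (intro bdd_belowI[of _ "- f (- x)"]) auto
  have up: "g x \<le> f (x + t *\<^sub>R y) - t * f y" if "t \<ge> 0" for x t
    unfolding g_def by (rule cINF_lower[OF bdd]) (use that in auto)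
  show le: "g x \<le> f x" for x using up[of 0 x] by simp
  show "g x \<le> f (x + y) - f y" using up[of 1 x] by simp
  have ge: "c \<le> g x" if "\<And>t. t \<ge> 0 \<Longrightarrow> c \<le> f (x + t *\<^sub>R y) - t * f y" for c x
    unfolding g_def by (rule cINF_greatest) (use that in auto)
  have gsc: "c * g x \<le> g (c *\<^sub>R x)" if c: "c > 0" for c x
  proof (rule ge)
    fix t :: real assume t: "t \<ge> 0"
    have "c * g x \<le> c * (f (x + (t / c) *\<^sub>R y) - (t / c) * f y)"
      using up[of "t / c" x] t c by (intro mult_left_mono) auto
    also have "\<dots> = f (c *\<^sub>R x + t *\<^sub>R y) - t * f y"
      using fsc[OF c, of "x + (t / c) *\<^sub>R y"] c by (simp add: algebra_simps)
    finally show "c * g x \<le> f (c *\<^sub>R x + t *\<^sub>R y) - t * f y" .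
  qed
  show "sublinear_functional g"
    unfolding sublinear_functional_def
  proof (intro conjI allI impI)
    show "g 0 = 0" using le[of 0] f0 low[of _ 0] ge[of 0 0] by force
  next
    fix u v
    have "g (u + v) - (f (u + s *\<^sub>R y) - s * f y) \<le> f (v + t *\<^sub>R y) - t * f y"
      if "s \<ge> 0" "t \<ge> 0" for s t
      using up[of "s + t" "u + v"] fadd[of "u + s *\<^sub>R y" "v + t *\<^sub>R y"] that
      by (simp add: algebra_simps)
    then have "g (u + v) - (f (u + s *\<^sub>R y) - s * f y) \<le> g v" if "s \<ge> 0" for s
      using that by (intro ge) auto
    then have "g (u + v) - g v \<le> f (u + s *\<^sub>R y) - s * f y" if "s \<ge> 0" for s
      using that by force
    then have "g (u + v) - g v \<le> g u" by (rule ge)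
    then show "g (u + v) \<le> g u + g v" by simp
  next
    fix c :: real and x assume c: "c > 0"
    have "(1 / c) * g (c *\<^sub>R x) \<le> g ((1 / c) *\<^sub>R (c *\<^sub>R x))" using c by (intro gsc) auto
    then have "g (c *\<^sub>R x) \<le> c * g x" using c by (simp add: field_simps)
    then show "g (c *\<^sub>R x) = c * g x" using gsc[OF c, of x] by simp
  qed
qed

text \<open>Zorn's lemma for the pointwise order: the infimum of a chain of sublinear functionals is
  sublinear, and a minimal one coincides with all its modifications along rays, so it is linear.\<close>

lemma linear_functional_below_sublinear:
  fixes q :: "'a::real_vector \<Rightarrow> real"
  assumes q: "sublinear_functional q"
  obtains f where "linear f" "\<And>x. f x \<le> q x"
proof -
  let ?A = "{f. sublinear_functional f \<and> f \<le> q}"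
  let ?r = "{(f, g). f \<in> ?A \<and> g \<in> ?A \<and> g \<le> f}"
  have fld: "Field ?r = ?A" by (auto simp: Field_def)
  have po: "Partial_order ?r"
    unfolding partial_order_on_def preorder_on_def fld
    by (auto simp: refl_on_def trans_def antisym_def intro: order_trans)
  have "\<exists>m\<in>Field ?r. \<forall>a\<in>Field ?r. (m, a) \<in> ?r \<longrightarrow> a = m"
  proof (rule Zorns_po_lemma[OF po])
    fix C assume C: "C \<in> Chains ?r"
    show "\<exists>u\<in>Field ?r. \<forall>a\<in>C. (a, u) \<in> ?r"
    proof (cases "C = {}")
      case True
      then show ?thesis using q fld by auto
    next
      case False
      have CA: "sublinear_functional f" "f \<le> q" if "f \<in> C" for f
        using C that by (auto simp: Chains_def)
      have chain: "f \<le> g \<or> g \<le> f" if "f \<in> C" "g \<in> C" for f g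
        using C that by (auto simp: Chains_def)
      define u where "u x = (INF f\<in>C. f x)" for x
      have bdd: "bdd_below ((\<lambda>f. f x) ` C)" for x
      proof (intro bdd_belowI[of _ "- q (- x)"], clarify)
        fix f assume f: "f \<in> C"
        then have "f (- x) \<le> q (- x)" using CA(2)[OF f] by (simp add: le_fun_def)
        then show "- q (- x) \<le> f x"
          using sublinear_functional_lower_bound[OF CA(1)[OF f], of x] by simp
      qed
      have up: "u x \<le> f x" if "f \<in> C" for f x
        unfolding u_def by (rule cINF_lower[OF bdd that])
      have ge: "c \<le> u x" if "\<And>f. f \<in> C \<Longrightarrow> c \<le> f x" for c x
        unfolding u_def by (rule cINF_greatest[OF False that])
      have fadd: "f (x + y) \<le> f x + f y" if "f \<in> C" for f x y
        using CA(1)[OF that] by (auto simp: sublinear_functional_def)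
      have fsc: "f (c *\<^sub>R x) = c * f x" if "f \<in> C" "c > 0" for f c x
        using CA(1)[OF that(1)] that(2) by (auto simp: sublinear_functional_def)
      have gsc: "c * u x \<le> u (c *\<^sub>R x)" if c: "c > 0" for c x
      proof (rule ge)
        fix f assume "f \<in> C"
        then show "c * u x \<le> f (c *\<^sub>R x)" using up[of f x] fsc[of f c x] c by simp
      qed
      have "sublinear_functional u"
        unfolding sublinear_functional_def
      proof (intro conjI allI impI)
        have "f 0 = 0" if "f \<in> C" for f using CA(1)[OF that] by (simp add: sublinear_functional_def)
        then have "(\<lambda>f. f 0) ` C = {0}" using False by force
        then show "u 0 = 0" by (simp add: u_def)
      next
        fix x y
        have "u (x + y) - f x \<le> g y" if f: "f \<in> C" and g: "g \<in> C" for f g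
        proof (cases "f \<le> g")
          case True
          then have "f y \<le> g y" by (simp add: le_fun_def)
          then show ?thesis using up[OF f, of "x + y"] fadd[OF f, of x y] by simp
        next
          case False
          then have "g x \<le> f x" using chain[OF f g] by (auto simp: le_fun_def)
          then show ?thesis using up[OF g, of "x + y"] fadd[OF g, of x y] by simp
        qed
        then have "u (x + y) - f x \<le> u y" if "f \<in> C" for f using that by (intro ge) auto
        then have "u (x + y) - u y \<le> u x" by (intro ge) force
        then show "u (x + y) \<le> u x + u y" by simp
      next
        fix c :: real and x assume c: "c > 0"
        have "(1 / c) * u (c *\<^sub>R x) \<le> u ((1 / c) *\<^sub>R (c *\<^sub>R x))" using c by (intro gsc) auto
        then have "u (c *\<^sub>R x) \<le> c * u x" using c by (simp add: field_simps)
        then show "u (c *\<^sub>R x) = c * u x" using gsc[OF c, of x] by simp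
      qed
      moreover have "u \<le> f" if "f \<in> C" for f using up[OF that] by (simp add: le_fun_def)
      ultimately show ?thesis
        unfolding fld using CA False by (intro bexI[of _ u]) (auto intro: order_trans)
    qed
  qed
  then obtain m where m: "sublinear_functional m" "m \<le> q"
    and min: "\<And>a. sublinear_functional a \<Longrightarrow> a \<le> m \<Longrightarrow> a = m"
    unfolding fld by (auto intro: order_trans)
  have madd: "m (x + y) = m x + m y" for x y
  proof -
    note ray = sublinear_functional_ray[OF m(1), where y = y]
    have "(\<lambda>x. INF t\<in>{0..}. m (x + t *\<^sub>R y) - t * m y) = m"
      using ray(1) ray(2) by (intro min) (auto simp: le_fun_def)
    then have "m x \<le> m (x + y) - m y" using ray(3)[of x] by (simp add: fun_eq_iff)
    then show ?thesis using m(1) unfolding sublinear_functional_def by (smt (verit))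
  qed
  have m0: "m 0 = 0" using m(1) by (simp add: sublinear_functional_def)
  have mneg: "m (- x) = - m x" for x using madd[of x "- x"] m0 by simp
  have mpos: "m (c *\<^sub>R x) = c * m x" if "c > 0" for c x
    using m(1) that by (simp add: sublinear_functional_def)
  have "linear m"
  proof (rule linearI)
    fix c :: real and x
    consider "c > 0" | "c = 0" | "c < 0" by linarith
    then show "m (c *\<^sub>R x) = c *\<^sub>R m x"
    proof cases
      case 3
      then show ?thesis using mpos[of "- c" x] mneg[of "(- c) *\<^sub>R x"] by simp
    qed (use mpos m0 in auto)
  qed (rule madd)
  then show thesis using m(2) that by (auto simp: le_fun_def)
qed

text \<open>The distance to a subspace is a sublinear functional; its modification along the ray through
  \<open>x\<close> forces the linear functional below it to be positive at \<open>x\<close>.\<close>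

lemma separating_functional:
  fixes V :: "'a::real_normed_vector set"
  assumes V: "subspace V" "closed V" and x: "x \<notin> V"
  obtains \<phi> :: "'a \<Rightarrow>\<^sub>L real" where "\<And>v. v \<in> V \<Longrightarrow> blinfun_apply \<phi> v = 0" "blinfun_apply \<phi> x \<noteq> 0"
proof -
  have V0: "0 \<in> V" "V \<noteq> {}" using V(1) subspace_0 by auto
  define q where "q z = infdist z V" for z
  have near: "\<exists>v\<in>V. dist z v < q z + e" if "e > 0" for z e
  proof (rule ccontr)
    assume "\<not> ?thesis"
    then have "q z + e \<le> infdist z V"
      unfolding infdist_notempty[OF V0(2)] by (intro cINF_greatest V0) force
    then show False using that by (simp add: q_def)
  qed
  have q_le: "q z \<le> norm (z - v)" if "v \<in> V" for z v
    using infdist_le[OF that, of z] by (simp add: q_def dist_norm)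
  have qsc: "q (c *\<^sub>R z) \<le> c * q z" if c: "c > 0" for c z
  proof (rule field_le_epsilon)
    fix e :: real assume "e > 0"
    then obtain v where v: "v \<in> V" "dist z v < q z + e / c" using near[of "e / c" z] c by auto
    have "q (c *\<^sub>R z) \<le> norm (c *\<^sub>R z - c *\<^sub>R v)"
      using v V(1) by (intro q_le) (auto intro: subspace_scale)
    also have "\<dots> = c * dist z v" using c by (simp add: dist_norm flip: scaleR_diff_right)
    also have "\<dots> \<le> c * (q z + e / c)" using v c by (intro mult_left_mono) auto
    also have "\<dots> = c * q z + e" using c by (simp add: field_simps)
    finally show "q (c *\<^sub>R z) \<le> c * q z + e" .
  qed
  have sub: "sublinear_functional q"
    unfolding sublinear_functional_def
  proof (intro conjI allI impI)
    show "q 0 = 0" using V0 by (simp add: q_def)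
  next
    fix y z
    show "q (y + z) \<le> q y + q z"
    proof (rule field_le_epsilon)
      fix e :: real assume "e > 0"
      then obtain v w where v: "v \<in> V" "dist y v < q y + e / 2" "w \<in> V" "dist z w < q z + e / 2"
        using near[of "e / 2"] by (meson half_gt_zero)
      have "q (y + z) \<le> norm (y + z - (v + w))"
        using v V(1) by (intro q_le) (auto intro: subspace_add)
      also have "\<dots> \<le> dist y v + dist z w"
        using norm_triangle_ineq[of "y - v" "z - w"] by (simp add: dist_norm algebra_simps)
      finally show "q (y + z) \<le> q y + q z + e" using v by simp
    qed
  next
    fix c :: real and z assume c: "c > 0"
    have "q ((1 / c) *\<^sub>R (c *\<^sub>R z)) \<le> (1 / c) * q (c *\<^sub>R z)" using c by (intro qsc) auto
    then have "c * q z \<le> q (c *\<^sub>R z)" using c by (simp add: field_simps)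
    then show "q (c *\<^sub>R z) = c * q z" using qsc[OF c, of z] by simp
  qed
  have qx: "q x > 0"
    using V V0 x infdist_nonneg[of x V] in_closed_iff_infdist_zero[of V x] by (simp add: q_def)
  note ray = sublinear_functional_ray[OF sub, where y = x]
  define g where "g z = (INF t\<in>{0..}. q (z + t *\<^sub>R x) - t * q x)" for z
  have g: "sublinear_functional g" "\<And>z. g z \<le> q z" "\<And>z. g z \<le> q (z + x) - q x"
    unfolding g_def using ray by blast+
  obtain f where f: "linear f" "\<And>z. f z \<le> g z"
    using linear_functional_below_sublinear[OF g(1)] by blast
  have q0: "q 0 = 0" using sub by (simp add: sublinear_functional_def)
  \<comment> \<open>At \<open>- x\<close> the modification along the ray is at most \<open>q 0 - q x\<close>.\<close>
  have "f (- x) \<le> - q x" using f(2)[of "- x"] g(3)[of "- x"] q0 by simp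
  then have fx: "f x \<noteq> 0" using qx linear_neg[OF f(1), of x] by simp
  have fq: "f z \<le> q z" for z using f(2)[of z] g(2)[of z] by simp
  have qn: "q z \<le> norm z" for z using q_le[OF V0(1), of z] by simp
  have bl: "bounded_linear f"
  proof (intro bounded_linear.intro[OF f(1)] bounded_linear_axioms.intro exI allI)
    fix z show "norm (f z) \<le> norm z * 1"
      using fq[of z] qn[of z] fq[of "- z"] qn[of "- z"] linear_neg[OF f(1), of z] by (simp add: abs_le_iff)
  qed
  have "f v = 0" if v: "v \<in> V" for v
  proof -
    have "- v \<in> V" using v V(1) by (rule subspace_neg[rotated])
    then have "q v = 0" "q (- v) = 0" using v by (simp_all add: q_def)
    then show ?thesis using fq[of v] fq[of "- v"] linear_neg[OF f(1), of v] by simp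
  qed
  then show thesis
    using that[of "Blinfun f"] fx by (simp add: bounded_linear_Blinfun_apply[OF bl])
qed

text \<open>Baire's theorem: one of the closed sets where the whole family is bounded by \<open>n\<close> has an
  interior point.\<close>

lemma uniform_boundedness:
  fixes f :: "'i \<Rightarrow> 'a::banach \<Rightarrow>\<^sub>L 'b::real_normed_vector"
  assumes pw: "\<And>x. \<exists>C. \<forall>i\<in>I. norm (f i x) \<le> C"
  obtains C where "C > 0" "\<And>i. i \<in> I \<Longrightarrow> norm (f i) \<le> C"
proof -
  define A where "A n = {x. \<forall>i\<in>I. norm (f i x) \<le> real n}" for n
  have cl: "closed (A n)" for n
  proof -
    have "A n = (\<Inter>i\<in>I. {x. norm (f i x) \<le> real n})" by (auto simp: A_def)
    moreover have "closed {x. norm (f i x) \<le> real n}" for i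
      by (intro closed_Collect_le continuous_intros)
    ultimately show ?thesis by auto
  qed
  have un: "(\<Union>n. A n) = UNIV"
  proof -
    have "\<exists>n. x \<in> A n" for x
    proof -
      obtain C where "\<forall>i\<in>I. norm (f i x) \<le> C" using pw by blast
      moreover obtain n where "C \<le> real n" using real_arch_simple by blast
      ultimately show ?thesis by (auto simp: A_def intro: order_trans)
    qed
    then show ?thesis by auto
  qed
  have "\<exists>n. interior (A n) \<noteq> {}"
  proof (rule ccontr)
    assume none: "\<not> ?thesis"
    have "euclidean interior_of \<Union>(range A) = {}"
      using none cl
      by (intro Baire_category_alt) (auto simp: completely_metrizable_space_euclidean)
    then show False using un by simp
  qed
  then obtain n x where "x \<in> interior (A n)" by blast
  then obtain e where e: "e > 0" "ball x e \<subseteq> A n" using mem_interior by blast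
  define C where "C = 4 * real n / e + 1"
  have C: "C > 0" using e by (simp add: C_def add_nonneg_pos)
  have "norm (f i) \<le> C" if i: "i \<in> I" for i
  proof (rule norm_blinfun_bound)
    show "C \<ge> 0" using C by simp
    fix z
    show "norm (f i z) \<le> C * norm z"
    proof (cases "z = 0")
      case False
      define c where "c = e / (2 * norm z)"
      have c: "c > 0" using e False by (simp add: c_def)
      have "norm (c *\<^sub>R z) < e" using e False by (simp add: c_def)
      then have "x + c *\<^sub>R z \<in> A n" "x \<in> A n" using e by (auto simp: subset_iff dist_norm)
      then have "norm (f i (x + c *\<^sub>R z)) \<le> real n" "norm (f i x) \<le> real n"
        using i by (auto simp: A_def)
      then have "norm (f i (x + c *\<^sub>R z) - f i x) \<le> 2 * real n"
        using norm_triangle_ineq4[of "f i (x + c *\<^sub>R z)" "f i x"] by simp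
      then have "c * norm (f i z) \<le> 2 * real n"
        using c by (simp add: blinfun.add_right blinfun.scaleR_right)
      then have "norm (f i z) \<le> (4 * real n / e) * norm z"
        using e False by (simp add: c_def field_simps)
      also have "\<dots> \<le> C * norm z" unfolding C_def by (intro mult_right_mono) auto
      finally show ?thesis .
    qed simp
  qed
  then show thesis using that C by blast
qed

section \<open>Finite codimension by duality\<close>

text \<open>A spanning complement of least cardinality avoids the subspace and is independent.\<close>

lemma finite_codim_subspace_iff_finite_complement:
  fixes V :: "'a::real_vector set"
  shows "finite_codim_subspace V \<longleftrightarrow> subspace V \<and> (\<exists>c. finite c \<and> span (V \<union> c) = UNIV)"
proof
  assume "subspace V \<and> (\<exists>c. finite c \<and> span (V \<union> c) = UNIV)"
  then have V: "subspace V" and ex: "\<exists>n c. finite c \<and> span (V \<union> c) = UNIV \<and> card c = n" by auto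
  define n where "n = (LEAST n. \<exists>c. finite c \<and> span (V \<union> c) = UNIV \<and> card c = n)"
  obtain c where c: "finite c" "span (V \<union> c) = UNIV" "card c = n"
    using LeastI_ex[OF ex] unfolding n_def by blast
  have key: "z \<notin> span (V \<union> (c - {z}))" if z: "z \<in> c" for z
  proof
    assume "z \<in> span (V \<union> (c - {z}))"
    then have "span (insert z (V \<union> (c - {z}))) = span (V \<union> (c - {z}))" by (rule span_redundant)
    moreover have "insert z (V \<union> (c - {z})) = V \<union> c" using z by auto
    ultimately have "span (V \<union> (c - {z})) = UNIV" using c(2) by simp
    then have "n \<le> card (c - {z})"
      using c(1) unfolding n_def by (intro Least_le) blast
    then show False using c z card_Diff1_less[of c z] by simp
  qed
  have "independent c"
    unfolding dependent_def using key span_mono[of "c - {z}" "V \<union> (c - {z})" for z] by blast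
  moreover have "c \<subseteq> - V" using key by (auto intro: span_base)
  ultimately show "finite_codim_subspace V"
    unfolding finite_codim_subspace_def using V c by blast
qed (auto simp: finite_codim_subspace_def)

definition annihilator :: "'a::real_normed_vector set \<Rightarrow> ('a \<Rightarrow>\<^sub>L real) set" where
  "annihilator V = {\<phi>. \<forall>v\<in>V. blinfun_apply \<phi> v = 0}"

lemma subspace_annihilator: "subspace (annihilator V)"
  by (auto simp: annihilator_def subspace_def blinfun.add_left blinfun.scaleR_left)

lemma annihilator_closure: "annihilator (closure V) = annihilator V"
proof
  show "annihilator (closure V) \<subseteq> annihilator V"
    using closure_subset by (auto simp: annihilator_def)
  show "annihilator V \<subseteq> annihilator (closure V)"
  proof
    fix \<phi> assume "\<phi> \<in> annihilator V"
    then have "V \<subseteq> {v. blinfun_apply \<phi> v = 0}" by (auto simp: annihilator_def)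
    moreover have "closed {v. blinfun_apply \<phi> v = 0}"
      by (intro closed_Collect_eq continuous_intros)
    ultimately have "closure V \<subseteq> {v. blinfun_apply \<phi> v = 0}" by (rule closure_minimal)
    then show "\<phi> \<in> annihilator (closure V)" by (auto simp: annihilator_def)
  qed
qed

text \<open>Each point of \<open>c\<close> can lower the dimension of the space of functionals by at most one.\<close>

lemma finite_dim_if_determined_on_finite_set:
  fixes N :: "('a::real_normed_vector \<Rightarrow>\<^sub>L real) set"
  assumes "finite c" "subspace N"
    and "\<And>\<phi>. \<phi> \<in> N \<Longrightarrow> (\<forall>z\<in>c. blinfun_apply \<phi> z = 0) \<Longrightarrow> \<phi> = 0"
  shows "finite_dim_subspace N"
  using assms
proof (induction c arbitrary: N rule: finite_induct)
  case empty
  then have "N = {0}" using subspace_0 by fastforce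
  then show ?case by (auto simp: finite_dim_subspace_def intro!: exI[of _ "{}"])
next
  case (insert z c)
  define N' where "N' = {\<phi>\<in>N. blinfun_apply \<phi> z = 0}"
  have "finite_dim_subspace N'"
  proof (rule insert.IH)
    show "subspace N'"
      using insert.prems(1)
      by (auto simp: N'_def subspace_def blinfun.add_left blinfun.scaleR_left)
  qed (use insert.prems(2) in \<open>auto simp: N'_def\<close>)
  then obtain b where b: "finite b" "span b = N'" by (auto simp: finite_dim_subspace_def)
  show ?case
  proof (cases "N' = N")
    case True
    then show ?thesis using b insert.prems(1) by (auto simp: finite_dim_subspace_def)
  next
    case False
    then obtain \<psi> where \<psi>: "\<psi> \<in> N" "blinfun_apply \<psi> z \<noteq> 0" by (auto simp: N'_def)
    have "span (insert \<psi> b) \<subseteq> N"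
      using b(2) \<psi>(1) insert.prems(1) span_superset[of b] by (intro span_minimal) (auto simp: N'_def)
    moreover have "\<phi> \<in> span (insert \<psi> b)" if \<phi>: "\<phi> \<in> N" for \<phi>
    proof -
      let ?k = "blinfun_apply \<phi> z / blinfun_apply \<psi> z"
      have "\<phi> - ?k *\<^sub>R \<psi> \<in> N'"
        using \<phi> \<psi> insert.prems(1)
        by (auto simp: N'_def blinfun.diff_left blinfun.scaleR_left intro: subspace_diff subspace_scale)
      then show ?thesis unfolding span_insert using b(2) by blast
    qed
    ultimately show ?thesis
      using b insert.prems(1) unfolding finite_dim_subspace_def
      by (intro conjI exI[of _ "insert \<psi> b"]) auto
  qed
qed

text \<open>Conversely, each functional cuts the codimension by at most one.\<close>

lemma finite_complement_of_common_kernel: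
  fixes \<Phi> :: "('a::real_normed_vector \<Rightarrow>\<^sub>L real) set"
  assumes "finite \<Phi>"
  shows "\<exists>c. finite c \<and> span ({x. \<forall>\<phi>\<in>\<Phi>. blinfun_apply \<phi> x = 0} \<union> c) = UNIV"
  using assms
proof (induction \<Phi> rule: finite_induct)
  case empty
  then show ?case by (intro exI[of _ "{}"]) simp
next
  case (insert \<phi> \<Phi>)
  let ?V = "{x. \<forall>\<phi>\<in>\<Phi>. blinfun_apply \<phi> x = 0}"
  let ?W = "{x. \<forall>\<phi>\<in>insert \<phi> \<Phi>. blinfun_apply \<phi> x = 0}"
  obtain c where c: "finite c" "span (?V \<union> c) = UNIV" using insert.IH by blast
  show ?case
  proof (cases "\<forall>x\<in>?V. blinfun_apply \<phi> x = 0")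
    case True
    then have W: "?W = ?V" by auto
    show ?thesis unfolding W by (rule exI[of _ c]) (use c in blast)
  next
    case False
    then obtain z where z: "z \<in> ?V" "blinfun_apply \<phi> z \<noteq> 0" by blast
    have "?V \<subseteq> span (?W \<union> insert z c)"
    proof
      fix x assume x: "x \<in> ?V"
      let ?k = "blinfun_apply \<phi> x / blinfun_apply \<phi> z"
      have "x - ?k *\<^sub>R z \<in> ?W"
        using x z by (auto simp: blinfun.diff_right blinfun.scaleR_right)
      then have "x - ?k *\<^sub>R z \<in> span (?W \<union> insert z c)" by (intro span_base) auto
      moreover have "?k *\<^sub>R z \<in> span (?W \<union> insert z c)" by (intro span_scale span_base) auto
      ultimately have "(x - ?k *\<^sub>R z) + ?k *\<^sub>R z \<in> span (?W \<union> insert z c)" by (rule span_add)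
      then show "x \<in> span (?W \<union> insert z c)" by simp
    qed
    then have "span (?V \<union> c) \<subseteq> span (?W \<union> insert z c)"
      by (intro span_minimal) (auto intro: span_base)
    then show ?thesis using c by (intro exI[of _ "insert z c"]) auto
  qed
qed

text \<open>A closed subspace is the common kernel of its annihilator, hence of finitely many functionals
  when the annihilator is finite dimensional.\<close>

lemma finite_codim_iff_finite_dim_annihilator:
  fixes V :: "'a::real_normed_vector set"
  assumes V: "subspace V" "closed V"
  shows "finite_codim_subspace V \<longleftrightarrow> finite_dim_subspace (annihilator V)"
proof
  assume "finite_codim_subspace V"
  then obtain c where c: "finite c" "span (V \<union> c) = UNIV"
    by (auto simp: finite_codim_subspace_iff_finite_complement)
  show "finite_dim_subspace (annihilator V)"
  proof (rule finite_dim_if_determined_on_finite_set[OF c(1) subspace_annihilator])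
    fix \<phi> :: "'a \<Rightarrow>\<^sub>L real" assume \<phi>: "\<phi> \<in> annihilator V" "\<forall>z\<in>c. blinfun_apply \<phi> z = 0"
    have "V \<union> c \<subseteq> {x. blinfun_apply \<phi> x = 0}" using \<phi> by (auto simp: annihilator_def)
    moreover have "subspace {x. blinfun_apply \<phi> x = 0}"
      by (auto simp: subspace_def blinfun.add_right blinfun.scaleR_right)
    ultimately have "span (V \<union> c) \<subseteq> {x. blinfun_apply \<phi> x = 0}" by (rule span_minimal)
    then have "blinfun_apply \<phi> x = 0" for x using c(2) by auto
    then show "\<phi> = 0" by (intro blinfun_eqI) simp
  qed
next
  assume "finite_dim_subspace (annihilator V)"
  then obtain b where b: "finite b" "span b = annihilator V" by (auto simp: finite_dim_subspace_def)
  have "{x. \<forall>\<phi>\<in>b. blinfun_apply \<phi> x = 0} = V"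
  proof
    show "V \<subseteq> {x. \<forall>\<phi>\<in>b. blinfun_apply \<phi> x = 0}"
      using span_superset[of b] b(2) by (auto simp: annihilator_def)
    show "{x. \<forall>\<phi>\<in>b. blinfun_apply \<phi> x = 0} \<subseteq> V"
    proof (rule ccontr)
      assume "\<not> ?thesis"
      then obtain x where x: "\<And>\<phi>. \<phi> \<in> b \<Longrightarrow> blinfun_apply \<phi> x = 0" "x \<notin> V" by blast
      obtain \<psi> :: "'a \<Rightarrow>\<^sub>L real" where \<psi>: "\<And>v. v \<in> V \<Longrightarrow> blinfun_apply \<psi> v = 0" "blinfun_apply \<psi> x \<noteq> 0"
        using separating_functional[OF V x(2)] by blast
      have "b \<subseteq> {\<phi>. blinfun_apply \<phi> x = 0}" using x by auto
      moreover have "subspace {\<phi>. blinfun_apply \<phi> x = 0}"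
        by (auto simp: subspace_def blinfun.add_left blinfun.scaleR_left)
      ultimately have "span b \<subseteq> {\<phi>. blinfun_apply \<phi> x = 0}" by (rule span_minimal)
      then show False using \<psi> b(2) by (auto simp: annihilator_def)
    qed
  qed
  then show "finite_codim_subspace V"
    using finite_complement_of_common_kernel[OF b(1)] V(1)
    by (auto simp: finite_codim_subspace_iff_finite_complement)
qed

section \<open>Strong measurability and the strong integral\<close>

lemma complete_measure_lebesgue_on:
  assumes "S \<in> sets lebesgue"
  shows "complete_measure (lebesgue_on S)"
proof
  fix A B :: "'a set"
  assume "B \<subseteq> A" "A \<in> null_sets (lebesgue_on S)"
  then have "A \<in> null_sets lebesgue" "A \<subseteq> S" using assms by (auto simp: null_sets_restrict_space)
  then have "B \<in> sets lebesgue" "B \<subseteq> S"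
    using \<open>B \<subseteq> A\<close> completion.complete by (blast, blast)
  then show "B \<in> sets (lebesgue_on S)" using assms by (auto simp: sets_restrict_space_iff)
qed

abbreviation (input) Leb :: "real \<Rightarrow> real \<Rightarrow> real measure" where
  "Leb a b \<equiv> lebesgue_on {a<..<b}"

lemma complete_measure_interval [simp]: "complete_measure (Leb a b)"
  by (rule complete_measure_lebesgue_on) simp

text \<open>Completeness of the measure absorbs the null set without convergence.\<close>

lemma borel_measurable_AE_limit:
  fixes f :: "nat \<Rightarrow> 'a \<Rightarrow> real"
  assumes M: "complete_measure M" and f: "\<And>n. f n \<in> borel_measurable M"
    and lim: "AE x in M. (\<lambda>n. f n x) \<longlonglongrightarrow> g x"
  shows "g \<in> borel_measurable M"
proof (rule measurableI)
  fix A :: "real set" assume A: "A \<in> sets borel"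
  have h: "(\<lambda>x. lim (\<lambda>n. f n x)) \<in> borel_measurable M" using f by measurable
  have "AE x in M. x \<in> (\<lambda>x. lim (\<lambda>n. f n x)) -` A \<inter> space M \<longleftrightarrow> x \<in> g -` A \<inter> space M"
    using lim AE_space by eventually_elim (auto dest: limI)
  then show "g -` A \<inter> space M \<in> sets M"
    using complete_measure.in_sets_AE[OF M] measurable_sets[OF h A] by blast
qed simp

lemma strongly_measurable_compose:
  fixes h :: "'b::real_normed_vector \<Rightarrow> 'c::real_normed_vector"
  assumes f: "strongly_measurable M f" and h: "continuous_on UNIV h"
  shows "strongly_measurable M (\<lambda>x. h (f x))"
proof -
  obtain s where s: "\<And>n. simple_function M (s n)" "AE x in M. (\<lambda>n. s n x) \<longlonglongrightarrow> f x"
    using f unfolding strongly_measurable_def by blast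
  have "AE x in M. (\<lambda>n. h (s n x)) \<longlonglongrightarrow> h (f x)"
    using s(2)
    by eventually_elim (use h in \<open>auto simp: continuous_on_def intro: tendsto_compose\<close>)
  moreover have "simple_function M (\<lambda>x. h (s n x))" for n
    using s(1) by (rule simple_function_compose1)
  ultimately show ?thesis
    unfolding strongly_measurable_def by (intro exI[of _ "\<lambda>n x. h (s n x)"]) simp
qed

lemma strongly_measurable_compose2:
  fixes h :: "'b::real_normed_vector \<Rightarrow> 'c::real_normed_vector \<Rightarrow> 'd::real_normed_vector"
  assumes f: "strongly_measurable M f" and g: "strongly_measurable M g"
    and h: "\<And>X Y x y. X \<longlonglongrightarrow> x \<Longrightarrow> Y \<longlonglongrightarrow> y \<Longrightarrow> (\<lambda>n::nat. h (X n) (Y n)) \<longlonglongrightarrow> h x y"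
  shows "strongly_measurable M (\<lambda>x. h (f x) (g x))"
proof -
  obtain s where s: "\<And>n. simple_function M (s n)" "AE x in M. (\<lambda>n. s n x) \<longlonglongrightarrow> f x"
    using f unfolding strongly_measurable_def by blast
  obtain r where r: "\<And>n. simple_function M (r n)" "AE x in M. (\<lambda>n. r n x) \<longlonglongrightarrow> g x"
    using g unfolding strongly_measurable_def by blast
  have "AE x in M. (\<lambda>n. h (s n x) (r n x)) \<longlonglongrightarrow> h (f x) (g x)"
    using s(2) r(2) by eventually_elim (rule h)
  moreover have "simple_function M (\<lambda>x. h (s n x) (r n x))" for n
    using s(1) r(1) by (rule simple_function_compose2)
  ultimately show ?thesis unfolding strongly_measurable_def
    by (intro exI[of _ "\<lambda>n x. h (s n x) (r n x)"]) simp
qed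

lemma strongly_measurable_add:
  "strongly_measurable M f \<Longrightarrow> strongly_measurable M g \<Longrightarrow> strongly_measurable M (\<lambda>x. f x + g x)"
  by (erule (1) strongly_measurable_compose2) (rule tendsto_add)

lemma strongly_measurable_diff:
  "strongly_measurable M f \<Longrightarrow> strongly_measurable M g \<Longrightarrow> strongly_measurable M (\<lambda>x. f x - g x)"
  by (erule (1) strongly_measurable_compose2) (rule tendsto_diff)

lemma strongly_measurable_blinfun_apply:
  "strongly_measurable M f \<Longrightarrow> strongly_measurable M g \<Longrightarrow>
    strongly_measurable M (\<lambda>x. blinfun_apply (f x) (g x))"
  by (erule (1) strongly_measurable_compose2) (rule blinfun.tendsto)

lemma strongly_measurable_real_imp_borel:
  fixes f :: "'a \<Rightarrow> real"
  assumes "complete_measure M" "strongly_measurable M f"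
  shows "f \<in> borel_measurable M"
  using assms borel_measurable_AE_limit[OF assms(1)] borel_measurable_simple_function
  unfolding strongly_measurable_def by blast

lemma borel_imp_strongly_measurable_real:
  fixes f :: "'a \<Rightarrow> real"
  assumes "f \<in> borel_measurable M"
  shows "strongly_measurable M f"
proof -
  obtain s where "\<And>i. simple_function M (s i)" "\<And>x. x \<in> space M \<Longrightarrow> (\<lambda>i. s i x) \<longlonglongrightarrow> f x"
    using borel_measurable_implies_sequence_metric[OF assms, of 0] by metis
  then show ?thesis unfolding strongly_measurable_def by (intro exI[of _ s]) auto
qed

lemma strongly_measurable_norm_borel:
  assumes "complete_measure M" "strongly_measurable M f"
  shows "(\<lambda>x. norm (f x)) \<in> borel_measurable M"
  using strongly_measurable_compose[OF assms(2), of norm]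
  by (intro strongly_measurable_real_imp_borel[OF assms(1)]) (auto intro: continuous_intros)

lemma strongly_measurable_const: "strongly_measurable M (\<lambda>x. c)"
  unfolding strongly_measurable_def by (intro exI[of _ "\<lambda>n x. c"]) auto

lemma AE_lebesgue_on_Ioo:
  "(AE t in Leb a b. P t) \<longleftrightarrow>
     (\<exists>N. negligible N \<and> (\<forall>t. a < t \<and> t < b \<and> t \<notin> N \<longrightarrow> P t))"
proof
  assume "AE t in Leb a b. P t"
  then have "AE t in lebesgue. t \<in> {a<..<b} \<longrightarrow> P t" by (simp add: AE_restrict_space_iff)
  then obtain N where "N \<in> null_sets lebesgue" "{t\<in>space lebesgue. \<not> (t \<in> {a<..<b} \<longrightarrow> P t)} \<subseteq> N"
    by (rule AE_E3) auto
  then show "\<exists>N. negligible N \<and> (\<forall>t. a < t \<and> t < b \<and> t \<notin> N \<longrightarrow> P t)"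
    by (intro exI[of _ N]) (auto simp: negligible_iff_null_sets)
next
  assume "\<exists>N. negligible N \<and> (\<forall>t. a < t \<and> t < b \<and> t \<notin> N \<longrightarrow> P t)"
  then obtain N where N: "negligible N" "\<And>t. a < t \<Longrightarrow> t < b \<Longrightarrow> t \<notin> N \<Longrightarrow> P t" by blast
  have "AE t in lebesgue. t \<in> {a<..<b} \<longrightarrow> P t"
    using N by (intro AE_I'[of N]) (auto simp: negligible_iff_null_sets)
  then show "AE t in Leb a b. P t" by (simp add: AE_restrict_space_iff)
qed

lemma strongly_measurable_subinterval:
  assumes f: "strongly_measurable (Leb a b) f" and "a \<le> c" "d \<le> b"
  shows "strongly_measurable (Leb c d) f"
proof -
  obtain s where s: "\<And>n. simple_function (Leb a b) (s n)"
      "AE x in Leb a b. (\<lambda>n. s n x) \<longlonglongrightarrow> f x"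
    using f unfolding strongly_measurable_def by blast
  have sub: "{c<..<d} \<subseteq> {a<..<b}" using assms by auto
  have "simple_function (Leb c d) (s n)" for n
    unfolding simple_function_def
  proof (intro conjI ballI)
    have "s n ` {c<..<d} \<subseteq> s n ` {a<..<b}" using sub by auto
    then show "finite (s n ` space (Leb c d))"
      using simple_functionD(1)[OF s(1)[of n]] finite_subset by (auto simp: space_restrict_space)
  next
    fix x
    have "s n -` {x} \<inter> {a<..<b} \<in> sets (Leb a b)"
      using simple_functionD(2)[OF s(1)[of n], of "{x}"] by (simp add: space_restrict_space)
    then have "s n -` {x} \<inter> {a<..<b} \<in> sets lebesgue" by (auto simp: sets_restrict_space_iff)
    then have "(s n -` {x} \<inter> {a<..<b}) \<inter> {c<..<d} \<in> sets lebesgue" by (rule sets.Int) simp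
    moreover have "(s n -` {x} \<inter> {a<..<b}) \<inter> {c<..<d} = s n -` {x} \<inter> {c<..<d}" using sub by auto
    ultimately show "s n -` {x} \<inter> space (Leb c d) \<in> sets (Leb c d)"
      by (simp add: sets_restrict_space_iff space_restrict_space)
  qed
  moreover have "AE x in Leb c d. (\<lambda>n. s n x) \<longlonglongrightarrow> f x"
    using s(2) assms(2,3) unfolding AE_lebesgue_on_Ioo by fastforce
  ultimately show ?thesis
    unfolding strongly_measurable_def by (intro exI[of _ s]) simp
qed

text \<open>Rounding down to multiples of \<open>1 / Suc n\<close>, clipped to \<open>{a..b}\<close>, has finitely many values on the
  interval.\<close>

lemma simple_grid_approximation:
  fixes a b :: real
  obtains r where "\<And>n. simple_function (Leb a b) (r n)"
    and "\<And>n s. a \<le> b \<Longrightarrow> r n s \<in> {a..b}" and "\<And>s. s \<in> {a<..<b} \<Longrightarrow> (\<lambda>n. r n s) \<longlonglongrightarrow> s"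
proof -
  define r where "r n s = max a (min b (of_int \<lfloor>real (Suc n) * s\<rfloor> / real (Suc n)))" for n s
  have "simple_function (Leb a b) (r n)" for n
  proof (rule simple_function_borel_measurable)
    have "r n \<in> borel_measurable borel" unfolding r_def by measurable
    then have "r n \<in> borel_measurable lebesgue" by (simp add: measurable_completion)
    then show "r n \<in> borel_measurable (Leb a b)" by (rule measurable_restrict_space1)
    let ?J = "{\<lfloor>real (Suc n) * a\<rfloor>..\<lfloor>real (Suc n) * b\<rfloor>}"
    have "r n ` {a<..<b} \<subseteq> (\<lambda>k. max a (min b (of_int k / real (Suc n)))) ` ?J"
    proof
      fix y assume "y \<in> r n ` {a<..<b}"
      then obtain s where s: "a < s" "s < b" "y = r n s" by auto
      have "\<lfloor>real (Suc n) * s\<rfloor> \<in> ?J"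
        using s by (auto intro!: floor_mono mult_left_mono)
      then show "y \<in> (\<lambda>k. max a (min b (of_int k / real (Suc n)))) ` ?J"
        unfolding s(3) r_def by (rule rev_image_eqI) simp
    qed
    then have "finite (r n ` {a<..<b})" by (rule finite_subset) simp
    then show "finite (r n ` space (Leb a b))" by (simp add: space_restrict_space)
  qed
  moreover have "(\<lambda>n. r n s) \<longlonglongrightarrow> s" if s: "s \<in> {a<..<b}" for s
  proof -
    have "(\<lambda>n. of_int \<lfloor>real (Suc n) * s\<rfloor> / real (Suc n)) \<longlonglongrightarrow> s"
    proof (rule real_tendsto_sandwich[where f = "\<lambda>n. s - 1 / real (Suc n)" and h = "\<lambda>n. s"])
      show "\<forall>\<^sub>F n in sequentially. s - 1 / real (Suc n) \<le> of_int \<lfloor>real (Suc n) * s\<rfloor> / real (Suc n)"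
      proof (intro always_eventually allI)
        fix n
        have "(real (Suc n) * s - 1) / real (Suc n) \<le> of_int \<lfloor>real (Suc n) * s\<rfloor> / real (Suc n)"
          by (intro divide_right_mono) linarith+
        moreover have "(real (Suc n) * s - 1) / real (Suc n) = s - 1 / real (Suc n)"
          by (simp add: divide_simps)
        ultimately show "s - 1 / real (Suc n) \<le> of_int \<lfloor>real (Suc n) * s\<rfloor> / real (Suc n)" by simp
      qed
      show "\<forall>\<^sub>F n in sequentially. of_int \<lfloor>real (Suc n) * s\<rfloor> / real (Suc n) \<le> s"
      proof (intro always_eventually allI)
        fix n
        have "of_int \<lfloor>real (Suc n) * s\<rfloor> / real (Suc n) \<le> (real (Suc n) * s) / real (Suc n)"
          by (intro divide_right_mono) linarith+
        then show "of_int \<lfloor>real (Suc n) * s\<rfloor> / real (Suc n) \<le> s" by simp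
      qed
      show "(\<lambda>n. s - 1 / real (Suc n)) \<longlonglongrightarrow> s"
        using tendsto_diff[OF tendsto_const LIMSEQ_inverse_real_of_nat, of s]
        by (simp add: inverse_eq_divide)
    qed simp
    then have "(\<lambda>n. r n s) \<longlonglongrightarrow> max a (min b s)"
      unfolding r_def by (intro tendsto_max tendsto_min tendsto_const)
    then show ?thesis using s by simp
  qed
  moreover have "r n s \<in> {a..b}" if "a \<le> b" for n s using that by (auto simp: r_def)
  ultimately show thesis using that by blast
qed

lemma strongly_measurable_continuous_on:
  fixes f :: "real \<Rightarrow> 'b::real_normed_vector"
  assumes f: "continuous_on {a..b} f"
  shows "strongly_measurable (Leb a b) f"
proof -
  obtain r where r: "\<And>n. simple_function (Leb a b) (r n)"
    "\<And>n s. a \<le> b \<Longrightarrow> r n s \<in> {a..b}" "\<And>s. s \<in> {a<..<b} \<Longrightarrow> (\<lambda>n. r n s) \<longlonglongrightarrow> s"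
    using simple_grid_approximation[of a b] by blast
  have "(\<lambda>n. f (r n s)) \<longlonglongrightarrow> f s" if s: "s \<in> {a<..<b}" for s
  proof -
    have "s \<in> {a..b}" "\<And>n. r n s \<in> {a..b}" using s r(2) by auto
    then show ?thesis using r(3)[OF s] f unfolding continuous_on_sequentially by (auto simp: o_def)
  qed
  then have "AE s in Leb a b. (\<lambda>n. f (r n s)) \<longlonglongrightarrow> f s"
    by (auto simp: AE_lebesgue_on_Ioo intro: exI[of _ "{}"])
  then show ?thesis
    unfolding strongly_measurable_def
    by (intro exI[of _ "\<lambda>n s. f (r n s)"]) (auto intro: simple_function_compose1 r(1))
qed

text \<open>A strongly continuous operator family need not be strongly measurable as an operator valued
  function.  It maps strongly measurable functions to such functions nevertheless: evaluate it at
  grid points, and let it act on simple functions.\<close>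

lemma strongly_measurable_operator_family:
  fixes K :: "real \<Rightarrow> 'b::real_normed_vector \<Rightarrow>\<^sub>L 'c::real_normed_vector"
  assumes K: "\<And>x. continuous_on {a..b} (\<lambda>s. K s x)" and bd: "\<And>s. s \<in> {a..b} \<Longrightarrow> norm (K s) \<le> C"
    and f: "strongly_measurable (Leb a b) f"
  shows "strongly_measurable (Leb a b) (\<lambda>s. K s (f s))"
proof -
  obtain r where r: "\<And>n. simple_function (Leb a b) (r n)"
    "\<And>n s. a \<le> b \<Longrightarrow> r n s \<in> {a..b}" "\<And>s. s \<in> {a<..<b} \<Longrightarrow> (\<lambda>n. r n s) \<longlonglongrightarrow> s"
    using simple_grid_approximation[of a b] by blast
  obtain g where g: "\<And>n. simple_function (Leb a b) (g n)"
      "AE x in Leb a b. (\<lambda>n. g n x) \<longlonglongrightarrow> f x"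
    using f unfolding strongly_measurable_def by blast
  have "AE s in Leb a b. (\<lambda>n. K (r n s) (g n s)) \<longlonglongrightarrow> K s (f s)"
    using g(2) AE_space
  proof eventually_elim
    fix s assume lim: "(\<lambda>n. g n s) \<longlonglongrightarrow> f s" and "s \<in> space (Leb a b)"
    then have s: "s \<in> {a<..<b}" by (simp add: space_restrict_space)
    have in1: "s \<in> {a..b}" and in2: "\<And>n. r n s \<in> {a..b}" using s r(2) by auto
    have C0: "C \<ge> 0" using bd[OF in1] norm_ge_zero order_trans by blast
    have 1: "(\<lambda>n. K (r n s) (f s)) \<longlonglongrightarrow> K s (f s)"
      using K[of "f s"] r(3)[OF s] in1 in2 unfolding continuous_on_sequentially by (auto simp: o_def)
    have 2: "(\<lambda>n. K (r n s) (g n s - f s)) \<longlonglongrightarrow> 0"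
    proof (rule Lim_null_comparison)
      show "\<forall>\<^sub>F n in sequentially. norm (K (r n s) (g n s - f s)) \<le> C * norm (g n s - f s)"
        using bd[OF in2] by (intro always_eventually allI)
          (meson mult_right_mono norm_blinfun norm_ge_zero order_trans)
      have "(\<lambda>n. C * norm (g n s - f s)) \<longlonglongrightarrow> C * 0"
        using lim by (intro tendsto_mult tendsto_const) (simp add: tendsto_norm_zero_iff LIM_zero_iff)
      then show "(\<lambda>n. C * norm (g n s - f s)) \<longlonglongrightarrow> 0" by simp
    qed
    show "(\<lambda>n. K (r n s) (g n s)) \<longlonglongrightarrow> K s (f s)"
      using tendsto_add[OF 1 2] by (simp add: blinfun.diff_right)
  qed
  moreover have "simple_function (Leb a b) (\<lambda>s. K (r n s) (g n s))" for n
    using simple_function_compose2[OF r(1)[of n] g(1)[of n], of "\<lambda>u. blinfun_apply (K u)"] by simp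
  ultimately show ?thesis unfolding strongly_measurable_def
    by (intro exI[of _ "\<lambda>n s. K (r n s) (g n s)"]) simp
qed

abbreviation (input) "simple_integrable \<equiv> Bochner_Integration.simple_bochner_integrable"

abbreviation (input) "simple_int \<equiv> Bochner_Integration.simple_bochner_integral"

lemma nn_integral_simple_diff_bound:
  assumes M: "complete_measure M" and f: "strongly_measurable M f"
    and s: "simple_integrable M s"
    and t: "simple_integrable M t"
  shows "ennreal (norm (simple_int M s
            - simple_int M t))
    \<le> (\<integral>\<^sup>+ x. ennreal (norm (f x - s x)) \<partial>M) + (\<integral>\<^sup>+ x. ennreal (norm (f x - t x)) \<partial>M)"
proof -
  have sf: "simple_function M s" "simple_function M t"
    using s t by (auto elim: simple_bochner_integrable.cases)
  have meas: "(\<lambda>x. norm (f x - s x)) \<in> borel_measurable M" if "simple_function M s" for s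
  proof -
    have "strongly_measurable M s"
      unfolding strongly_measurable_def using that by (intro exI[of _ "\<lambda>n. s"]) simp
    from strongly_measurable_diff[OF f this] show ?thesis
      by (rule strongly_measurable_norm_borel[OF M])
  qed
  have st: "simple_integrable M (\<lambda>x. s x - t x)"
    using simple_bochner_integrable_compose2[of "(-)", OF _ s t] by simp
  have nst: "simple_integrable M (\<lambda>x. norm (s x - t x))"
    using simple_bochner_integrable_compose2[of "\<lambda>x y. norm (x - y)", OF _ s t] by simp
  have "norm (simple_int M s
            - simple_int M t)
      \<le> simple_int M (\<lambda>x. norm (s x - t x))"
    using simple_bochner_integral_norm_bound[OF st] simple_bochner_integral_diff[OF s t] by simp
  then have "ennreal (norm (simple_int M s
            - simple_int M t))
      \<le> (\<integral>\<^sup>+ x. ennreal (norm (s x - t x)) \<partial>M)"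
    using simple_bochner_integral_eq_nn_integral[OF nst] by (metis ennreal_leI norm_ge_zero)
  also have "\<dots> \<le> (\<integral>\<^sup>+ x. ennreal (norm (f x - s x)) + ennreal (norm (f x - t x)) \<partial>M)"
  proof (rule nn_integral_mono)
    fix x
    have "norm (s x - t x) \<le> norm (f x - s x) + norm (f x - t x)"
      using norm_triangle_ineq4[of "f x - t x" "f x - s x"] by (simp add: algebra_simps)
    then show "ennreal (norm (s x - t x)) \<le> ennreal (norm (f x - s x)) + ennreal (norm (f x - t x))"
      by (simp flip: ennreal_plus)
  qed
  also have "\<dots> = (\<integral>\<^sup>+ x. ennreal (norm (f x - s x)) \<partial>M) + (\<integral>\<^sup>+ x. ennreal (norm (f x - t x)) \<partial>M)"
    using meas[OF sf(1)] meas[OF sf(2)] by (intro nn_integral_add) auto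
  finally show ?thesis .
qed

text \<open>Cutting the approximating simple functions off where they exceed \<open>2 |f|\<close> makes dominated
  convergence applicable; completeness of the target space then gives the limit of their
  integrals.\<close>

lemma has_strong_integral_exists:
  fixes f :: "'a \<Rightarrow> 'b::banach"
  assumes M: "complete_measure M" and f: "strongly_measurable M f"
    and fin: "(\<integral>\<^sup>+ x. ennreal (norm (f x)) \<partial>M) < \<infinity>"
  obtains I where "has_strong_integral M f I"
proof -
  obtain s where s: "\<And>n. simple_function M (s n)" "AE x in M. (\<lambda>n. s n x) \<longlonglongrightarrow> f x"
    using f unfolding strongly_measurable_def by blast
  note nf [measurable] = strongly_measurable_norm_borel[OF M f]
  have [measurable]: "(\<lambda>x. norm (s n x)) \<in> borel_measurable M" for n
    using simple_function_compose1[OF s(1), of norm] by (rule borel_measurable_simple_function)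
  define t where "t n x = (if norm (s n x) \<le> 2 * norm (f x) then s n x else 0)" for n x
  have t_simple: "simple_function M (t n)" for n
    unfolding t_def by (intro simple_function_If s) auto
  have t_bound: "norm (t n x) \<le> 2 * norm (f x)" for n x by (auto simp: t_def)
  have t_lim: "AE x in M. (\<lambda>n. t n x) \<longlonglongrightarrow> f x"
    using s(2)
  proof eventually_elim
    fix x assume lim: "(\<lambda>n. s n x) \<longlonglongrightarrow> f x"
    show "(\<lambda>n. t n x) \<longlonglongrightarrow> f x"
    proof (cases "f x = 0")
      case True
      then have "t n x = 0" for n by (auto simp: t_def)
      then show ?thesis using True by simp
    next
      case False
      then have "\<forall>\<^sub>F n in sequentially. norm (s n x) < 2 * norm (f x)"
        using tendsto_norm[OF lim] by (intro order_tendstoD) auto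
      then have "\<forall>\<^sub>F n in sequentially. s n x = t n x" by eventually_elim (simp add: t_def)
      then show ?thesis using lim by (rule tendsto_cong[THEN iffD1])
    qed
  qed
  have int2: "(\<integral>\<^sup>+ x. ennreal (3 * norm (f x)) \<partial>M) < \<infinity>"
    using fin by (simp add: ennreal_mult nn_integral_cmult ennreal_mult_less_top)
  have int2': "(\<integral>\<^sup>+ x. ennreal (2 * norm (f x)) \<partial>M) < \<infinity>"
    using fin by (simp add: ennreal_mult nn_integral_cmult ennreal_mult_less_top)
  have t_int: "simple_integrable M (t n)" for n
  proof (rule simple_bochner_integrableI_bounded[OF t_simple])
    have "(\<integral>\<^sup>+ x. ennreal (norm (t n x)) \<partial>M) \<le> (\<integral>\<^sup>+ x. ennreal (2 * norm (f x)) \<partial>M)"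
      using t_bound by (intro nn_integral_mono ennreal_leI)
    then show "(\<integral>\<^sup>+ x. ennreal (norm (t n x)) \<partial>M) < \<infinity>" using int2' by (rule le_less_trans)
  qed
  have t_sm: "strongly_measurable M (t n)" for n
    unfolding strongly_measurable_def by (intro exI[of _ "\<lambda>k. t n"]) (simp add: t_simple)
  have L1: "(\<lambda>n. \<integral>\<^sup>+ x. ennreal (norm (f x - t n x)) \<partial>M) \<longlonglongrightarrow> 0"
  proof -
    have "(\<lambda>n. \<integral>\<^sup>+ x. ennreal (norm (f x - t n x)) \<partial>M) \<longlonglongrightarrow> (\<integral>\<^sup>+ x. 0 \<partial>M)"
    proof (rule nn_integral_dominated_convergence[where w = "\<lambda>x. ennreal (3 * norm (f x))"])
      show "(\<lambda>x. ennreal (norm (f x - t n x))) \<in> borel_measurable M" for n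
        using strongly_measurable_norm_borel[OF M strongly_measurable_diff[OF f t_sm]] by simp
      have "norm (f x - t n x) \<le> 3 * norm (f x)" for n x
        using norm_triangle_ineq4[of "f x" "t n x"] t_bound[of n x] by simp
      then show "AE x in M. ennreal (norm (f x - t n x)) \<le> ennreal (3 * norm (f x))" for n
        by (intro AE_I2 ennreal_leI)
      show "AE x in M. (\<lambda>n. ennreal (norm (f x - t n x))) \<longlonglongrightarrow> 0"
        using t_lim
      proof eventually_elim
        fix x assume "(\<lambda>n. t n x) \<longlonglongrightarrow> f x"
        from tendsto_diff[OF tendsto_const[of "f x"] this]
        show "(\<lambda>n. ennreal (norm (f x - t n x))) \<longlonglongrightarrow> 0"
          by (simp add: tendsto_norm_zero_iff flip: ennreal_0)
      qed
    qed (use int2 in auto)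
    then show ?thesis by simp
  qed
  let ?i = "\<lambda>n. simple_int M (t n)"
  have "Cauchy ?i"
  proof (rule metric_CauchyI)
    fix e :: real assume e: "e > 0"
    then have "\<forall>\<^sub>F n in sequentially. (\<integral>\<^sup>+ x. ennreal (norm (f x - t n x)) \<partial>M) < ennreal (e / 2)"
      using L1 by (intro order_tendstoD) auto
    then obtain N where N: "\<And>n. n \<ge> N \<Longrightarrow> (\<integral>\<^sup>+ x. ennreal (norm (f x - t n x)) \<partial>M) < ennreal (e / 2)"
      by (auto simp: eventually_sequentially)
    have "dist (?i m) (?i n) < e" if "m \<ge> N" "n \<ge> N" for m n
    proof -
      have "ennreal (norm (?i m - ?i n)) < ennreal (e / 2) + ennreal (e / 2)"
        using nn_integral_simple_diff_bound[OF M f t_int t_int, of m n] N[OF that(1)] N[OF that(2)]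
        by (meson add_strict_mono le_less_trans)
      also have "\<dots> = ennreal e" using e by (simp flip: ennreal_plus)
      finally show ?thesis by (simp add: dist_norm ennreal_less_iff)
    qed
    then show "\<exists>N. \<forall>m\<ge>N. \<forall>n\<ge>N. dist (?i m) (?i n) < e" by blast
  qed
  then obtain I where "?i \<longlonglongrightarrow> I" by (auto simp: Cauchy_convergent_iff convergent_def)
  then have "has_strong_integral M f I" 
    unfolding has_strong_integral_def using f t_int L1 by (intro conjI exI[of _ t]) auto
  then show thesis by (rule that)
qed

lemma has_strong_integral_norm_le:
  assumes M: "complete_measure M" and I: "has_strong_integral M f I"
  shows "ennreal (norm I) \<le> (\<integral>\<^sup>+ x. ennreal (norm (f x)) \<partial>M)"
proof -
  obtain s where f: "strongly_measurable M f"
    and s: "\<And>n. simple_integrable M (s n)"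
      "(\<lambda>n. \<integral>\<^sup>+ t. ennreal (norm (f t - s n t)) \<partial>M) \<longlonglongrightarrow> 0"
      "(\<lambda>n. simple_int M (s n)) \<longlonglongrightarrow> I"
    using I unfolding has_strong_integral_def by blast
  have zero: "simple_integrable M (\<lambda>x. 0::'b)"
    by (rule simple_bochner_integrable.intros) auto
  have "simple_int M (\<lambda>x. 0::'b) = 0"
    unfolding simple_bochner_integral_def by (rule sum.neutral) auto
  then have "ennreal (norm (simple_int M (s n)))
     \<le> (\<integral>\<^sup>+ x. ennreal (norm (f x - s n x)) \<partial>M) + (\<integral>\<^sup>+ x. ennreal (norm (f x)) \<partial>M)" for n
    using nn_integral_simple_diff_bound[OF M f s(1) zero, of n] by simp
  moreover have "(\<lambda>n. (\<integral>\<^sup>+ x. ennreal (norm (f x - s n x)) \<partial>M) + (\<integral>\<^sup>+ x. ennreal (norm (f x)) \<partial>M))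
     \<longlonglongrightarrow> 0 + (\<integral>\<^sup>+ x. ennreal (norm (f x)) \<partial>M)"
    by (intro tendsto_add s(2) tendsto_const)
  moreover have "(\<lambda>n. ennreal (norm (simple_int M (s n))))
     \<longlonglongrightarrow> ennreal (norm I)"
    by (intro tendsto_ennrealI tendsto_norm s(3))
  ultimately show ?thesis by (auto intro: LIMSEQ_le)
qed

lemma has_strong_integral_bound:
  assumes I: "has_strong_integral (Leb a b) f I" and ab: "a \<le> b"
    and C: "C \<ge> 0" "AE t in Leb a b. norm (f t) \<le> C"
  shows "norm I \<le> C * (b - a)"
proof -
  have "ennreal (norm I) \<le> (\<integral>\<^sup>+ t. ennreal (norm (f t)) \<partial>Leb a b)"
    using has_strong_integral_norm_le[OF _ I] by simp
  also have "\<dots> \<le> (\<integral>\<^sup>+ t. ennreal C \<partial>Leb a b)"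
    using C(2) by (intro nn_integral_mono_AE) (auto elim!: eventually_mono intro: ennreal_leI)
  also have "\<dots> = ennreal (C * (b - a))"
    using C(1) ab by (simp add: emeasure_restrict_space ennreal_mult)
  finally show ?thesis using C(1) ab by (simp add: ennreal_le_iff)
qed

text \<open>Functionals turn the strong integral into an ordinary one.  As they separate points, identities
  between strong integrals reduce to identities between integrals of real functions.\<close>

lemma has_strong_integral_functional:
  fixes h :: "'b::real_normed_vector \<Rightarrow> real"
  assumes M: "complete_measure M" and I: "has_strong_integral M f I" and h: "bounded_linear h"
  shows "has_bochner_integral M (\<lambda>x. h (f x)) (h I)"
proof -
  interpret h: bounded_linear h by (rule h)
  obtain s where f: "strongly_measurable M f"
    and s: "\<And>n. simple_integrable M (s n)"
      "(\<lambda>n. \<integral>\<^sup>+ t. ennreal (norm (f t - s n t)) \<partial>M) \<longlonglongrightarrow> 0"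
      "(\<lambda>n. simple_int M (s n)) \<longlonglongrightarrow> I"
    using I unfolding has_strong_integral_def by blast
  obtain K where K: "K > 0" "\<And>x. norm (h x) \<le> norm x * K" using h.pos_bounded by blast
  show ?thesis
  proof (rule has_bochner_integral.intros)
    show "(\<lambda>x. h (f x)) \<in> borel_measurable M"
      using strongly_measurable_compose[OF f, of h] h.continuous_on[OF continuous_on_id]
      by (intro strongly_measurable_real_imp_borel[OF M]) auto
    show "simple_integrable M (\<lambda>x. h (s n x))" for n
      using simple_bochner_integrable_compose2[of "\<lambda>x y. h x", OF _ s(1) s(1)] h.zero by simp
    show "(\<lambda>n. simple_int M (\<lambda>x. h (s n x))) \<longlonglongrightarrow> h I"
      using h.tendsto[OF s(3)] simple_bochner_integral_linear[OF h.linear_axioms s(1)] by simp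
    show "(\<lambda>n. \<integral>\<^sup>+ x. ennreal (norm (h (f x) - h (s n x))) \<partial>M) \<longlonglongrightarrow> 0"
    proof (rule tendsto_sandwich[where f = "\<lambda>n. 0"])
      have "(\<lambda>n. ennreal K * (\<integral>\<^sup>+ t. ennreal (norm (f t - s n t)) \<partial>M)) \<longlonglongrightarrow> ennreal K * 0"
        using s(2) by (intro ennreal_tendsto_cmult) auto
      then show "(\<lambda>n. ennreal K * (\<integral>\<^sup>+ t. ennreal (norm (f t - s n t)) \<partial>M)) \<longlonglongrightarrow> 0" by simp
      show "\<forall>\<^sub>F n in sequentially. (\<integral>\<^sup>+ x. ennreal (norm (h (f x) - h (s n x))) \<partial>M)
          \<le> ennreal K * (\<integral>\<^sup>+ t. ennreal (norm (f t - s n t)) \<partial>M)"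
      proof (intro always_eventually allI)
        fix n
        have sm: "strongly_measurable M (s n)"
          unfolding strongly_measurable_def using s(1)
          by (intro exI[of _ "\<lambda>k. s n"]) (auto elim: simple_bochner_integrable.cases)
        have "(\<integral>\<^sup>+ x. ennreal (norm (h (f x) - h (s n x))) \<partial>M)
            \<le> (\<integral>\<^sup>+ t. ennreal K * ennreal (norm (f t - s n t)) \<partial>M)"
          using K by (intro nn_integral_mono)
            (simp add: mult.commute flip: h.diff ennreal_mult)
        also have "\<dots> = ennreal K * (\<integral>\<^sup>+ t. ennreal (norm (f t - s n t)) \<partial>M)"
          using strongly_measurable_norm_borel[OF M strongly_measurable_diff[OF f sm]]
          by (intro nn_integral_cmult) auto
        finally show "(\<integral>\<^sup>+ x. ennreal (norm (h (f x) - h (s n x))) \<partial>M)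
          \<le> ennreal K * (\<integral>\<^sup>+ t. ennreal (norm (f t - s n t)) \<partial>M)" .
      qed
    qed auto
  qed
qed

lemma has_bochner_integral_imp_has_integral:
  fixes f :: "real \<Rightarrow> real"
  assumes "has_bochner_integral (Leb a b) f I"
  shows "(f has_integral I) {a..b}"
proof -
  have "integrable (Leb a b) f" "integral\<^sup>L (Leb a b) f = I"
    using assms by (auto simp: has_bochner_integral_iff)
  then have "(f has_integral I) {a<..<b}"
    using has_integral_integral_lebesgue_on[of "{a<..<b}" f] by simp
  then show ?thesis by (simp add: has_integral_Icc_iff_Ioo)
qed

lemma has_strong_integral_imp_has_integral:
  fixes h :: "'b::real_normed_vector \<Rightarrow> real"
  assumes "has_strong_integral (Leb a b) f I" "bounded_linear h"
  shows "((\<lambda>t. h (f t)) has_integral h I) {a..b}"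
  using has_strong_integral_functional[OF _ assms] by (intro has_bochner_integral_imp_has_integral) simp

lemma has_strong_integral_exists_bounded:
  fixes f :: "real \<Rightarrow> 'b::banach"
  assumes f: "strongly_measurable (Leb a b) f"
    and C: "AE t in Leb a b. norm (f t) \<le> C"
  obtains I where "has_strong_integral (Leb a b) f I"
proof (rule has_strong_integral_exists[OF complete_measure_interval f])
  have "(\<integral>\<^sup>+ t. ennreal (norm (f t)) \<partial>Leb a b) \<le> (\<integral>\<^sup>+ t. ennreal C \<partial>Leb a b)"
    using C by (intro nn_integral_mono_AE) (auto elim!: eventually_mono intro: ennreal_leI)
  also have "\<dots> < \<infinity>" by (cases "a \<le> b") (auto simp: emeasure_restrict_space ennreal_mult_less_top)
  finally show "(\<integral>\<^sup>+ t. ennreal (norm (f t)) \<partial>Leb a b) < \<infinity>" .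
qed (use that in blast)

lemma integrable_bounded_strongly_measurable:
  fixes f :: "real \<Rightarrow> real"
  assumes f: "strongly_measurable (Leb a b) f"
    and C: "AE t in Leb a b. norm (f t) \<le> C"
  shows "f integrable_on {a..b}"
proof -
  obtain I where "has_strong_integral (Leb a b) f I"
    using has_strong_integral_exists_bounded[OF assms] .
  then have "((\<lambda>t. (\<lambda>x. x) (f t)) has_integral I) {a..b}"
    by (rule has_strong_integral_imp_has_integral) (rule bounded_linear_ident)
  then show ?thesis by (auto simp: integrable_on_def)
qed

lemma functionals_separate_points:
  fixes x y :: "'a::real_normed_vector"
  assumes "\<And>\<phi> :: 'a \<Rightarrow>\<^sub>L real. blinfun_apply \<phi> x = blinfun_apply \<phi> y"
  shows "x = y"
proof (rule ccontr)
  assume "x \<noteq> y"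
  then have "x - y \<notin> {0}" by simp
  then obtain \<phi> :: "'a \<Rightarrow>\<^sub>L real" where "blinfun_apply \<phi> (x - y) \<noteq> 0"
    using separating_functional[of "{0}" "x - y"] by (metis closed_singleton subspace_single_0)
  then show False using assms[of \<phi>] by (simp add: blinfun.diff_right)
qed

lemma has_integral_bound_off_negligible:
  fixes f :: "real \<Rightarrow> real"
  assumes f: "(f has_integral I) {a..b}" and N: "negligible N" and ab: "a \<le> b" and C: "C \<ge> 0"
    and le: "\<And>t. a < t \<Longrightarrow> t < b \<Longrightarrow> t \<notin> N \<Longrightarrow> \<bar>f t\<bar> \<le> C"
  shows "\<bar>I\<bar> \<le> C * (b - a)"
proof -
  define g where "g t = (if t \<in> N \<union> {a, b} then 0 else f t)" for t
  have "(g has_integral I) {a..b}"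
    by (rule has_integral_spike[OF _ _ f, of "N \<union> {a, b}"]) (use N in \<open>auto simp: g_def\<close>)
  moreover have "norm (g t) \<le> C" if "t \<in> cbox a b" for t
    using le[of t] C that by (auto simp: g_def)
  ultimately show ?thesis
    using has_integral_bound[of C g I a b] C ab by simp
qed

text \<open>Increments of size \<open>o(t - s)\<close> force the derivative to vanish.\<close>

lemma constant_if_small_increments:
  fixes g :: "real \<Rightarrow> real"
  assumes ab: "a \<le> b"
    and small: "\<And>e. e > 0 \<Longrightarrow> \<exists>d>0. \<forall>s t. a \<le> s \<and> s \<le> t \<and> t \<le> b \<and> t - s < d \<longrightarrow> \<bar>g t - g s\<bar> \<le> e * (t - s)"
  shows "g a = g b"
proof -
  have "(g has_field_derivative 0) (at s within {a..b})" if s: "s \<in> {a..b}" for s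
    unfolding has_field_derivative_iff
  proof (rule tendstoI)
    fix e :: real assume e: "e > 0"
    then obtain d where d: "d > 0"
      "\<And>s t. a \<le> s \<Longrightarrow> s \<le> t \<Longrightarrow> t \<le> b \<Longrightarrow> t - s < d \<Longrightarrow> \<bar>g t - g s\<bar> \<le> e / 2 * (t - s)"
      using small[of "e / 2"] by auto
    have "dist ((g t - g s) / (t - s)) 0 < e" if t: "t \<in> {a..b}" "t \<noteq> s" "dist t s < d" for t
    proof -
      have "\<bar>g t - g s\<bar> \<le> e / 2 * \<bar>t - s\<bar>"
        using d(2)[of s t] d(2)[of t s] s t
        by (cases "s \<le> t") (auto simp: dist_real_def abs_minus_commute)
      then have "\<bar>g t - g s\<bar> / \<bar>t - s\<bar> \<le> e / 2" using t by (simp add: divide_le_eq)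
      then have "dist ((g t - g s) / (t - s)) 0 \<le> e / 2" by (simp add: dist_real_def)
      then show ?thesis using e by linarith
    qed
    then show "\<forall>\<^sub>F t in at s within {a..b}. dist ((g t - g s) / (t - s)) 0 < e"
      unfolding eventually_at using d(1) by auto
  qed
  then obtain c where "\<And>x. x \<in> {a..b} \<Longrightarrow> g x = c"
    using has_field_derivative_zero_constant[of "{a..b}" g] by auto
  then show ?thesis using ab by auto
qed

lemma constant_if_quadratic_increments:
  fixes g :: "real \<Rightarrow> real"
  assumes ab: "a \<le> b" and C: "C \<ge> 0"
    and quad: "\<And>s t. a \<le> s \<Longrightarrow> s \<le> t \<Longrightarrow> t \<le> b \<Longrightarrow> \<bar>g t - g s\<bar> \<le> C * (t - s) * (t - s)"
  shows "g a = g b"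
proof (rule constant_if_small_increments[OF ab])
  fix e :: real assume e: "e > 0"
  have "\<bar>g t - g s\<bar> \<le> e * (t - s)" if "a \<le> s" "s \<le> t" "t \<le> b" "t - s < e / (C + 1)" for s t
  proof -
    have "C * (t - s) \<le> (C + 1) * (e / (C + 1))" using C that by (intro mult_mono) auto
    then have "C * (t - s) * (t - s) \<le> e * (t - s)" using C that by (intro mult_right_mono) auto
    then show ?thesis using quad[of s t] that by simp
  qed
  then show "\<exists>d>0. \<forall>s t. a \<le> s \<and> s \<le> t \<and> t \<le> b \<and> t - s < d \<longrightarrow> \<bar>g t - g s\<bar> \<le> e * (t - s)"
    using e C by (intro exI[of _ "e / (C + 1)"]) auto
qed

section \<open>Semigroups, their integrals and their generators\<close>

locale semigroup_generator =
  fixes G :: "real \<Rightarrow> 'a::banach \<Rightarrow>\<^sub>L 'a" and D :: "'a set" and A :: "'a \<Rightarrow> 'a"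
  assumes generates: "generates_C0_semigroup D A G"
begin

lemma C0: "C0_semigroup G"
  and domain_iff: "x \<in> D \<longleftrightarrow> (\<exists>y. ((\<lambda>h. (G h x - x) /\<^sub>R h) \<longlongrightarrow> y) (at_right 0))"
  and generator_limit: "x \<in> D \<Longrightarrow> ((\<lambda>h. (G h x - x) /\<^sub>R h) \<longlongrightarrow> A x) (at_right 0)"
  using generates unfolding generates_C0_semigroup_def by blast+

lemma G_0 [simp]: "G 0 = id_blinfun"
  and G_add: "0 \<le> s \<Longrightarrow> 0 \<le> t \<Longrightarrow> G (s + t) = G s o\<^sub>L G t"
  and G_limit_0: "((\<lambda>t. G t x) \<longlongrightarrow> x) (at_right 0)"
  using C0 unfolding C0_semigroup_def by blast+

lemma G_add_apply: "0 \<le> s \<Longrightarrow> 0 \<le> t \<Longrightarrow> G (s + t) x = G s (G t x)"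
  by (simp add: G_add)

lemma G_commute: "0 \<le> s \<Longrightarrow> 0 \<le> t \<Longrightarrow> G s (G t x) = G t (G s x)"
  by (metis G_add_apply add.commute)

lemma domain_and_generator_if_limit:
  assumes "((\<lambda>h. (G h x - x) /\<^sub>R h) \<longlongrightarrow> y) (at_right 0)"
  shows "x \<in> D" "A x = y"
proof -
  show "x \<in> D" using assms domain_iff by blast
  then show "A x = y" using generator_limit assms tendsto_unique trivial_limit_at_right_real by blast
qed

lemma G_near_0:
  assumes "e > 0"
  obtains d where "d > 0" "\<And>r. 0 \<le> r \<Longrightarrow> r < d \<Longrightarrow> norm (G r x - x) < e"
proof -
  have "\<forall>\<^sub>F r in at_right 0. dist (G r x) x < e"
    using G_limit_0 assms by (rule tendstoD)
  then obtain d where d: "d > 0" "\<And>r. 0 < r \<Longrightarrow> r < d \<Longrightarrow> dist (G r x) x < e"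
    unfolding eventually_at_right_field by auto
  have "norm (G r x - x) < e" if "0 \<le> r" "r < d" for r
    using d(2)[of r] that assms by (cases "r = 0") (auto simp: dist_norm)
  then show thesis using that d(1) by blast
qed

text \<open>Operators \<open>G (t n)\<close> of unbounded norm with \<open>t n\<close> tending to zero would contradict uniform
  boundedness; the semigroup law carries the bound to every bounded interval.\<close>

lemma G_bound:
  obtains C where "C \<ge> 1" "\<And>t. 0 \<le> t \<Longrightarrow> t \<le> b \<Longrightarrow> norm (G t) \<le> C"
proof -
  have "\<exists>d>0. \<exists>C. \<forall>t. 0 \<le> t \<and> t \<le> d \<longrightarrow> norm (G t) \<le> C"
  proof (rule ccontr)
    assume none: "\<not> ?thesis"
    have "\<forall>n. \<exists>t. 0 \<le> t \<and> t \<le> 1 / real (Suc n) \<and> real n < norm (G t)"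
    proof
      fix n
      have "(1 / real (Suc n)) > 0" by simp
      with none have "\<not> (\<forall>t. 0 \<le> t \<and> t \<le> 1 / real (Suc n) \<longrightarrow> norm (G t) \<le> real n)" by blast
      then show "\<exists>t. 0 \<le> t \<and> t \<le> 1 / real (Suc n) \<and> real n < norm (G t)" by (auto simp: not_le)
    qed
    then obtain t where t: "\<And>n. 0 \<le> t n" "\<And>n. t n \<le> 1 / real (Suc n)" "\<And>n. real n < norm (G (t n))"
      by metis
    have "t \<longlonglongrightarrow> 0"
      by (rule real_tendsto_sandwich[of "\<lambda>n. 0" _ _ "\<lambda>n. 1 / real (Suc n)"])
        (use t LIMSEQ_inverse_real_of_nat in \<open>auto simp: inverse_eq_divide\<close>)
    have "\<exists>C. \<forall>n\<in>UNIV. norm (G (t n) x) \<le> C" for x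
    proof -
      obtain d where d: "d > 0" "\<And>r. 0 \<le> r \<Longrightarrow> r < d \<Longrightarrow> norm (G r x - x) < 1"
        using G_near_0[of 1 x] by auto
      have "\<forall>\<^sub>F n in sequentially. t n < d" using \<open>t \<longlonglongrightarrow> 0\<close> d(1) by (rule order_tendstoD)
      then have "\<forall>\<^sub>F n in sequentially. norm (G (t n) x) \<le> 1 + norm x"
      proof eventually_elim
        fix n assume "t n < d"
        then have "norm (G (t n) x - x) < 1" using d(2) t(1) by blast
        then show "norm (G (t n) x) \<le> 1 + norm x"
          using norm_triangle_ineq2[of "G (t n) x" x] by simp
      qed
      then have "Bfun (\<lambda>n. G (t n) x) sequentially" unfolding Bfun_def
        by (intro exI[of _ "1 + norm x"]) (auto simp: add_pos_nonneg)
      then show ?thesis unfolding Bseq_def by auto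
    qed
    then obtain C where "\<And>n. norm (G (t n)) \<le> C"
      using uniform_boundedness[of UNIV "\<lambda>n. G (t n)"] by (metis UNIV_I)
    moreover obtain n where "C \<le> real n" using real_arch_simple by blast
    ultimately show False using t(3)[of n] by (meson not_le order_trans)
  qed
  then obtain d C0 where d: "d > 0" "\<And>t. 0 \<le> t \<Longrightarrow> t \<le> d \<Longrightarrow> norm (G t) \<le> C0" by blast
  define C where "C = max 1 C0"
  have C: "C \<ge> 1" "\<And>t. 0 \<le> t \<Longrightarrow> t \<le> d \<Longrightarrow> norm (G t) \<le> C"
    using d(2) unfolding C_def by (auto intro: max.coboundedI2)
  have pow: "norm (G t) \<le> C ^ k" if "0 \<le> t" "t \<le> real k * d" for k t
    using that
  proof (induction k arbitrary: t)
    case 0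
    then have "norm (G t) \<le> 1" by (simp add: norm_blinfun_id_le)
    then show ?case by simp
  next
    case (Suc k)
    show ?case
    proof (cases "t \<le> d")
      case True
      then have "norm (G t) \<le> C" using C Suc.prems by blast
      also have "\<dots> \<le> C ^ Suc k" using C(1) power_increasing[of 1 "Suc k" C] by simp
      finally show ?thesis .
    next
      case False
      have "norm (G d o\<^sub>L G (t - d)) \<le> norm (G d) * norm (G (t - d))" by (rule norm_blinfun_compose)
      also have "\<dots> \<le> C * C ^ k"
        using C d(1) False Suc.prems by (intro mult_mono Suc.IH) (auto simp: algebra_simps)
      also have "G d o\<^sub>L G (t - d) = G t" using G_add[of d "t - d"] d(1) False by simp
      finally show ?thesis by simp
    qed
  qed
  obtain k where k: "b \<le> real k * d"
    using reals_Archimedean3[OF d(1)] less_imp_le by blast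
  show thesis
  proof (rule that[of "C ^ k"])
    show "C ^ k \<ge> 1" using C(1) by simp
    show "norm (G t) \<le> C ^ k" if "0 \<le> t" "t \<le> b" for t using that k by (intro pow) auto
  qed
qed

lemma G_apply_bound:
  assumes "\<And>t. 0 \<le> t \<Longrightarrow> t \<le> b \<Longrightarrow> norm (G t) \<le> C" "0 \<le> t" "t \<le> b"
  shows "norm (G t x) \<le> C * norm x"
  using assms by (meson mult_right_mono norm_blinfun norm_ge_zero order_trans)

lemma continuous_on_G: "continuous_on {0..b} (\<lambda>t. G t x)"
proof -
  obtain C where C: "C \<ge> 1" "\<And>t. 0 \<le> t \<Longrightarrow> t \<le> b \<Longrightarrow> norm (G t) \<le> C"
    using G_bound[of b] by auto
  have mono: "norm (G t x - G s x) \<le> C * norm (G (t - s) x - x)" if "0 \<le> s" "s \<le> t" "t \<le> b" for s t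
  proof -
    have "G t x - G s x = G s (G (t - s) x - x)"
      using G_add_apply[of s "t - s" x] that by (simp add: blinfun.diff_right)
    then show ?thesis using G_apply_bound[OF C(2), where t = s] that by simp
  qed
  show ?thesis
    unfolding continuous_on_iff
  proof (intro ballI allI impI)
    fix s and e :: real assume s: "s \<in> {0..b}" and e: "e > 0"
    have "e / C > 0" using e C by simp
    then obtain d where d: "d > 0" "\<And>r. 0 \<le> r \<Longrightarrow> r < d \<Longrightarrow> norm (G r x - x) < e / C"
      using G_near_0 by blast
    have "dist (G t x) (G s x) < e" if t: "t \<in> {0..b}" "dist t s < d" for t
    proof (cases "s \<le> t")
      case True
      have "dist (G t x) (G s x) \<le> C * norm (G (t - s) x - x)"
        using mono[of s t] True s t by (simp add: dist_norm)
      also have "\<dots> < C * (e / C)"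
        using d(2)[of "t - s"] True t C by (intro mult_strict_left_mono) (auto simp: dist_real_def)
      finally show ?thesis using C by simp
    next
      case False
      have "dist (G t x) (G s x) \<le> C * norm (G (s - t) x - x)"
        using mono[of t s] False s t by (simp add: dist_norm norm_minus_commute)
      also have "\<dots> < C * (e / C)"
        using d(2)[of "s - t"] False t C by (intro mult_strict_left_mono) (auto simp: dist_real_def)
      finally show ?thesis using C by simp
    qed
    then show "\<exists>d>0. \<forall>t\<in>{0..b}. dist t s < d \<longrightarrow> dist (G t x) (G s x) < e" using d(1) by blast
  qed
qed

lemma G_integrable: "0 \<le> a \<Longrightarrow> (\<lambda>r. G r x) integrable_on {a..b}"
  by (intro integrable_continuous_interval continuous_on_subset[OF continuous_on_G[of b]]) auto

definition G_integral :: "real \<Rightarrow> 'a \<Rightarrow>\<^sub>L 'a" where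
  "G_integral h = Blinfun (\<lambda>x. integral {0..h} (\<lambda>r. G r x))"

lemma G_integral_apply: "G_integral h x = integral {0..h} (\<lambda>r. G r x)"
proof -
  obtain C where C: "C \<ge> 1" "\<And>t. 0 \<le> t \<Longrightarrow> t \<le> h \<Longrightarrow> norm (G t) \<le> C"
    using G_bound[of h] by auto
  have "bounded_linear (\<lambda>x. integral {0..h} (\<lambda>r. G r x))"
  proof (rule bounded_linear_intro)
    show "integral {0..h} (\<lambda>r. G r (x + y)) = integral {0..h} (\<lambda>r. G r x) + integral {0..h} (\<lambda>r. G r y)" for x y
      by (simp add: blinfun.add_right integral_add G_integrable)
    show "integral {0..h} (\<lambda>r. G r (c *\<^sub>R x)) = c *\<^sub>R integral {0..h} (\<lambda>r. G r x)" for c x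
      by (simp add: blinfun.scaleR_right)
    show "norm (integral {0..h} (\<lambda>r. G r x)) \<le> norm x * (C * \<bar>h\<bar>)" for x
    proof (cases "h \<ge> 0")
      case True
      have "norm (integral {0..h} (\<lambda>r. G r x)) \<le> (C * norm x) * (h - 0)"
        by (rule integral_bound[OF True continuous_on_G]) (use G_apply_bound[OF C(2)] in auto)
      then show ?thesis using True by (simp add: algebra_simps)
    next
      case False
      have "0 \<le> norm x * (C * \<bar>h\<bar>)" using C by (intro mult_nonneg_nonneg) auto
      then show ?thesis using False by simp
    qed
  qed
  then show ?thesis unfolding G_integral_def by (simp add: bounded_linear_Blinfun_apply)
qed

lemma G_shift_integral:
  assumes "0 \<le> t" "0 \<le> h"
  shows "G t (G_integral h x) = integral {t..t + h} (\<lambda>r. G r x)"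
proof -
  have "G t (G_integral h x) = integral {0..h} (\<lambda>r. G t (G r x))"
    unfolding G_integral_apply
    using integral_linear[OF G_integrable[OF order_refl, of x h] blinfun.bounded_linear_right[of "G t"]]
    by (simp add: o_def)
  also have "\<dots> = integral {0..h} ((\<lambda>r. G r x) \<circ> (+) t)"
    by (intro integral_cong) (use assms in \<open>simp add: G_add_apply\<close>)
  also have "\<dots> = integral {t..t + h} (\<lambda>r. G r x)"
    unfolding integral_shift_Icc_real by (simp add: add.commute)
  finally show ?thesis .
qed

lemma G_integral_commute:
  assumes "0 \<le> t" "0 \<le> h"
  shows "G t (G_integral h x) = G_integral h (G t x)"
proof -
  have "G t (G_integral h x) = integral {0..h} (\<lambda>r. G t (G r x))"
    unfolding G_integral_apply
    using integral_linear[OF G_integrable[OF order_refl, of x h] blinfun.bounded_linear_right[of "G t"]]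
    by (simp add: o_def)
  also have "\<dots> = integral {0..h} (\<lambda>r. G r (G t x))"
    using assms by (intro integral_cong G_commute) auto
  finally show ?thesis by (simp add: G_integral_apply)
qed

text \<open>Both sides are the integral of the orbit over \<open>{0..t + h}\<close> minus those over \<open>{0..t}\<close> and
  \<open>{0..h}\<close>.\<close>

lemma G_integral_symmetry:
  assumes "0 \<le> t" "0 \<le> h"
  shows "G t (G_integral h x) - G_integral h x = G h (G_integral t x) - G_integral t x"
proof -
  have "integral {0..t} (\<lambda>r. G r x) + integral {t..t + h} (\<lambda>r. G r x) = integral {0..t + h} (\<lambda>r. G r x)"
    using assms by (intro Henstock_Kurzweil_Integration.integral_combine G_integrable) auto
  moreover have "integral {0..h} (\<lambda>r. G r x) + integral {h..t + h} (\<lambda>r. G r x) = integral {0..t + h} (\<lambda>r. G r x)"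
    using assms by (intro Henstock_Kurzweil_Integration.integral_combine G_integrable) auto
  ultimately show ?thesis
    using G_shift_integral[OF assms, of x] G_shift_integral[OF assms(2,1), of x]
    by (simp add: G_integral_apply algebra_simps)
qed

lemma G_integral_near:
  assumes "e > 0"
  obtains d where "d > 0" "\<And>h. 0 \<le> h \<Longrightarrow> h < d \<Longrightarrow> norm (G_integral h x - h *\<^sub>R x) \<le> e * h"
proof -
  obtain d where d: "d > 0" "\<And>r. 0 \<le> r \<Longrightarrow> r < d \<Longrightarrow> norm (G r x - x) < e"
    using G_near_0[OF assms, of x] by auto
  have "norm (G_integral h x - h *\<^sub>R x) \<le> e * h" if h: "0 \<le> h" "h < d" for h
  proof -
    have "G_integral h x - h *\<^sub>R x = integral {0..h} (\<lambda>r. G r x - x)"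
      using h by (subst integral_diff) (auto simp: G_integral_apply intro: G_integrable)
    also have "norm \<dots> \<le> e * (h - 0)"
    proof (rule integral_bound)
      show "continuous_on {0..h} (\<lambda>r. G r x - x)" by (intro continuous_intros continuous_on_G)
      show "norm (G r x - x) \<le> e" if "r \<in> {0..h}" for r
        using d(2)[of r] that h by simp
    qed (use h in simp)
    finally show ?thesis by simp
  qed
  then show thesis using that d(1) by blast
qed

lemma G_integral_average_limit: "((\<lambda>h. G_integral h x /\<^sub>R h) \<longlongrightarrow> x) (at_right 0)"
proof (rule tendstoI)
  fix e :: real assume e: "e > 0"
  obtain d where d: "d > 0" "\<And>h. 0 \<le> h \<Longrightarrow> h < d \<Longrightarrow> norm (G_integral h x - h *\<^sub>R x) \<le> e / 2 * h"
    using G_integral_near[of "e / 2" x] e by auto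
  have "dist (G_integral h x /\<^sub>R h) x < e" if h: "0 < h" "h < d" for h
  proof -
    have "G_integral h x /\<^sub>R h - x = (G_integral h x - h *\<^sub>R x) /\<^sub>R h"
      using h by (simp add: scaleR_diff_right)
    then have "norm (G_integral h x /\<^sub>R h - x) = norm (G_integral h x - h *\<^sub>R x) / h"
      using h by (simp add: divide_inverse mult.commute)
    also have "\<dots> \<le> e / 2" using d(2)[of h] h by (simp add: field_simps)
    finally show ?thesis using e by (simp add: dist_norm)
  qed
  then show "\<forall>\<^sub>F h in at_right 0. dist (G_integral h x /\<^sub>R h) x < e"
    unfolding eventually_at_right_field using d(1) by auto
qed

lemma G_integral_increment_bound:
  assumes C: "\<And>r. 0 \<le> r \<Longrightarrow> r \<le> h \<Longrightarrow> norm (G r) \<le> C" "C \<ge> 0" and t: "0 \<le> t" "t \<le> h"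
  shows "norm (G t (G_integral h x) - G_integral h x) \<le> (C + 1) * C * t * norm x"
proof -
  have 1: "norm (G_integral t x) \<le> (C * norm x) * (t - 0)"
    unfolding G_integral_apply
    by (rule integral_bound[OF t(1) continuous_on_G]) (use G_apply_bound[OF C(1)] t in auto)
  have "norm (G h (G_integral t x) - G_integral t x) \<le> C * norm (G_integral t x) + norm (G_integral t x)"
  proof -
    have "norm (G h (G_integral t x)) \<le> C * norm (G_integral t x)"
      by (rule G_apply_bound[OF C(1)]) (use t in auto)
    then show ?thesis
      using norm_triangle_ineq4[of "G h (G_integral t x)" "G_integral t x"] by linarith
  qed
  also have "\<dots> = (C + 1) * norm (G_integral t x)" by (simp add: algebra_simps)
  also have "\<dots> \<le> (C + 1) * ((C * norm x) * (t - 0))" using 1 C(2) by (intro mult_left_mono) auto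
  finally show ?thesis using G_integral_symmetry[of t h x] t by (simp add: mult_ac)
qed

lemma G_integral_in_domain:
  assumes "0 \<le> h"
  shows "G_integral h x \<in> D" "A (G_integral h x) = G h x - x"
proof -
  have "((\<lambda>t. G h (G_integral t x /\<^sub>R t) - G_integral t x /\<^sub>R t) \<longlongrightarrow> G h x - x) (at_right 0)"
    by (intro tendsto_diff blinfun.tendsto tendsto_const G_integral_average_limit)
  moreover have "\<forall>\<^sub>F t in at_right 0. G h (G_integral t x /\<^sub>R t) - G_integral t x /\<^sub>R t
      = (G t (G_integral h x) - G_integral h x) /\<^sub>R t"
    using eventually_at_right_less[of 0]
    by eventually_elim
      (use assms in \<open>simp add: G_integral_symmetry[of _ h] blinfun.scaleR_right scaleR_diff_right\<close>)
  ultimately have "((\<lambda>t. (G t (G_integral h x) - G_integral h x) /\<^sub>R t) \<longlongrightarrow> G h x - x) (at_right 0)"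
    by (rule Lim_transform_eventually)
  then show "G_integral h x \<in> D" "A (G_integral h x) = G h x - x"
    by (rule domain_and_generator_if_limit)+
qed

lemma closure_domain: "closure D = UNIV"
proof -
  have "x \<in> closure D" for x
  proof (rule Lim_in_closed_set[OF closed_closure])
    show "((\<lambda>h. G_integral h x /\<^sub>R h) \<longlongrightarrow> x) (at_right 0)" by (rule G_integral_average_limit)
    show "\<forall>\<^sub>F h in at_right 0. G_integral h x /\<^sub>R h \<in> closure D"
      using eventually_at_right_less[of 0]
    proof eventually_elim
      fix h :: real assume "0 < h"
      then have "G_integral h (x /\<^sub>R h) \<in> D" by (intro G_integral_in_domain) simp
      then show "G_integral h x /\<^sub>R h \<in> closure D"
        using closure_subset by (auto simp: blinfun.scaleR_right)
    qed
  qed simp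
  then show ?thesis by auto
qed

text \<open>Integrating the orbit of the difference quotients: by the symmetry of the integrals these
  integrals are themselves averages of an orbit increment.\<close>

lemma G_integral_generator:
  assumes "0 \<le> t" "x \<in> D"
  shows "G_integral t (A x) = G t x - x"
proof -
  have 1: "((\<lambda>h. G_integral t ((G h x - x) /\<^sub>R h)) \<longlongrightarrow> G_integral t (A x)) (at_right 0)"
    by (intro blinfun.tendsto tendsto_const generator_limit assms)
  have "((\<lambda>h. G t (G_integral h x /\<^sub>R h) - G_integral h x /\<^sub>R h) \<longlongrightarrow> G t x - x) (at_right 0)"
    by (intro tendsto_diff blinfun.tendsto tendsto_const G_integral_average_limit)
  moreover have "\<forall>\<^sub>F h in at_right 0. G t (G_integral h x /\<^sub>R h) - G_integral h x /\<^sub>R h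
      = G_integral t ((G h x - x) /\<^sub>R h)"
    using eventually_at_right_less[of 0]
  proof eventually_elim
    fix h :: real assume "0 < h"
    then have "G t (G_integral h x) - G_integral h x = G_integral t (G h x - x)"
      using G_integral_symmetry[of t h x] G_integral_commute[of h t x] assms(1)
      by (simp add: blinfun.diff_right)
    then show "G t (G_integral h x /\<^sub>R h) - G_integral h x /\<^sub>R h = G_integral t ((G h x - x) /\<^sub>R h)"
      by (simp add: blinfun.scaleR_right flip: scaleR_diff_right)
  qed
  ultimately have "((\<lambda>h. G_integral t ((G h x - x) /\<^sub>R h)) \<longlongrightarrow> G t x - x) (at_right 0)"
    by (rule Lim_transform_eventually)
  with 1 show ?thesis using tendsto_unique trivial_limit_at_right_real by blast
qed

lemma G_domain:
  assumes "0 \<le> t" "x \<in> D"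
  shows "G t x \<in> D" "A (G t x) = G t (A x)"
proof -
  have "((\<lambda>h. G t ((G h x - x) /\<^sub>R h)) \<longlongrightarrow> G t (A x)) (at_right 0)"
    by (intro blinfun.tendsto tendsto_const generator_limit assms)
  moreover have "\<forall>\<^sub>F h in at_right 0. G t ((G h x - x) /\<^sub>R h) = (G h (G t x) - G t x) /\<^sub>R h"
    using eventually_at_right_less[of 0]
    by eventually_elim (use assms in \<open>simp add: blinfun.scaleR_right blinfun.diff_right G_commute\<close>)
  ultimately have "((\<lambda>h. (G h (G t x) - G t x) /\<^sub>R h) \<longlongrightarrow> G t (A x)) (at_right 0)"
    by (rule Lim_transform_eventually)
  then show "G t x \<in> D" "A (G t x) = G t (A x)" by (rule domain_and_generator_if_limit)+
qed

lemma functional_G_integral: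
  "((\<lambda>r. blinfun_apply \<phi> (G r x)) has_integral blinfun_apply \<phi> (G_integral h x)) {0..h}"
  unfolding G_integral_apply
  using has_integral_linear[OF integrable_integral[OF G_integrable[OF order_refl, of x h]]
      blinfun.bounded_linear_right[of \<phi>]]
  by (simp add: o_def)

end

section \<open>The adjoint semigroup\<close>

text \<open>The adjoint as an element of the operator space, so that adjoints can form a semigroup.\<close>

definition adjoint_blinfun ::
    "('a::real_normed_vector \<Rightarrow>\<^sub>L 'b::real_normed_vector) \<Rightarrow> ('b \<Rightarrow>\<^sub>L real) \<Rightarrow>\<^sub>L ('a \<Rightarrow>\<^sub>L real)" where
  "adjoint_blinfun L = Blinfun (dual_adjoint L)"

lemma adjoint_blinfun_apply: "adjoint_blinfun L \<phi> = dual_adjoint L \<phi>"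
proof -
  have "bounded_linear (\<lambda>\<phi> :: 'b \<Rightarrow>\<^sub>L real. \<phi> o\<^sub>L L)"
    by (rule bounded_bilinear.bounded_linear_left[OF bounded_bilinear_blinfun_compose])
  then have "bounded_linear (dual_adjoint L)" by (simp add: dual_adjoint_def[abs_def])
  then show ?thesis by (simp add: adjoint_blinfun_def bounded_linear_Blinfun_apply)
qed

lemma dual_adjoint_apply [simp]: "blinfun_apply (dual_adjoint L \<phi>) x = blinfun_apply \<phi> (L x)"
  by (simp add: dual_adjoint_def)

lemma adjoint_apply [simp]: "blinfun_apply (adjoint_blinfun L \<phi>) x = blinfun_apply \<phi> (L x)"
  by (simp add: adjoint_blinfun_apply)

lemma norm_dual_adjoint: "norm (dual_adjoint L \<phi>) \<le> norm \<phi> * norm L"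
  unfolding dual_adjoint_def by (rule norm_blinfun_compose)

lemma norm_adjoint_blinfun: "norm (adjoint_blinfun L) \<le> norm L"
  by (rule norm_blinfun_bound)
    (auto simp: adjoint_blinfun_apply norm_dual_adjoint mult.commute[of "norm L"])

lemma blinfun_eq_on_dense:
  fixes f g :: "'a::real_normed_vector \<Rightarrow>\<^sub>L 'b::real_normed_vector"
  assumes "closure S = UNIV" "\<And>x. x \<in> S \<Longrightarrow> f x = g x"
  shows "f = g"
proof -
  have "closed {x. f x = g x}" by (intro closed_Collect_eq continuous_intros)
  then have "closure S \<subseteq> {x. f x = g x}" using assms(2) by (intro closure_minimal) auto
  then show ?thesis using assms(1) by (intro blinfun_eqI) auto
qed

context semigroup_generator
begin

abbreviation (input) "Gs t \<equiv> adjoint_blinfun (G t)"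

lemma adjoint_op_apply:
  assumes "\<phi> \<in> adjoint_dom D A" "x \<in> D"
  shows "blinfun_apply (adjoint_op D A \<phi>) x = blinfun_apply \<phi> (A x)"
proof -
  obtain \<psi> :: "'a \<Rightarrow>\<^sub>L real" where \<psi>: "\<forall>x\<in>D. blinfun_apply \<psi> x = blinfun_apply \<phi> (A x)"
    using assms(1) by (auto simp: adjoint_dom_def)
  have "\<forall>x\<in>D. blinfun_apply (adjoint_op D A \<phi>) x = blinfun_apply \<phi> (A x)"
    unfolding adjoint_op_def
    by (rule theI[of _ \<psi>], rule \<psi>, rule blinfun_eq_on_dense[OF closure_domain]) (use \<psi> in simp)
  then show ?thesis using assms(2) by blast
qed

lemma adjoint_op_eqI:
  assumes "\<And>x. x \<in> D \<Longrightarrow> blinfun_apply \<psi> x = blinfun_apply \<phi> (A x)"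
  shows "\<phi> \<in> adjoint_dom D A" "adjoint_op D A \<phi> = \<psi>"
proof -
  show dom: "\<phi> \<in> adjoint_dom D A" using assms by (auto simp: adjoint_dom_def)
  show "adjoint_op D A \<phi> = \<psi>"
    by (rule blinfun_eq_on_dense[OF closure_domain]) (simp add: adjoint_op_apply[OF dom] assms)
qed

text \<open>The integrated orbit of any point lies in the domain of the generator, so this identity holds
  at every \<open>x\<close> and not only on the domain.\<close>

lemma adjoint_domain_integral:
  assumes "\<phi> \<in> adjoint_dom D A" "0 \<le> h"
  shows "blinfun_apply \<phi> (G h x) - blinfun_apply \<phi> x
       = blinfun_apply (adjoint_op D A \<phi>) (G_integral h x)"
  using adjoint_op_apply[OF assms(1) G_integral_in_domain(1)[OF assms(2)], of x]
  by (simp add: G_integral_in_domain(2)[OF assms(2)] blinfun.diff_right)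

text \<open>The functionals with strongly continuous orbit form a closed subspace, which contains the
  averages \<open>\<phi> \<circ> G_integral h\<close>.  A functional outside of it would be separated from it by an element
  of the bidual, that is, by evaluation at a point \<open>x\<close>; but the averages converge to \<open>\<phi>\<close> at
  every point.\<close>

lemma adjoint_C0_semigroup:
  assumes refl: "reflexive_space TYPE('a)"
  shows "C0_semigroup (\<lambda>t. Gs t)"
  unfolding C0_semigroup_def
proof (intro conjI allI impI)
  show "Gs 0 = id_blinfun" by (intro blinfun_eqI) simp
  show "adjoint_blinfun (G (s + t)) = Gs s o\<^sub>L Gs t"
    if "0 \<le> s" "0 \<le> t" for s t
    by (intro blinfun_eqI) (use that in \<open>simp add: G_add_apply G_commute\<close>)
next
  obtain C where C: "C \<ge> 1" "\<And>t. 0 \<le> t \<Longrightarrow> t \<le> 1 \<Longrightarrow> norm (G t) \<le> C"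
    using G_bound[of 1] by auto
  define X where "X = {\<phi>. ((\<lambda>t. Gs t \<phi>) \<longlongrightarrow> \<phi>) (at_right 0)}"
  have near1: "\<forall>\<^sub>F t::real in at_right 0. 0 < t \<and> t < 1"
    unfolding eventually_at_right_field by (intro exI[of _ 1]) auto
  have sub: "subspace X"
    unfolding subspace_def
  proof (intro conjI ballI allI)
    show "0 \<in> X" by (simp add: X_def)
  next
    fix \<phi> \<psi> assume "\<phi> \<in> X" "\<psi> \<in> X"
    then show "\<phi> + \<psi> \<in> X" by (simp add: X_def blinfun.add_right tendsto_add)
  next
    fix c \<phi> assume "\<phi> \<in> X"
    then show "c *\<^sub>R \<phi> \<in> X" by (simp add: X_def blinfun.scaleR_right tendsto_scaleR)
  qed
  have "closure X \<subseteq> X"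
  proof
    fix \<phi> assume \<phi>: "\<phi> \<in> closure X"
    have "((\<lambda>t. Gs t \<phi>) \<longlongrightarrow> \<phi>) (at_right 0)"
    proof (rule tendstoI)
      fix e :: real assume e: "e > 0"
      then have "e / (2 * (C + 1)) > 0" using C(1) by simp
      then obtain \<psi> where \<psi>: "\<psi> \<in> X" "dist \<psi> \<phi> < e / (2 * (C + 1))"
        using \<phi> unfolding closure_approachable by blast
      have "\<forall>\<^sub>F t in at_right 0. dist (Gs t \<psi>) \<psi> < e / 2"
      proof (rule tendstoD)
        show "((\<lambda>t. Gs t \<psi>) \<longlongrightarrow> \<psi>) (at_right 0)" using \<psi>(1) by (simp add: X_def)
      qed (use e in simp)
      then show "\<forall>\<^sub>F t in at_right 0. dist (Gs t \<phi>) \<phi> < e"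
        using near1
      proof eventually_elim
        fix t :: real
        assume t: "dist (Gs t \<psi>) \<psi> < e / 2" "0 < t \<and> t < 1"
        have "norm (Gs t (\<phi> - \<psi>)) \<le> norm (Gs t) * norm (\<phi> - \<psi>)"
          by (rule norm_blinfun)
        also have "\<dots> \<le> C * norm (\<phi> - \<psi>)"
          using norm_adjoint_blinfun[of "G t"] C(2)[of t] t(2) by (intro mult_right_mono) auto
        finally have 1: "norm (Gs t (\<phi> - \<psi>)) \<le> C * norm (\<phi> - \<psi>)" .
        have "Gs t \<phi> - \<phi>
            = Gs t (\<phi> - \<psi>) + (Gs t \<psi> - \<psi>) + (\<psi> - \<phi>)"
          by (simp add: blinfun.diff_right)
        then have "norm (Gs t \<phi> - \<phi>)
            \<le> norm (Gs t (\<phi> - \<psi>)) + norm (Gs t \<psi> - \<psi>) + norm (\<psi> - \<phi>)"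
          by (metis norm_triangle_mono norm_triangle_ineq order_refl)
        also have "\<dots> < C * norm (\<phi> - \<psi>) + e / 2 + norm (\<phi> - \<psi>)"
          using 1 t(1) by (simp add: dist_norm norm_minus_commute)
        also have "\<dots> = (C + 1) * norm (\<phi> - \<psi>) + e / 2" by (simp add: algebra_simps)
        also have "\<dots> \<le> (C + 1) * (e / (2 * (C + 1))) + e / 2"
          using \<psi>(2) C(1) by (intro add_right_mono mult_left_mono) (auto simp: dist_norm norm_minus_commute)
        also have "\<dots> = e" using C(1) by (simp add: field_simps)
        finally show "dist (Gs t \<phi>) \<phi> < e" by (simp add: dist_norm)
      qed
    qed
    then show "\<phi> \<in> X" by (simp add: X_def)
  qed
  then have clo: "closed X" by (simp add: closure_subset_eq)
  have avg: "dual_adjoint (G_integral h) \<phi> \<in> X" if h: "0 < h" for h \<phi>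
  proof -
    obtain C' where C': "C' \<ge> 1" "\<And>t. 0 \<le> t \<Longrightarrow> t \<le> h \<Longrightarrow> norm (G t) \<le> C'"
      using G_bound[of h] by auto
    let ?\<phi> = "dual_adjoint (G_integral h) \<phi>"
    have "((\<lambda>t. Gs t ?\<phi> - ?\<phi>) \<longlongrightarrow> 0) (at_right 0)"
    proof (rule Lim_null_comparison)
      show "\<forall>\<^sub>F t in at_right 0. norm (Gs t ?\<phi> - ?\<phi>) \<le> norm \<phi> * (C' + 1) * C' * t"
        unfolding eventually_at_right_field
      proof (intro exI[of _ h] conjI allI impI)
        fix t :: real assume t: "0 < t" "t < h"
        show "norm (Gs t ?\<phi> - ?\<phi>) \<le> norm \<phi> * (C' + 1) * C' * t"
        proof (rule norm_blinfun_bound)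
          show "0 \<le> norm \<phi> * (C' + 1) * C' * t" using t C' by simp
          fix x
          have "blinfun_apply (Gs t ?\<phi> - ?\<phi>) x
              = blinfun_apply \<phi> (G t (G_integral h x) - G_integral h x)"
            using t by (simp add: blinfun.diff_left blinfun.diff_right G_integral_commute)
          also have "norm \<dots> \<le> norm \<phi> * norm (G t (G_integral h x) - G_integral h x)"
            by (rule norm_blinfun)
          also have "\<dots> \<le> norm \<phi> * ((C' + 1) * C' * t * norm x)"
            using G_integral_increment_bound[OF C'(2), where t = t and x = x] t C'(1)
            by (intro mult_left_mono) auto
          finally show "norm (blinfun_apply (Gs t ?\<phi> - ?\<phi>) x)
              \<le> norm \<phi> * (C' + 1) * C' * t * norm x" by (simp add: mult_ac)
        qed
      qed (rule h)
      have "((\<lambda>t. norm \<phi> * (C' + 1) * C' * t) \<longlongrightarrow> norm \<phi> * (C' + 1) * C' * 0) (at_right 0)"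
        by (intro tendsto_intros)
      then show "((\<lambda>t. norm \<phi> * (C' + 1) * C' * t) \<longlongrightarrow> 0) (at_right 0)" by simp
    qed
    from LIM_zero_cancel[OF this] show ?thesis by (simp add: X_def)
  qed
  fix \<phi>
  have "\<phi> \<in> X"
  proof (rule ccontr)
    assume "\<phi> \<notin> X"
    then obtain \<Phi> :: "('a \<Rightarrow>\<^sub>L real) \<Rightarrow>\<^sub>L real"
      where \<Phi>: "\<And>\<psi>. \<psi> \<in> X \<Longrightarrow> blinfun_apply \<Phi> \<psi> = 0" "blinfun_apply \<Phi> \<phi> \<noteq> 0"
      using separating_functional[OF sub clo] by blast
    obtain x where x: "\<And>\<psi>. blinfun_apply \<Phi> \<psi> = blinfun_apply \<psi> x"
      using refl unfolding reflexive_space_def by blast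
    have "blinfun_apply \<phi> (G_integral h x) = 0" if "0 < h" for h
      using \<Phi>(1)[OF avg[OF that, of \<phi>]] by (simp add: x)
    then have "\<forall>\<^sub>F h in at_right 0. blinfun_apply \<phi> (G_integral h x /\<^sub>R h) = 0"
      using eventually_at_right_less[of 0] by (auto elim!: eventually_mono simp: blinfun.scaleR_right)
    moreover have "((\<lambda>h. blinfun_apply \<phi> (G_integral h x /\<^sub>R h)) \<longlongrightarrow> blinfun_apply \<phi> x) (at_right 0)"
      by (intro blinfun.tendsto tendsto_const G_integral_average_limit)
    ultimately have "((\<lambda>h::real. 0) \<longlongrightarrow> blinfun_apply \<phi> x) (at_right 0)"
      by (rule Lim_transform_eventually[rotated])
    then have "blinfun_apply \<phi> x = 0" by (simp add: tendsto_const_iff)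
    then show False using \<Phi>(2) by (simp add: x)
  qed
  then show "((\<lambda>t. Gs t \<phi>) \<longlongrightarrow> \<phi>) (at_right 0)" by (simp add: X_def)
qed

text \<open>On the domain of the adjoint, difference quotients are averages of the orbit of
  \<open>adjoint_op D A \<phi>\<close>, and these converge in norm because the adjoint semigroup is strongly
  continuous.\<close>

lemma adjoint_semigroup_generator:
  assumes refl: "reflexive_space TYPE('a)"
  shows "generates_C0_semigroup (adjoint_dom D A) (adjoint_op D A) (\<lambda>t. Gs t)"
proof -
  note C0' = adjoint_C0_semigroup[OF refl]
  have gen_lim: "((\<lambda>h. (Gs h \<phi> - \<phi>) /\<^sub>R h) \<longlongrightarrow> adjoint_op D A \<phi>) (at_right 0)"
    if \<phi>: "\<phi> \<in> adjoint_dom D A" for \<phi>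
  proof (rule tendstoI)
    fix e :: real assume e: "e > 0"
    let ?\<psi> = "adjoint_op D A \<phi>"
    have "((\<lambda>t. Gs t ?\<psi>) \<longlongrightarrow> ?\<psi>) (at_right 0)"
      using C0' by (simp add: C0_semigroup_def)
    then have "\<forall>\<^sub>F r in at_right 0. dist (Gs r ?\<psi>) ?\<psi> < e / 2"
      using e by (intro tendstoD) auto
    then obtain d where d: "d > 0" "\<And>r. 0 < r \<Longrightarrow> r < d \<Longrightarrow> dist (Gs r ?\<psi>) ?\<psi> < e / 2"
      unfolding eventually_at_right_field by auto
    have d': "norm (Gs r ?\<psi> - ?\<psi>) \<le> e / 2" if "0 \<le> r" "r < d" for r
    proof (cases "r = 0")
      case True
      have "Gs 0 ?\<psi> = ?\<psi>" by (intro blinfun_eqI) simp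
      then show ?thesis using True e by simp
    next
      case False
      then show ?thesis using d(2)[of r] that by (simp add: dist_norm)
    qed
    have "dist ((Gs h \<phi> - \<phi>) /\<^sub>R h) ?\<psi> < e" if h: "0 < h" "h < d" for h
    proof -
      have "norm ((Gs h \<phi> - \<phi>) /\<^sub>R h - ?\<psi>) \<le> e / 2"
      proof (rule norm_blinfun_bound)
        fix x
        have int: "((\<lambda>r. ?\<psi> (G r x) - ?\<psi> x) has_integral
            (?\<psi> (G_integral h x) - h * ?\<psi> x)) {0..h}"
          using h has_integral_diff[OF functional_G_integral has_integral_const_real[of "?\<psi> x" 0 h]]
          by simp
        have le: "norm (?\<psi> (G r x) - ?\<psi> x) \<le> e / 2 * norm x"
          if "r \<in> cbox 0 h" for r
        proof -
          have "norm (blinfun_apply (Gs r ?\<psi> - ?\<psi>) x) \<le> norm (Gs r ?\<psi> - ?\<psi>) * norm x"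
            by (rule norm_blinfun)
          also have "\<dots> \<le> e / 2 * norm x" using d'[of r] that h by (intro mult_right_mono) auto
          finally show ?thesis by (simp add: blinfun.diff_left)
        qed
        have bd: "norm (?\<psi> (G_integral h x) - h * ?\<psi> x) \<le> e / 2 * norm x * h"
          using has_integral_bound[OF _ int[folded box_real(2)] le] e h by simp
        have eq: "blinfun_apply ((Gs h \<phi> - \<phi>) /\<^sub>R h - ?\<psi>) x
            = (?\<psi> (G_integral h x) - h * ?\<psi> x) / h"
        proof -
          have "blinfun_apply ((Gs h \<phi> - \<phi>) /\<^sub>R h - ?\<psi>) x
              = (blinfun_apply \<phi> (G h x) - blinfun_apply \<phi> x) / h - ?\<psi> x"
            by (simp add: blinfun.diff_left blinfun.scaleR_left divide_inverse mult.commute)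
          also have "\<dots> = ?\<psi> (G_integral h x) / h - ?\<psi> x"
            using adjoint_domain_integral[OF \<phi>, of h x] h by simp
          finally show ?thesis using h by (simp add: diff_divide_distrib)
        qed
        show "norm (blinfun_apply ((Gs h \<phi> - \<phi>) /\<^sub>R h - ?\<psi>) x) \<le> e / 2 * norm x"
          unfolding eq using bd h by (simp add: divide_le_eq)
      qed (use e in simp)
      then show ?thesis using e by (simp add: dist_norm)
    qed
    then show "\<forall>\<^sub>F h in at_right 0. dist ((Gs h \<phi> - \<phi>) /\<^sub>R h) ?\<psi> < e"
      unfolding eventually_at_right_field using d(1) by auto
  qed
  have dom: "\<phi> \<in> adjoint_dom D A"
    if lim: "((\<lambda>h. (Gs h \<phi> - \<phi>) /\<^sub>R h) \<longlongrightarrow> \<psi>) (at_right 0)" for \<phi> \<psi>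
  proof (rule adjoint_op_eqI(1))
    fix x assume x: "x \<in> D"
    have "((\<lambda>h. blinfun_apply ((Gs h \<phi> - \<phi>) /\<^sub>R h) x) \<longlongrightarrow> blinfun_apply \<psi> x) (at_right 0)"
      by (intro blinfun.tendsto tendsto_const lim)
    moreover have "blinfun_apply ((Gs h \<phi> - \<phi>) /\<^sub>R h) x
        = blinfun_apply \<phi> ((G h x - x) /\<^sub>R h)" for h
      by (simp add: blinfun.diff_left blinfun.diff_right blinfun.scaleR_left blinfun.scaleR_right)
    ultimately have "((\<lambda>h. blinfun_apply \<phi> ((G h x - x) /\<^sub>R h)) \<longlongrightarrow> blinfun_apply \<psi> x) (at_right 0)"
      by simp
    moreover have "((\<lambda>h. blinfun_apply \<phi> ((G h x - x) /\<^sub>R h)) \<longlongrightarrow> blinfun_apply \<phi> (A x)) (at_right 0)"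
      by (intro blinfun.tendsto tendsto_const generator_limit x)
    ultimately show "blinfun_apply \<psi> x = blinfun_apply \<phi> (A x)"
      by (rule tendsto_unique[OF trivial_limit_at_right_real])
  qed
  show ?thesis
    unfolding generates_C0_semigroup_def using C0' gen_lim dom by blast
qed

text \<open>For \<open>\<phi>\<close> in the domain of the adjoint, \<open>s \<mapsto> H s \<phi> (G (t - s) x)\<close> has increments of size
  \<open>o(h)\<close>: to first order both contributions are \<open>h\<close> times the value of \<open>adjoint_op D A (H s \<phi>)\<close>.\<close>

lemma adjoint_semigroup_unique:
  assumes H: "generates_C0_semigroup (adjoint_dom D A) (adjoint_op D A) H" and t: "0 \<le> t"
  shows "H t = Gs t"
proof -
  interpret H: semigroup_generator H "adjoint_dom D A" "adjoint_op D A"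
    by unfold_locales (rule H)
  obtain C where C: "C \<ge> 1" "\<And>s. 0 \<le> s \<Longrightarrow> s \<le> t \<Longrightarrow> norm (G s) \<le> C"
    using G_bound[of t] by auto
  obtain K where K: "K \<ge> 1" "\<And>s. 0 \<le> s \<Longrightarrow> s \<le> t \<Longrightarrow> norm (H s) \<le> K"
    using H.G_bound[of t] by auto
  show ?thesis
  proof (rule blinfun_eq_on_dense[OF H.closure_domain], rule blinfun_eqI)
    fix \<phi> x assume \<phi>: "\<phi> \<in> adjoint_dom D A"
    define \<eta> where "\<eta> = adjoint_op D A \<phi>"
    define k where "k s = blinfun_apply (H s \<phi>) (G (t - s) x)" for s
    define L where "L = K * C * norm x + K * C * norm \<eta> + 1"
    have L: "L > 0" using K(1) C(1) by (simp add: L_def add_nonneg_pos)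
    have "k 0 = k t"
    proof (rule constant_if_small_increments[OF t])
      fix e :: real assume e: "e > 0"
      then have eL: "e / L > 0" using L by simp
      obtain d1 where d1: "d1 > 0"
        "\<And>h. 0 \<le> h \<Longrightarrow> h < d1 \<Longrightarrow> norm (G_integral h x - h *\<^sub>R x) \<le> e / L * h"
        using G_integral_near[OF eL, of x] by auto
      obtain d2 where d2: "d2 > 0"
        "\<And>h. 0 \<le> h \<Longrightarrow> h < d2 \<Longrightarrow> norm (H.G_integral h \<eta> - h *\<^sub>R \<eta>) \<le> e / L * h"
        using H.G_integral_near[OF eL, of \<eta>] by auto
      have "\<bar>k s' - k s\<bar> \<le> e * (s' - s)"
        if s: "0 \<le> s" "s \<le> s'" "s' \<le> t" "s' - s < min d1 d2" for s s'
      proof -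
        define h where "h = s' - s"
        have h: "0 \<le> h" "h < d1" "h < d2" using s by (auto simp: h_def)
        define \<psi> where "\<psi> = H s \<phi>"
        define z where "z = G (t - s') x"
        let ?v = "H.G_integral h \<eta> - h *\<^sub>R \<eta>" and ?r = "G_integral h x - h *\<^sub>R x"
        have \<psi>: "\<psi> \<in> adjoint_dom D A" "adjoint_op D A \<psi> = H s \<eta>"
          unfolding \<psi>_def \<eta>_def by (rule H.G_domain[OF s(1) \<phi>])+
        have 1: "k s' = blinfun_apply (H h \<psi>) z"
          using H.G_add_apply[of h s \<phi>] h s by (simp add: k_def \<psi>_def z_def h_def)
        have 2: "k s = blinfun_apply \<psi> (G h z)"
          using G_add_apply[of h "t - s'" x] h s by (simp add: k_def \<psi>_def z_def h_def)
        have 3: "H h \<psi> - \<psi> = H.G_integral h (H s \<eta>)"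
          using H.G_integral_generator[OF h(1) \<psi>(1)] \<psi>(2) by simp
        have 4: "blinfun_apply \<psi> (G h z) - blinfun_apply \<psi> z = blinfun_apply (H s \<eta>) (G_integral h z)"
          using adjoint_domain_integral[OF \<psi>(1) h(1)] \<psi>(2) by simp
        have "k s' - k s = blinfun_apply (H h \<psi> - \<psi>) z - (blinfun_apply \<psi> (G h z) - blinfun_apply \<psi> z)"
          unfolding 1 2 by (simp add: blinfun.diff_left)
        also have "\<dots> = blinfun_apply (H.G_integral h (H s \<eta>)) z - blinfun_apply (H s \<eta>) (G_integral h z)"
          unfolding 3 4 ..
        also have "H.G_integral h (H s \<eta>) = H s (H.G_integral h \<eta>)"
          by (rule H.G_integral_commute[symmetric]) (use s h in auto)
        also have "G_integral h z = G (t - s') (G_integral h x)"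
          unfolding z_def by (rule G_integral_commute[symmetric]) (use s h in auto)
        finally have "k s' - k s = blinfun_apply (H s ?v) z
            - blinfun_apply (H s \<eta>) (G (t - s') ?r)"
          by (simp add: z_def blinfun.diff_right blinfun.diff_left blinfun.scaleR_left blinfun.scaleR_right)
        moreover have "\<bar>blinfun_apply (H s ?v) z\<bar> \<le> (K * (e / L * h)) * (C * norm x)"
        proof -
          have "norm (H s ?v) \<le> K * norm ?v"
            by (rule H.G_apply_bound[OF K(2)]) (use s in auto)
          also have "\<dots> \<le> K * (e / L * h)" using d2(2)[OF h(1) h(3)] K(1) by (intro mult_left_mono) auto
          finally have a: "norm (H s ?v) \<le> K * (e / L * h)" .
          have b: "norm z \<le> C * norm x" unfolding z_def by (rule G_apply_bound[OF C(2)]) (use s in auto)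
          have "norm (blinfun_apply (H s ?v) z) 
             \<le> norm (H s ?v) * norm z" by (rule norm_blinfun)
          also have "\<dots> \<le> (K * (e / L * h)) * (C * norm x)"
            using a b by (intro mult_mono) (auto intro: order_trans[OF norm_ge_zero])
          finally show ?thesis by simp
        qed
        moreover have "\<bar>blinfun_apply (H s \<eta>) (G (t - s') ?r)\<bar>
            \<le> (K * norm \<eta>) * (C * (e / L * h))"
        proof -
          have a: "norm (H s \<eta>) \<le> K * norm \<eta>" by (rule H.G_apply_bound[OF K(2)]) (use s in auto)
          have "norm (G (t - s') ?r) \<le> C * norm ?r"
            by (rule G_apply_bound[OF C(2)]) (use s in auto)
          also have "\<dots> \<le> C * (e / L * h)" using d1(2)[OF h(1) h(2)] C(1) by (intro mult_left_mono) auto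
          finally have b: "norm (G (t - s') ?r) \<le> C * (e / L * h)" .
          have "norm (blinfun_apply (H s \<eta>) (G (t - s') ?r))
             \<le> norm (H s \<eta>) * norm (G (t - s') ?r)" by (rule norm_blinfun)
          also have "\<dots> \<le> (K * norm \<eta>) * (C * (e / L * h))"
            using a b by (intro mult_mono) (auto intro: order_trans[OF norm_ge_zero])
          finally show ?thesis by simp
        qed
        ultimately have "\<bar>k s' - k s\<bar> \<le> (K * (e / L * h)) * (C * norm x) + (K * norm \<eta>) * (C * (e / L * h))"
          by linarith
        also have "\<dots> = (K * C * norm x + K * C * norm \<eta>) * (e / L * h)"
        proof -
          have "(K * q) * (C * a) + (K * b) * (C * q) = (K * C * a + K * C * b) * q" for a b q :: real
            by (simp add: algebra_simps)
          then show ?thesis .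
        qed
        also have "K * C * norm x + K * C * norm \<eta> = L - 1" by (simp add: L_def)
        also have "(L - 1) * (e / L * h) \<le> L * (e / L * h)" using e L h(1) by (intro mult_right_mono) auto
        also have "\<dots> = e * h" using L by simp
        finally show ?thesis by (simp add: h_def)
      qed
      then show "\<exists>d>0. \<forall>s s'. 0 \<le> s \<and> s \<le> s' \<and> s' \<le> t \<and> s' - s < d \<longrightarrow> \<bar>k s' - k s\<bar> \<le> e * (s' - s)"
        using d1(1) d2(1) by (intro exI[of _ "min d1 d2"]) auto
    qed
    then show "blinfun_apply (H t \<phi>) x = blinfun_apply (Gs t \<phi>) x"
      by (simp add: k_def)
  qed
qed

end

section \<open>The evolution operator and the adjoint equation\<close>

lemma norm_blinfun_apply_le:
  assumes "norm L \<le> a" "norm x \<le> b"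
  shows "norm (blinfun_apply L x) \<le> a * b"
proof -
  have "norm (blinfun_apply L x) \<le> norm L * norm x" by (rule norm_blinfun)
  also have "\<dots> \<le> a * b" using assms order_trans[OF norm_ge_zero assms(1)] by (intro mult_mono) auto
  finally show ?thesis .
qed

lemma has_integral_difference_Icc:
  fixes f :: "real \<Rightarrow> real"
  assumes I: "(f has_integral I) {a..b}" and J: "(f has_integral J) {c..b}" and ac: "a \<le> c" "c \<le> b"
  shows "(f has_integral (I - J)) {a..c}"
proof -
  have int: "f integrable_on {a..c}"
    using integrable_subinterval_real[OF has_integral_integrable[OF I], of a c] ac by simp
  then obtain K where K: "(f has_integral K) {a..c}" by (auto simp: integrable_on_def)
  have "(f has_integral (K + J)) {a..b}" by (rule has_integral_combine[OF ac K J])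
  then have "K + J = I" using I by (rule has_integral_unique)
  then have "K = I - J" by simp
  then show ?thesis using K by simp
qed

text \<open>To compare \<open>f\<close> at points near \<open>t0\<close>, use \<open>g t1\<close> for a \<open>t1\<close> slightly to the right of \<open>t0\<close> (or
  \<open>t1 = T\<close>, when \<open>t0 = T\<close>), where it is uniformly close to \<open>f\<close>.\<close>

lemma continuous_on_if_approximated_from_right:
  fixes f :: "real \<Rightarrow> 'b::real_normed_vector"
  assumes L: "L \<ge> 0"
    and g: "\<And>t1. 0 \<le> t1 \<Longrightarrow> t1 \<le> T \<Longrightarrow> continuous_on {0..t1} (g t1)"
    and fg: "\<And>t t1. 0 \<le> t \<Longrightarrow> t \<le> t1 \<Longrightarrow> t1 \<le> T \<Longrightarrow> norm (f t - g t1 t) \<le> L * (t1 - t)"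
  shows "continuous_on {0..T} f"
  unfolding continuous_on_iff
proof (intro ballI allI impI)
  fix t0 and e :: real assume t0: "t0 \<in> {0..T}" and e: "e > 0"
  \<comment> \<open>The errors at \<open>t\<close> and \<open>t0\<close> add up to at most \<open>3 * L * d0\<close>, which is to be below \<open>e / 2\<close>.\<close>
  define d0 where "d0 = e / (6 * (L + 1))"
  have d0: "d0 > 0" using e L by (simp add: d0_def)
  have Ld0: "L * d0 \<le> e / 6"
  proof -
    have "L * d0 \<le> (L + 1) * d0" using d0 by (intro mult_right_mono) auto
    also have "\<dots> = e / 6" using L by (simp add: d0_def field_simps)
    finally show ?thesis .
  qed
  define t1 where "t1 = min T (t0 + d0)"
  have t1: "0 \<le> t1" "t1 \<le> T" "t0 \<le> t1" "t1 \<le> t0 + d0" using t0 d0 by (auto simp: t1_def)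
  have "e / 2 > 0" using e by simp
  then obtain d1 where d1: "d1 > 0" "\<And>t. t \<in> {0..t1} \<Longrightarrow> dist t t0 < d1 \<Longrightarrow> dist (g t1 t) (g t1 t0) < e / 2"
    using g[OF t1(1,2)] t0 t1 unfolding continuous_on_iff by (metis atLeastAtMost_iff)
  have "dist (f t) (f t0) < e" if t: "t \<in> {0..T}" "dist t t0 < min d0 d1" for t
  proof -
    have tt1: "0 \<le> t" "t \<le> t1" using t by (auto simp: t1_def dist_real_def)
    have 1: "norm (f t - g t1 t) \<le> L * (2 * d0)"
    proof -
      have "norm (f t - g t1 t) \<le> L * (t1 - t)" by (rule fg) (use tt1 t1 in auto)
      also have "\<dots> \<le> L * (2 * d0)" using t t1 L by (intro mult_left_mono) (auto simp: dist_real_def)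
      finally show ?thesis .
    qed
    have 2: "norm (f t0 - g t1 t0) \<le> L * d0"
    proof -
      have "norm (f t0 - g t1 t0) \<le> L * (t1 - t0)" by (rule fg) (use t0 t1 in auto)
      also have "\<dots> \<le> L * d0" using t1 L by (intro mult_left_mono) auto
      finally show ?thesis .
    qed
    have 3: "norm (g t1 t - g t1 t0) < e / 2" using d1(2)[of t] tt1 t by (simp add: dist_norm)
    have "f t - f t0 = (f t - g t1 t) + (g t1 t - g t1 t0) - (f t0 - g t1 t0)" by simp
    then have "norm (f t - f t0) \<le> norm (f t - g t1 t) + norm (g t1 t - g t1 t0) + norm (f t0 - g t1 t0)"
      by (metis norm_triangle_ineq4 norm_triangle_ineq order_trans add_right_mono)
    also have "\<dots> < L * (2 * d0) + e / 2 + L * d0" using 1 2 3 by linarith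
    also have "\<dots> = 3 * (L * d0) + e / 2" by simp
    also have "\<dots> \<le> e" using Ld0 by simp
    finally show ?thesis by (simp add: dist_norm)
  qed
  then show "\<exists>d>0. \<forall>t\<in>{0..T}. dist t t0 < d \<longrightarrow> dist (f t) (f t0) < e"
    using d0 d1(1) by (intro exI[of _ "min d0 d1"]) auto
qed

text \<open>One constant \<open>C\<close> bounds the semigroup, the evolution operator and, off the null set \<open>N\<close>, the
  perturbation, so that integrands can be estimated pointwise off a fixed null set.\<close>

locale evolution_system = semigroup_generator G D A
  for G :: "real \<Rightarrow> 'a::banach \<Rightarrow>\<^sub>L 'a" and D :: "'a set" and A :: "'a \<Rightarrow> 'a" +
  fixes T C :: real and N :: "real set"
    and F :: "real \<Rightarrow> 'a \<Rightarrow>\<^sub>L 'a" and S :: "real \<Rightarrow> real \<Rightarrow> 'a \<Rightarrow>\<^sub>L 'a"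
  assumes T_pos: "T > 0" and C_ge: "C \<ge> 1" and reflexive: "reflexive_space TYPE('a)"
    and G_le: "\<And>t. 0 \<le> t \<Longrightarrow> t \<le> T \<Longrightarrow> norm (G t) \<le> C"
    and S_le: "\<And>s t. 0 \<le> s \<Longrightarrow> s \<le> t \<Longrightarrow> t \<le> T \<Longrightarrow> norm (S t s) \<le> C"
    and N: "negligible N"
    and F_le: "\<And>t. 0 < t \<Longrightarrow> t < T \<Longrightarrow> t \<notin> N \<Longrightarrow> norm (F t) \<le> C"
    and F_meas: "strongly_measurable (Leb 0 T) F"
    and S_same: "\<And>t. 0 \<le> t \<Longrightarrow> t \<le> T \<Longrightarrow> S t t = id_blinfun"
    and S_comp: "\<And>s r t. 0 \<le> s \<Longrightarrow> s \<le> r \<Longrightarrow> r \<le> t \<Longrightarrow> t \<le> T \<Longrightarrow> S t s = S t r o\<^sub>L S r s"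
    and S_cont: "\<And>x. continuous_on {(t, s). 0 \<le> s \<and> s \<le> t \<and> t \<le> T} (\<lambda>(t, s). S t s x)"
    and S_duhamel: "\<And>s t x. 0 \<le> s \<Longrightarrow> s \<le> t \<Longrightarrow> t \<le> T \<Longrightarrow>
           has_strong_integral (Leb s t)
             (\<lambda>r. G (t - r) (F r (S r s x))) (S t s x - G (t - s) x)"
begin

lemma S_comp_apply: "0 \<le> s \<Longrightarrow> s \<le> r \<Longrightarrow> r \<le> t \<Longrightarrow> t \<le> T \<Longrightarrow> S t s x = S t r (S r s x)"
  using S_comp[of s r t] by simp

lemma C_pos: "C \<ge> 0" using C_ge by simp

lemma G_apply_le: "0 \<le> t \<Longrightarrow> t \<le> T \<Longrightarrow> norm (G t x) \<le> C * norm x"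
  by (intro norm_blinfun_apply_le G_le order_refl)

lemma S_apply_le: "0 \<le> s \<Longrightarrow> s \<le> t \<Longrightarrow> t \<le> T \<Longrightarrow> norm (S t s x) \<le> C * norm x"
  by (intro norm_blinfun_apply_le S_le order_refl)

lemma continuous_on_S: "0 \<le> a \<Longrightarrow> b \<le> t \<Longrightarrow> t \<le> T \<Longrightarrow> continuous_on {a..b} (\<lambda>s. S t s x)"
proof -
  assume a: "0 \<le> a" "b \<le> t" "t \<le> T"
  have "continuous_on {a..b} ((\<lambda>(t, s). S t s x) \<circ> (\<lambda>s. (t, s)))"
    by (rule continuous_on_compose, intro continuous_intros, rule continuous_on_subset[OF S_cont])
      (use a in auto)
  then show ?thesis by (simp add: o_def)
qed

lemma S_minus_G:
  assumes "0 \<le> s" "s \<le> t" "t \<le> T"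
  shows "norm (S t s x - G (t - s) x) \<le> C * C * C * (t - s) * norm x"
proof -
  have "AE r in Leb s t. norm (G (t - r) (F r (S r s x))) \<le> C * (C * (C * norm x))"
    unfolding AE_lebesgue_on_Ioo
    by (intro exI[of _ N] conjI N allI impI norm_blinfun_apply_le G_le F_le S_le order_refl)
      (use assms in auto)
  then have "norm (S t s x - G (t - s) x) \<le> C * (C * (C * norm x)) * (t - s)"
    using C_pos by (intro has_strong_integral_bound[OF S_duhamel[OF assms] assms(2)]) auto
  then show ?thesis by (simp add: mult_ac)
qed

lemma functional_duhamel:
  fixes \<phi> :: "'a \<Rightarrow>\<^sub>L real"
  assumes "0 \<le> s" "s \<le> t" "t \<le> T"
  shows "((\<lambda>r. \<phi> (G (t - r) (F r (S r s x)))) has_integral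
           (\<phi> (S t s x) - \<phi> (G (t - s) x))) {s..t}"
  using has_strong_integral_imp_has_integral[OF S_duhamel[OF assms] blinfun.bounded_linear_right[of \<phi>]]
  by (simp add: blinfun.diff_right)

text \<open>The weak form of the backward equation determines the solution.  The pairing of \<open>\<phi> t\<close> with
  the orbit \<open>S t s x\<close> is constant: over a step of length \<open>h\<close>, the two variation of constants formulas
  have integrands that agree up to \<open>O(h)\<close>, so the pairing changes by \<open>O(h * h)\<close>.\<close>

lemma weak_adjoint_solution_unique:
  fixes \<phi> :: "real \<Rightarrow> 'a \<Rightarrow>\<^sub>L real" and \<phi>T :: "'a \<Rightarrow>\<^sub>L real"
  assumes P: "P \<ge> 0" "\<And>t. 0 \<le> t \<Longrightarrow> t \<le> T \<Longrightarrow> norm (\<phi> t) \<le> P"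
    and weak: "\<And>t x. 0 \<le> t \<Longrightarrow> t \<le> T \<Longrightarrow>
      ((\<lambda>r. \<phi> r (F r (G (r - t) x))) has_integral
        (\<phi> t x - \<phi>T (G (T - t) x))) {t..T}"
    and s: "0 \<le> s" "s \<le> T"
  shows "\<phi> s = dual_adjoint (S T s) \<phi>T"
proof (rule blinfun_eqI)
  fix x
  have step: "((\<lambda>r. \<phi> r (F r (G (r - t) w))) has_integral
      (\<phi> t w - \<phi> t' (G (t' - t) w))) {t..t'}"
    if t: "0 \<le> t" "t \<le> t'" "t' \<le> T" for t t' w
  proof -
    have "((\<lambda>r. \<phi> r (F r (G (r - t') (G (t' - t) w)))) has_integral
        (\<phi> t' (G (t' - t) w) - \<phi>T (G (T - t') (G (t' - t) w)))) {t'..T}"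
      by (rule weak) (use t in auto)
    then have "((\<lambda>r. \<phi> r (F r (G (r - t) w))) has_integral
        (\<phi> t' (G (t' - t) w) - \<phi>T (G (T - t') (G (t' - t) w)))) {t'..T}"
      by (rule has_integral_eq[rotated]) (use t G_add_apply[of _ "t' - t" w, symmetric] in auto)
    moreover have "G (T - t') (G (t' - t) w) = G (T - t) w"
      using G_add_apply[of "T - t'" "t' - t" w] t by simp
    ultimately show ?thesis
      using has_integral_difference_Icc[OF weak[of t w], of _ t'] t by fastforce
  qed
  have near: "\<bar>\<phi> t w - \<phi> t' (G (t' - t) w)\<bar> \<le> P * C * C * (t' - t) * norm w"
    if t: "0 \<le> t" "t \<le> t'" "t' \<le> T" for t t' w
  proof -
    have "\<bar>\<phi> t w - \<phi> t' (G (t' - t) w)\<bar> \<le> P * (C * (C * norm w)) * (t' - t)"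
    proof (rule has_integral_bound_off_negligible[OF step[OF t] N t(2)])
      show "0 \<le> P * (C * (C * norm w))" using P(1) C_pos by simp
      fix r assume r: "t < r" "r < t'" "r \<notin> N"
      have "norm (\<phi> r (F r (G (r - t) w))) \<le> P * (C * (C * norm w))"
        by (intro norm_blinfun_apply_le P(2) F_le G_le order_refl) (use r t in auto)
      then show "\<bar>\<phi> r (F r (G (r - t) w))\<bar> \<le> P * (C * (C * norm w))" by simp
    qed
    then show ?thesis by (simp add: mult_ac)
  qed
  define g where "g t = \<phi> t (S t s x)" for t
  define Q where "Q = 2 * P * C * C * C * C * (C * norm x)"
  have Q: "Q \<ge> 0" using P(1) C_pos by (simp add: Q_def)
  have "g s = g T"
  proof (rule constant_if_quadratic_increments[OF s(2) Q])
    fix t t' assume t: "s \<le> t" "t \<le> t'" "t' \<le> T"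
    define w where "w = S t s x"
    have w: "norm w \<le> C * norm x" unfolding w_def by (rule S_apply_le) (use s t in auto)
    have t0: "0 \<le> t" using s t by simp
    have y: "S t' s x = S t' t w" unfolding w_def by (rule S_comp_apply) (use s t in auto)
    have "((\<lambda>r. \<phi> t' (G (t' - r) (F r (S r t w))) - \<phi> r (F r (G (r - t) w)))
      has_integral (\<phi> t' (S t' t w) - \<phi> t' (G (t' - t) w)
         - (\<phi> t w - \<phi> t' (G (t' - t) w)))) {t..t'}"
      by (intro has_integral_diff functional_duhamel step t0 t)
    moreover have "\<phi> t' (S t' t w) - \<phi> t' (G (t' - t) w)
         - (\<phi> t w - \<phi> t' (G (t' - t) w)) = g t' - g t"
      by (simp add: g_def y w_def)
    ultimately have int: "((\<lambda>r. \<phi> t' (G (t' - r) (F r (S r t w))) - \<phi> r (F r (G (r - t) w)))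
      has_integral (g t' - g t)) {t..t'}" by simp
    show "\<bar>g t' - g t\<bar> \<le> Q * (t' - t) * (t' - t)"
    proof (rule has_integral_bound_off_negligible[OF int N t(2)])
      show "0 \<le> Q * (t' - t)" using Q t by simp
      fix r assume r: "t < r" "r < t'" "r \<notin> N"
      let ?z = "F r (S r t w)"
      have z: "norm ?z \<le> C * (C * norm w)"
        by (intro norm_blinfun_apply_le F_le S_le order_refl) (use r t t0 in auto)
      have "\<bar>\<phi> t' (G (t' - r) ?z) - \<phi> r ?z\<bar> \<le> P * C * C * (t' - r) * norm ?z"
        using near[of r t' ?z] r t t0 by (simp add: abs_minus_commute)
      also have "\<dots> \<le> P * C * C * (t' - t) * (C * (C * norm w))"
        using z r P(1) C_pos by (intro mult_mono mult_left_mono) auto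
      finally have 1: "\<bar>\<phi> t' (G (t' - r) ?z) - \<phi> r ?z\<bar>
          \<le> P * C * C * (t' - t) * (C * (C * norm w))" .
      have "norm (S r t w - G (r - t) w) \<le> C * C * C * (r - t) * norm w"
        by (rule S_minus_G) (use r t t0 in auto)
      also have "\<dots> \<le> C * C * C * (t' - t) * norm w"
        using r C_pos by (intro mult_right_mono mult_left_mono) auto
      finally have "norm (\<phi> r (F r (S r t w - G (r - t) w))) \<le> P * (C * (C * C * C * (t' - t) * norm w))"
        by (intro norm_blinfun_apply_le P(2) F_le) (use r t t0 in auto)
      then have 2: "\<bar>\<phi> r ?z - \<phi> r (F r (G (r - t) w))\<bar>
          \<le> P * (C * (C * C * C * (t' - t) * norm w))" by (simp add: blinfun.diff_right)
      have "\<bar>\<phi> t' (G (t' - r) ?z) - \<phi> r (F r (G (r - t) w))\<bar>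
          \<le> P * C * C * (t' - t) * (C * (C * norm w)) + P * (C * (C * C * C * (t' - t) * norm w))"
        using 1 2 by linarith
      also have "\<dots> = 2 * P * C * C * C * C * (t' - t) * norm w" by (simp add: algebra_simps)
      also have "\<dots> \<le> 2 * P * C * C * C * C * (t' - t) * (C * norm x)"
        using w t P(1) C_pos by (intro mult_left_mono) auto
      also have "\<dots> = Q * (t' - t)" by (simp add: Q_def mult_ac)
      finally show "\<bar>\<phi> t' (G (t' - r) ?z) - \<phi> r (F r (G (r - t) w))\<bar> \<le> Q * (t' - t)" .
    qed
  qed
  moreover have "\<phi> T y = \<phi>T y" for y
    using has_integral_unique[OF weak[of T y] has_integral_null_real] T_pos by simp
  ultimately show "\<phi> s x = blinfun_apply (dual_adjoint (S T s) \<phi>T) x"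
    using S_same[OF s] by (simp add: g_def)
qed

text \<open>The variation of constants formula with free and perturbed evolution exchanged.  Here the
  pairing of \<open>\<phi>\<close> with \<open>S T r (G (r - t) x)\<close>, plus the integral up to \<open>r\<close>, is constant in \<open>r\<close>, again
  because its increments over steps of length \<open>h\<close> are \<open>O(h * h)\<close>.\<close>

lemma functional_dual_duhamel:
  fixes \<phi> :: "'a \<Rightarrow>\<^sub>L real"
  assumes t: "0 \<le> t" "t \<le> T"
  shows "((\<lambda>r. \<phi> (S T r (F r (G (r - t) x)))) has_integral
           (\<phi> (S T t x) - \<phi> (G (T - t) x))) {t..T}"
proof -
  define f where "f r = \<phi> (S T r (F r (G (r - t) x)))" for r
  have "continuous_on {t..T} ((\<lambda>r. G r x) \<circ> (\<lambda>r. r - t))"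
    by (rule continuous_on_compose, intro continuous_intros,
        rule continuous_on_subset[OF continuous_on_G[of "T - t"]]) auto
  then have "strongly_measurable (Leb t T) (\<lambda>r. G (r - t) x)"
    by (intro strongly_measurable_continuous_on) (simp add: o_def)
  then have "strongly_measurable (Leb t T) (\<lambda>r. F r (G (r - t) x))"
    using strongly_measurable_subinterval[OF F_meas, of t T] t
    by (intro strongly_measurable_blinfun_apply[of _ F]) auto
  then have "strongly_measurable (Leb t T) (\<lambda>r. S T r (F r (G (r - t) x)))"
    by (rule strongly_measurable_operator_family[of t T "S T" C, rotated 2])
      (use t in \<open>auto intro: continuous_on_S S_le\<close>)
  then have "strongly_measurable (Leb t T) f"
    unfolding f_def by (rule strongly_measurable_compose) (intro continuous_intros)
  moreover have "AE r in Leb t T. norm (f r) \<le> norm \<phi> * (C * (C * (C * norm x)))"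
    unfolding AE_lebesgue_on_Ioo f_def
    by (intro exI[of _ N] conjI N allI impI norm_blinfun_apply_le G_le F_le S_le order_refl)
      (use t in auto)
  ultimately have f_int: "f integrable_on {t..T}" by (rule integrable_bounded_strongly_measurable)
  define k where "k r = \<phi> (S T r (G (r - t) x)) + integral {t..r} f" for r
  define Q where "Q = 2 * norm \<phi> * C * C * C * C * C * C * (C * norm x)"
  have Q: "Q \<ge> 0" using C_pos by (simp add: Q_def)
  have "k t = k T"
  proof (rule constant_if_quadratic_increments[OF t(2) Q])
    fix r r' assume r: "t \<le> r" "r \<le> r'" "r' \<le> T"
    define w where "w = G (r - t) x"
    have w: "norm w \<le> C * norm x" unfolding w_def by (rule G_apply_le) (use r t in auto)
    have r0: "0 \<le> r" "0 \<le> r'" "r \<le> T" using t r by auto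
    let ?\<psi> = "dual_adjoint (S T r') \<phi>"
    have fi: "(f has_integral (integral {t..r'} f - integral {t..r} f)) {r..r'}"
    proof -
      have sub: "f integrable_on {t..r'}" "f integrable_on {r..r'}"
        using r by (auto intro: integrable_subinterval_real[OF f_int])
      have "integral {t..r} f + integral {r..r'} f = integral {t..r'} f"
        by (rule Henstock_Kurzweil_Integration.integral_combine[OF r(1,2) sub(1)])
      then have "integral {t..r'} f - integral {t..r} f = integral {r..r'} f" by simp
      then show ?thesis using integrable_integral[OF sub(2)] by simp
    qed
    have "((\<lambda>q. f q - ?\<psi> (G (r' - q) (F q (S q r w)))) has_integral
       (integral {t..r'} f - integral {t..r} f
         - (?\<psi> (S r' r w) - ?\<psi> (G (r' - r) w)))) {r..r'}"
      by (intro has_integral_diff fi functional_duhamel r0 r)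
    moreover have "S T r w = S T r' (S r' r w)" by (rule S_comp_apply) (use r r0 in auto)
    moreover have "G (r' - t) x = G (r' - r) w"
      using G_add_apply[of "r' - r" "r - t" x] r by (simp add: w_def)
    ultimately have int: "((\<lambda>q. f q - ?\<psi> (G (r' - q) (F q (S q r w)))) has_integral
        (k r' - k r)) {r..r'}"
      by (simp add: k_def w_def[symmetric] algebra_simps)
    show "\<bar>k r' - k r\<bar> \<le> Q * (r' - r) * (r' - r)"
    proof (rule has_integral_bound_off_negligible[OF int N r(2)])
      show "0 \<le> Q * (r' - r)" using Q r by simp
      fix q assume q: "r < q" "q < r'" "q \<notin> N"
      let ?z1 = "F q (G (q - r) w)" and ?z2 = "F q (S q r w)"
      have z2: "norm ?z2 \<le> C * (C * norm w)"
        by (intro norm_blinfun_apply_le F_le S_le order_refl) (use q r t in auto)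
      have "f q = ?\<psi> (S r' q ?z1)"
        using G_add_apply[of "q - r" "r - t" x] S_comp_apply[of q r' T ?z1] q r t
        by (simp add: f_def w_def)
      then have eq: "f q - ?\<psi> (G (r' - q) ?z2)
          = ?\<psi> (S r' q (F q (G (q - r) w - S q r w))) + ?\<psi> (S r' q ?z2 - G (r' - q) ?z2)"
        by (simp add: blinfun.diff_right)
      have \<psi>: "norm ?\<psi> \<le> norm \<phi> * C"
        using norm_dual_adjoint[of "S T r'" \<phi>] S_le[of r' T] r r0
        by (meson mult_left_mono norm_ge_zero order_refl order_trans)
      have "norm (G (q - r) w - S q r w) \<le> C * C * C * (q - r) * norm w"
        using S_minus_G[of r q w] q r r0 by (simp add: norm_minus_commute)
      also have "\<dots> \<le> C * C * C * (r' - r) * norm w"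
        using q C_pos by (intro mult_right_mono mult_left_mono) auto
      finally have 1: "norm (?\<psi> (S r' q (F q (G (q - r) w - S q r w))))
          \<le> (norm \<phi> * C) * (C * (C * (C * C * C * (r' - r) * norm w)))"
        by (intro norm_blinfun_apply_le \<psi> S_le F_le) (use q r r0 in auto)
      have "norm (S r' q ?z2 - G (r' - q) ?z2) \<le> C * C * C * (r' - q) * norm ?z2"
        by (rule S_minus_G) (use q r r0 in auto)
      also have "\<dots> \<le> C * C * C * (r' - r) * (C * (C * norm w))"
        using q z2 C_pos by (intro mult_mono mult_left_mono) auto
      finally have 2: "norm (?\<psi> (S r' q ?z2 - G (r' - q) ?z2))
          \<le> (norm \<phi> * C) * (C * C * C * (r' - r) * (C * (C * norm w)))"
        by (intro norm_blinfun_apply_le \<psi>)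
      have "\<bar>f q - ?\<psi> (G (r' - q) ?z2)\<bar>
          \<le> (norm \<phi> * C) * (C * (C * (C * C * C * (r' - r) * norm w)))
            + (norm \<phi> * C) * (C * C * C * (r' - r) * (C * (C * norm w)))"
        unfolding eq by (rule order_trans[OF abs_triangle_ineq
              add_mono[OF 1[unfolded real_norm_def] 2[unfolded real_norm_def]]])
      also have "\<dots> = 2 * norm \<phi> * C * C * C * C * C * C * (r' - r) * norm w" by (simp add: algebra_simps)
      also have "\<dots> \<le> 2 * norm \<phi> * C * C * C * C * C * C * (r' - r) * (C * norm x)"
        using w r C_pos by (intro mult_left_mono) auto
      also have "\<dots> = Q * (r' - r)" by (simp add: Q_def mult_ac)
      finally show "\<bar>f q - ?\<psi> (G (r' - q) ?z2)\<bar> \<le> Q * (r' - r)" .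
    qed
  qed
  then have "integral {t..T} f = \<phi> (S T t x) - \<phi> (G (T - t) x)"
    using S_same[of T] T_pos by (simp add: k_def)
  then show ?thesis using integrable_integral[OF f_int] by (simp add: f_def[abs_def])
qed

text \<open>For the norm continuity of \<open>t \<mapsto> S T t\<^sup>* \<phi>T\<close> compare, for \<open>t \<le> t1\<close>, with the adjoint semigroup
  started at \<open>t1\<close>: as \<open>S t1 t\<close> differs from \<open>G (t1 - t)\<close> by \<open>O(t1 - t)\<close> in operator norm, so do the
  two functionals.  The strong integral in the equation then exists, and the dual variation of
  constants formula gives its value at each point.\<close>

lemma adjoint_mild_solution_exists: "adjoint_mild_solution T D A F \<phi>T (\<lambda>t. dual_adjoint (S T t) \<phi>T)"
proof -
  let ?H = "\<lambda>t. adjoint_blinfun (G t)" and ?\<phi> = "\<lambda>t. dual_adjoint (S T t) \<phi>T"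
  interpret H: semigroup_generator ?H "adjoint_dom D A" "adjoint_op D A"
    by unfold_locales (rule adjoint_semigroup_generator[OF reflexive])
  have \<phi>_le: "norm (?\<phi> t) \<le> norm \<phi>T * C" if "0 \<le> t" "t \<le> T" for t
    using norm_dual_adjoint[of "S T t" \<phi>T] S_le[OF that order_refl]
    by (meson mult_left_mono norm_ge_zero order_trans)
  have cont: "continuous_on {0..T} ?\<phi>"
  proof (rule continuous_on_if_approximated_from_right[where g = "\<lambda>t1 t. ?H (t1 - t) (?\<phi> t1)"
        and L = "norm \<phi>T * C * C * C * C"])
    show "0 \<le> norm \<phi>T * C * C * C * C" using C_pos by simp
    show "continuous_on {0..t1} (\<lambda>t. ?H (t1 - t) (?\<phi> t1))" if "0 \<le> t1" "t1 \<le> T" for t1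
    proof -
      have "continuous_on {0..t1} ((\<lambda>t. ?H t (?\<phi> t1)) \<circ> (\<lambda>t. t1 - t))"
        by (rule continuous_on_compose, intro continuous_intros,
            rule continuous_on_subset[OF H.continuous_on_G[of t1]]) auto
      then show ?thesis by (simp add: o_def)
    qed
    show "norm (?\<phi> t - ?H (t1 - t) (?\<phi> t1)) \<le> norm \<phi>T * C * C * C * C * (t1 - t)"
      if t: "0 \<le> t" "t \<le> t1" "t1 \<le> T" for t t1
    proof (rule norm_blinfun_bound)
      show "0 \<le> norm \<phi>T * C * C * C * C * (t1 - t)" using C_pos t by simp
      fix x
      have "blinfun_apply (?\<phi> t - ?H (t1 - t) (?\<phi> t1)) x
          = blinfun_apply \<phi>T (S T t1 (S t1 t x - G (t1 - t) x))"
        using S_comp_apply[of t t1 T x] t by (simp add: blinfun.diff_left blinfun.diff_right)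
      also have "norm \<dots> \<le> norm \<phi>T * (C * (C * C * C * (t1 - t) * norm x))"
        by (intro norm_blinfun_apply_le S_le S_minus_G order_refl) (use t in auto)
      finally show "norm (blinfun_apply (?\<phi> t - ?H (t1 - t) (?\<phi> t1)) x)
          \<le> norm \<phi>T * C * C * C * C * (t1 - t) * norm x" by (simp add: mult_ac)
    qed
  qed
  have "has_strong_integral (Leb t T) (\<lambda>s. ?H (s - t) (dual_adjoint (F s) (?\<phi> s)))
      (?\<phi> t - ?H (T - t) \<phi>T)" if t: "t \<in> {0..T}" for t
  proof -
    have t': "0 \<le> t" "t \<le> T" using t by auto
    have "strongly_measurable (Leb t T) (\<lambda>s. dual_adjoint (F s) (?\<phi> s))"
      unfolding dual_adjoint_def[of "F _"]
    proof (rule strongly_measurable_compose2[where h = "\<lambda>L \<psi>. \<psi> o\<^sub>L L"])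
      show "strongly_measurable (Leb t T) F"
        by (rule strongly_measurable_subinterval[OF F_meas]) (use t' in auto)
      show "strongly_measurable (Leb t T) ?\<phi>"
        by (rule strongly_measurable_continuous_on[OF continuous_on_subset[OF cont]]) (use t' in auto)
    qed (rule bounded_bilinear.tendsto[OF bounded_bilinear_blinfun_compose])
    moreover have "continuous_on {t..T} (\<lambda>s. ?H (s - t) \<psi>)" for \<psi>
    proof -
      have "continuous_on {t..T} ((\<lambda>s. ?H s \<psi>) \<circ> (\<lambda>s. s - t))"
        by (rule continuous_on_compose, intro continuous_intros,
            rule continuous_on_subset[OF H.continuous_on_G[of "T - t"]]) auto
      then show ?thesis by (simp add: o_def)
    qed
    moreover have H_le: "norm (?H (s - t)) \<le> C" if "s \<in> {t..T}" for s
      using norm_adjoint_blinfun[of "G (s - t)"] G_le[of "s - t"] that t' by auto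
    ultimately have sm: "strongly_measurable (Leb t T) (\<lambda>s. ?H (s - t) (dual_adjoint (F s) (?\<phi> s)))"
      by (intro strongly_measurable_operator_family[of t T "\<lambda>s. ?H (s - t)" C]) auto
    have bd: "AE s in Leb t T. norm (?H (s - t) (dual_adjoint (F s) (?\<phi> s))) \<le> C * ((norm \<phi>T * C) * C)"
      unfolding AE_lebesgue_on_Ioo
    proof (intro exI[of _ N] conjI N allI impI norm_blinfun_apply_le H_le)
      fix s assume s: "t < s \<and> s < T \<and> s \<notin> N"
      have "norm (dual_adjoint (F s) (?\<phi> s)) \<le> norm (?\<phi> s) * norm (F s)" by (rule norm_dual_adjoint)
      also have "\<dots> \<le> (norm \<phi>T * C) * C"
        using s t' C_pos by (intro mult_mono \<phi>_le F_le) auto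
      finally show "norm (dual_adjoint (F s) (?\<phi> s)) \<le> (norm \<phi>T * C) * C" .
    qed auto
    obtain I where I: "has_strong_integral (Leb t T) (\<lambda>s. ?H (s - t) (dual_adjoint (F s) (?\<phi> s))) I"
      using has_strong_integral_exists_bounded[OF sm bd] .
    have "I = ?\<phi> t - ?H (T - t) \<phi>T"
    proof (rule blinfun_eqI)
      fix x
      have "((\<lambda>s. blinfun_apply (?H (s - t) (dual_adjoint (F s) (?\<phi> s))) x) has_integral (blinfun_apply I x)) {t..T}"
        by (rule has_strong_integral_imp_has_integral[OF I]) (rule blinfun.bounded_linear_left)
      then show "blinfun_apply I x = blinfun_apply (?\<phi> t - ?H (T - t) \<phi>T) x"
        using functional_dual_duhamel[OF t', of \<phi>T x]
        by (simp add: blinfun.diff_left has_integral_unique)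
    qed
    then show ?thesis using I by simp
  qed
  then show ?thesis
    unfolding adjoint_mild_solution_def using cont adjoint_semigroup_generator[OF reflexive] by blast
qed

lemma adjoint_mild_solution_unique:
  assumes sol: "adjoint_mild_solution T D A F \<phi>T \<phi>" and s: "0 \<le> s" "s \<le> T"
  shows "\<phi> s = dual_adjoint (S T s) \<phi>T"
proof -
  obtain H where cont: "continuous_on {0..T} \<phi>"
    and H: "generates_C0_semigroup (adjoint_dom D A) (adjoint_op D A) H"
    and int: "\<And>t. t \<in> {0..T} \<Longrightarrow> has_strong_integral (Leb t T)
           (\<lambda>s. H (s - t) (dual_adjoint (F s) (\<phi> s))) (\<phi> t - H (T - t) \<phi>T)"
    using sol unfolding adjoint_mild_solution_def by blast
  have HG: "H t = adjoint_blinfun (G t)" if "0 \<le> t" for t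
    by (rule adjoint_semigroup_unique[OF H that])
  have "compact (\<phi> ` {0..T})" by (rule compact_continuous_image[OF cont]) simp
  then have "bounded (\<phi> ` {0..T})" by (rule compact_imp_bounded)
  then obtain P where P: "P > 0" "\<And>t. t \<in> {0..T} \<Longrightarrow> norm (\<phi> t) \<le> P"
    unfolding bounded_pos by auto
  show ?thesis
  proof (rule weak_adjoint_solution_unique[where P = P])
    fix t x assume t: "0 \<le> t" "t \<le> T"
    have "((\<lambda>r. blinfun_apply (H (r - t) (dual_adjoint (F r) (\<phi> r))) x) has_integral
        blinfun_apply (\<phi> t - H (T - t) \<phi>T) x) {t..T}"
      using t by (intro has_strong_integral_imp_has_integral[OF int] blinfun.bounded_linear_left) auto
    then have "((\<lambda>r. blinfun_apply (\<phi> r) (F r (G (r - t) x))) has_integral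
        blinfun_apply (\<phi> t - H (T - t) \<phi>T) x) {t..T}"
      by (rule has_integral_eq[rotated]) (simp add: HG)
    then show "((\<lambda>r. blinfun_apply (\<phi> r) (F r (G (r - t) x))) has_integral
        (blinfun_apply (\<phi> t) x - blinfun_apply \<phi>T (G (T - t) x))) {t..T}"
      using t by (simp add: HG blinfun.diff_left)
  qed (use P s in auto)
qed

end

section \<open>Lebesgue spaces of controls\<close>

lemma subspace_closure:
  fixes V :: "'a::real_normed_vector set"
  assumes V: "subspace V"
  shows "subspace (closure V)"
  unfolding subspace_def
proof (intro conjI ballI allI)
  show "0 \<in> closure V" using closure_subset subspace_0[OF V] by blast
next
  fix x y assume "x \<in> closure V" "y \<in> closure V"
  then obtain X Y where "\<And>n. X n \<in> V" "X \<longlonglongrightarrow> x" "\<And>n. Y n \<in> V" "Y \<longlonglongrightarrow> y"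
    unfolding closure_sequential by blast
  then have "\<And>n. X n + Y n \<in> V" "(\<lambda>n. X n + Y n) \<longlonglongrightarrow> x + y"
    using V by (auto intro: subspace_add tendsto_add)
  then show "x + y \<in> closure V" unfolding closure_sequential by (intro exI[of _ "\<lambda>n. X n + Y n"]) simp
next
  fix c x assume "x \<in> closure V"
  then obtain X where "\<And>n. X n \<in> V" "X \<longlonglongrightarrow> x" unfolding closure_sequential by blast
  then have "\<And>n. c *\<^sub>R X n \<in> V" "(\<lambda>n. c *\<^sub>R X n) \<longlonglongrightarrow> c *\<^sub>R x"
    using V by (auto intro: subspace_scale tendsto_scaleR)
  then show "c *\<^sub>R x \<in> closure V" unfolding closure_sequential by (intro exI[of _ "\<lambda>n. c *\<^sub>R X n"]) simp
qed

lemma annihilator_span: "annihilator (span M) = annihilator M"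
proof
  show "annihilator (span M) \<subseteq> annihilator M" using span_superset[of M] by (auto simp: annihilator_def)
  show "annihilator M \<subseteq> annihilator (span M)"
  proof
    fix \<phi> assume "\<phi> \<in> annihilator M"
    then have "M \<subseteq> {v. blinfun_apply \<phi> v = 0}" by (auto simp: annihilator_def)
    moreover have "subspace {v. blinfun_apply \<phi> v = 0}"
      by (auto simp: subspace_def blinfun.add_right blinfun.scaleR_right)
    ultimately have "span M \<subseteq> {v. blinfun_apply \<phi> v = 0}" by (rule span_minimal)
    then show "\<phi> \<in> annihilator (span M)" by (auto simp: annihilator_def)
  qed
qed

lemma strongly_measurable_scaleR: "strongly_measurable M u \<Longrightarrow> strongly_measurable M (\<lambda>t. c *\<^sub>R u t)"
  by (erule strongly_measurable_compose) (intro continuous_intros)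

lemma Lp_strongly_measurable: "u \<in> Lp_space p T \<Longrightarrow> strongly_measurable (Leb 0 T) u"
  by (simp add: Lp_space_def)

lemma strongly_measurable_norm_ereal:
  "strongly_measurable (Leb 0 T) u \<Longrightarrow>
    (\<lambda>t. ereal (norm (u t))) \<in> borel_measurable (Leb 0 T)"
  by (intro borel_measurable_ereal strongly_measurable_norm_borel complete_measure_interval)

lemma Linf_space_iff:
  assumes p: "p = \<infinity>"
  shows "u \<in> Lp_space p T \<longleftrightarrow> strongly_measurable (Leb 0 T) u \<and>
     (\<exists>C. AE t in Leb 0 T. norm (u t) \<le> C)"
proof (intro iffI conjI; (elim conjE)?)
  assume u: "u \<in> Lp_space p T"
  then show "strongly_measurable (Leb 0 T) u" by (rule Lp_strongly_measurable)
  let ?E = "esssup (Leb 0 T) (\<lambda>t. ereal (norm (u t)))"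
  have "?E < \<infinity>" using u by (simp add: Lp_space_def p)
  then obtain C where "?E \<le> ereal C" by (cases ?E) auto
  then have "AE t in Leb 0 T. norm (u t) \<le> C"
    using esssup_AE[of "\<lambda>t. ereal (norm (u t))" "Leb 0 T"]
    by (auto elim!: eventually_mono dest: order_trans)
  then show "\<exists>C. AE t in Leb 0 T. norm (u t) \<le> C" by blast
next
  assume u: "strongly_measurable (Leb 0 T) u"
    and "\<exists>C. AE t in Leb 0 T. norm (u t) \<le> C"
  then obtain C where "AE t in Leb 0 T. ereal (norm (u t)) \<le> ereal C" by auto
  then have "esssup (Leb 0 T) (\<lambda>t. ereal (norm (u t))) \<le> ereal C"
    by (intro esssup_I strongly_measurable_norm_ereal u)
  also have "\<dots> < \<infinity>" by simp
  finally show "u \<in> Lp_space p T" using u by (simp add: Lp_space_def p)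
qed

lemma Linf_AE_le_norm:
  assumes u: "u \<in> Lp_space \<infinity> T"
  shows "AE t in Leb 0 T. norm (u t) \<le> Lp_norm \<infinity> T u"
proof -
  let ?E = "esssup (Leb 0 T) (\<lambda>t. ereal (norm (u t)))"
  have "?E < \<infinity>" using u by (simp add: Lp_space_def)
  then have "?E \<le> ereal (real_of_ereal ?E)" by (cases ?E) auto
  then show ?thesis
    using esssup_AE[of "\<lambda>t. ereal (norm (u t))" "Leb 0 T"]
    by (auto simp: Lp_norm_def elim!: eventually_mono dest: order_trans)
qed

lemma Linf_norm_le:
  assumes u: "strongly_measurable (Leb 0 T) u"
    and C: "AE t in Leb 0 T. norm (u t) \<le> C" "C \<ge> 0"
  shows "Lp_norm \<infinity> T u \<le> C"
proof -
  have "esssup (Leb 0 T) (\<lambda>t. ereal (norm (u t))) \<le> ereal C"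
    using C(1) by (intro esssup_I strongly_measurable_norm_ereal u) simp
  then show ?thesis
    using C(2) by (cases "esssup (Leb 0 T) (\<lambda>t. ereal (norm (u t)))")
      (auto simp: Lp_norm_def)
qed

lemma finite_exponent_gt_1:
  assumes "1 < p" "p \<noteq> (\<infinity>::ennreal)"
  shows "1 < enn2real p"
  using assms by (cases p) (auto simp flip: ennreal_1 simp: ennreal_less_iff)

lemma Lp_space_finite_iff:
  "p \<noteq> \<infinity> \<Longrightarrow> u \<in> Lp_space p T \<longleftrightarrow> strongly_measurable (Leb 0 T) u \<and>
     integrable (Leb 0 T) (\<lambda>t. norm (u t) powr enn2real p)"
  by (simp add: Lp_space_def)

lemma finite_measure_interval [simp]: "finite_measure (Leb 0 T)"
  by (intro finite_measure_lebesgue_on) simp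

lemma integrable_const_interval [simp]: "integrable (Leb 0 T) (\<lambda>t. c::real)"
  by (rule finite_measure.integrable_const) simp

lemma LINT_const_interval: "T > 0 \<Longrightarrow> (LINT t|Leb 0 T. (c::real)) = c * T"
  by (simp add: measure_restrict_space)

lemma Lp_powr_borel:
  "strongly_measurable (Leb 0 T) u \<Longrightarrow>
    (\<lambda>t. norm (u t) powr q) \<in> borel_measurable (Leb 0 T)"
  by (intro measurable_compose[OF strongly_measurable_norm_borel, where g = "\<lambda>x. x powr q"]) auto

text \<open>Integrated over the finite interval, with \<open>d\<close> small, this bounds the \<open>L\<^sup>1\<close> norm by an arbitrarily
  small constant plus a multiple of the \<open>q\<close>-th power of the \<open>L\<^sup>q\<close> norm: the continuity that
  Hoelder's inequality expresses.\<close>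

lemma le_const_plus_powr:
  fixes a d q :: real
  assumes "a \<ge> 0" "d > 0" "q \<ge> 1"
  shows "a \<le> d + d powr (1 - q) * a powr q"
proof (cases "a \<le> d")
  case True
  then show ?thesis by (simp add: add_increasing2)
next
  case False
  then have "a powr (1 - q) \<le> d powr (1 - q)" using assms by (intro powr_mono2') auto
  then have "a powr (1 - q) * a powr q \<le> d powr (1 - q) * a powr q" by (intro mult_right_mono) auto
  moreover have "a powr (1 - q) * a powr q = a" using False assms by (simp flip: powr_add)
  ultimately show ?thesis using assms by linarith
qed

lemma Lp_integrable_norm:
  assumes p: "1 < p" and u: "u \<in> Lp_space p T"
  shows "integrable (Leb 0 T) (\<lambda>t. norm (u t))"
proof -
  have meas: "(\<lambda>t. norm (u t)) \<in> borel_measurable (Leb 0 T)"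
    by (intro strongly_measurable_norm_borel Lp_strongly_measurable[OF u]) simp
  show ?thesis
  proof (cases "p = \<infinity>")
    case True
    then obtain C where "AE t in Leb 0 T. norm (u t) \<le> C" using u unfolding Linf_space_iff[OF True] by blast
    then show ?thesis
      by (intro Bochner_Integration.integrable_bound[OF integrable_const_interval[of T C] meas])
        (auto elim!: eventually_mono)
  next
    case False
    note q = finite_exponent_gt_1[OF p False]
    have "integrable (Leb 0 T) (\<lambda>t. 1 + norm (u t) powr enn2real p)"
      using u False by (intro Bochner_Integration.integrable_add) (auto simp: Lp_space_finite_iff)
    then show ?thesis
    proof (rule Bochner_Integration.integrable_bound[OF _ meas], intro AE_I2)
      fix t
      show "norm (norm (u t)) \<le> norm (1 + norm (u t) powr enn2real p)"
        using le_const_plus_powr[of "norm (u t)" 1 "enn2real p"] q by simp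
    qed
  qed
qed

lemma Lp_bounded_function:
  assumes u: "strongly_measurable (Leb 0 T) u"
    and C: "\<And>t. norm (u t) \<le> C" and p: "1 < p"
  shows "u \<in> Lp_space p T"
proof (cases "p = \<infinity>")
  case True
  show ?thesis unfolding Linf_space_iff[OF True] using u C by (intro conjI exI[of _ C]) auto
next
  case False
  note q = finite_exponent_gt_1[OF p False]
  have "integrable (Leb 0 T) (\<lambda>t. norm (u t) powr enn2real p)"
  proof (rule Bochner_Integration.integrable_bound[OF integrable_const_interval[of T "C powr enn2real p"] Lp_powr_borel[OF u]], intro AE_I2)
    fix t
    show "norm (norm (u t) powr enn2real p) \<le> norm (C powr enn2real p)"
      using C[of t] q by (simp add: powr_mono2)
  qed
  then show ?thesis using u False by (simp add: Lp_space_finite_iff)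
qed

lemma Lp_add:
  assumes p: "1 < p" and u: "u \<in> Lp_space p T" and v: "v \<in> Lp_space p T"
  shows "(\<lambda>t. u t + v t) \<in> Lp_space p T"
proof -
  have sm: "strongly_measurable (Leb 0 T) (\<lambda>t. u t + v t)"
    by (intro strongly_measurable_add Lp_strongly_measurable[OF u] Lp_strongly_measurable[OF v])
  show ?thesis
  proof (cases "p = \<infinity>")
    case True
    then obtain C K where "AE t in Leb 0 T. norm (u t) \<le> C"
      "AE t in Leb 0 T. norm (v t) \<le> K" using u v unfolding Linf_space_iff[OF True] by blast
    then have "AE t in Leb 0 T. norm (u t + v t) \<le> C + K"
      by eventually_elim (rule norm_triangle_mono)
    then show ?thesis unfolding Linf_space_iff[OF True] using sm by blast
  next
    case False
    let ?q = "enn2real p"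
    note q = finite_exponent_gt_1[OF p False]
    have "integrable (Leb 0 T) (\<lambda>t. 2 powr ?q * (norm (u t) powr ?q + norm (v t) powr ?q))"
      using u v False by (intro integrable_mult_right Bochner_Integration.integrable_add) (auto simp: Lp_space_finite_iff)
    then have "integrable (Leb 0 T) (\<lambda>t. norm (u t + v t) powr ?q)"
    proof (rule Bochner_Integration.integrable_bound[OF _ Lp_powr_borel[OF sm]], intro AE_I2)
      fix t
      let ?m = "max (norm (u t)) (norm (v t))"
      have "norm (u t + v t) powr ?q \<le> (2 * ?m) powr ?q"
        using q norm_triangle_ineq[of "u t" "v t"] by (intro powr_mono2) auto
      also have "\<dots> = 2 powr ?q * ?m powr ?q" by (simp add: powr_mult)
      also have "\<dots> \<le> 2 powr ?q * (norm (u t) powr ?q + norm (v t) powr ?q)"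
        by (intro mult_left_mono) (auto simp: max_def)
      finally show "norm (norm (u t + v t) powr ?q) \<le> norm (2 powr ?q * (norm (u t) powr ?q + norm (v t) powr ?q))"
        by simp
    qed
    then show ?thesis using sm False by (simp add: Lp_space_finite_iff)
  qed
qed

lemma Lp_scaleR:
  assumes u: "u \<in> Lp_space p T"
  shows "(\<lambda>t. c *\<^sub>R u t) \<in> Lp_space p T"
proof -
  have sm: "strongly_measurable (Leb 0 T) (\<lambda>t. c *\<^sub>R u t)"
    by (rule strongly_measurable_scaleR[OF Lp_strongly_measurable[OF u]])
  show ?thesis
  proof (cases "p = \<infinity>")
    case True
    then obtain C where "AE t in Leb 0 T. norm (u t) \<le> C" using u unfolding Linf_space_iff[OF True] by blast
    then have "AE t in Leb 0 T. norm (c *\<^sub>R u t) \<le> \<bar>c\<bar> * C"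
      by eventually_elim (simp add: mult_left_mono)
    then show ?thesis unfolding Linf_space_iff[OF True] using sm by blast
  next
    case False
    then show ?thesis
      using u sm by (auto simp: Lp_space_finite_iff powr_mult intro: integrable_mult_right)
  qed
qed

lemma Lp_diff:
  assumes "1 < p" "u \<in> Lp_space p T" "v \<in> Lp_space p T"
  shows "(\<lambda>t. u t - v t) \<in> Lp_space p T"
  using Lp_add[OF assms(1,2) Lp_scaleR[OF assms(3), of "-1"]] by simp

lemma Lp_norm_scaleR_small:
  assumes p: "1 < p" and u: "u \<in> Lp_space p T" and e: "e > 0"
  obtains c where "c > 0" "Lp_norm p T (\<lambda>t. c *\<^sub>R u t) < e"
proof -
  have "\<exists>K\<ge>0. \<forall>c>0. Lp_norm p T (\<lambda>t. c *\<^sub>R u t) \<le> c * K"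
  proof (cases "p = \<infinity>")
    case True
    then obtain C where "AE t in Leb 0 T. norm (u t) \<le> C" using u unfolding Linf_space_iff[OF True] by blast
    then have "AE t in Leb 0 T. norm (c *\<^sub>R u t) \<le> c * max C 0" if "c > 0" for c
      using that by (auto elim!: eventually_mono intro: mult_left_mono)
    then have "Lp_norm p T (\<lambda>t. c *\<^sub>R u t) \<le> c * max C 0" if "c > 0" for c
      unfolding True using that strongly_measurable_scaleR[OF Lp_strongly_measurable[OF u]]
      by (intro Linf_norm_le) auto
    then show ?thesis by (intro exI[of _ "max C 0"]) auto
  next
    case False
    let ?q = "enn2real p"
    let ?J = "LINT t|Leb 0 T. norm (u t) powr ?q"
    note q = finite_exponent_gt_1[OF p False]
    have "Lp_norm p T (\<lambda>t. c *\<^sub>R u t) = c * ?J powr (1 / ?q)" if "c > 0" for c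
    proof -
      have "Lp_norm p T (\<lambda>t. c *\<^sub>R u t) = (c powr ?q * ?J) powr (1 / ?q)"
        using False that by (simp add: Lp_norm_def powr_mult)
      also have "\<dots> = (c powr ?q) powr (1 / ?q) * ?J powr (1 / ?q)" by (simp add: powr_mult)
      also have "(c powr ?q) powr (1 / ?q) = c" using that q by (simp add: powr_powr)
      finally show ?thesis .
    qed
    then show ?thesis by (intro exI[of _ "?J powr (1 / ?q)"]) auto
  qed
  then obtain K where K: "K \<ge> 0" "\<And>c. c > 0 \<Longrightarrow> Lp_norm p T (\<lambda>t. c *\<^sub>R u t) \<le> c * K" by blast
  define c where "c = e / (K + 1)"
  have c: "c > 0" using e K by (simp add: c_def)
  have "c * K < c * (K + 1)" using c by simp
  also have "\<dots> = e" using K(1) by (simp add: c_def)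
  finally have "Lp_norm p T (\<lambda>t. c *\<^sub>R u t) < e" using K(2)[OF c] by simp
  then show thesis using that c by blast
qed

lemma Lp_norm_controls_L1_norm:
  fixes T :: real
  assumes T: "T > 0" and p: "1 < p" and \<eta>: "\<eta> > 0"
  shows "\<exists>e>0. \<forall>w::real \<Rightarrow> 'b::real_normed_vector. w \<in> Lp_space p T \<longrightarrow> Lp_norm p T w < e \<longrightarrow>
    (LINT t|Leb 0 T. norm (w t)) \<le> \<eta>"
proof (cases "p = \<infinity>")
  case True
  have "(LINT t|Leb 0 T. norm (w t)) \<le> \<eta>"
    if w: "w \<in> Lp_space p T" "Lp_norm p T w < \<eta> / T" for w :: "real \<Rightarrow> 'b"
  proof -
    have "AE t in Leb 0 T. norm (w t) \<le> \<eta> / T"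
      using Linf_AE_le_norm[of w T] w True by (auto elim!: eventually_mono)
    then have "(LINT t|Leb 0 T. norm (w t)) \<le> (LINT t|Leb 0 T. \<eta> / T)"
      by (intro integral_mono_AE Lp_integrable_norm[OF p w(1)] integrable_const_interval)
    also have "\<dots> = \<eta>" using T by (simp only: LINT_const_interval) simp
    finally show ?thesis .
  qed
  then show ?thesis using T \<eta> by (intro exI[of _ "\<eta> / T"]) auto
next
  case False
  let ?q = "enn2real p"
  note q = finite_exponent_gt_1[OF p False]
  \<comment> \<open>Chosen so that \<open>d * T\<close> and \<open>d powr (1 - q) * k\<close> are both \<open>\<eta> / 2\<close>.\<close>
  define d where "d = \<eta> / (2 * T)"
  have d: "d > 0" using \<eta> T by (simp add: d_def)
  define k where "k = \<eta> / 2 / d powr (1 - ?q)"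
  have k: "k > 0" using \<eta> d by (simp add: k_def)
  have "(LINT t|Leb 0 T. norm (w t)) \<le> \<eta>"
    if w: "w \<in> Lp_space p T" "Lp_norm p T w < k powr (1 / ?q)" for w :: "real \<Rightarrow> 'b"
  proof -
    let ?J = "LINT t|Leb 0 T. norm (w t) powr ?q"
    have "?J powr (1 / ?q) < k powr (1 / ?q)" using w(2) False by (simp add: Lp_norm_def)
    then have J: "?J < k"
      using q k powr_mono2[of "1 / ?q" k ?J] by (meson divide_nonneg_nonneg enn2real_nonneg less_imp_le not_less zero_le_one)
    have wq: "integrable (Leb 0 T) (\<lambda>t. norm (w t) powr ?q)"
      using w(1) False by (simp add: Lp_space_finite_iff)
    have "(LINT t|Leb 0 T. norm (w t))
        \<le> (LINT t|Leb 0 T. d + d powr (1 - ?q) * norm (w t) powr ?q)"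
      using le_const_plus_powr[of "norm (w _)" d ?q] d q
      by (intro integral_mono Lp_integrable_norm[OF p w(1)] Bochner_Integration.integrable_add
          integrable_mult_right wq integrable_const_interval) auto
    also have "\<dots> = (LINT t|Leb 0 T. d) + d powr (1 - ?q) * ?J"
      by (subst Bochner_Integration.integral_add) (use wq in auto)
    also have "(LINT t|Leb 0 T. d) = d * T" by (rule LINT_const_interval[OF T])
    also have "d * T + d powr (1 - ?q) * ?J \<le> d * T + d powr (1 - ?q) * k" using J by (intro add_left_mono mult_left_mono) auto
    also have "\<dots> = \<eta>" using d T by (simp add: k_def d_def)
    finally show ?thesis .
  qed
  then show ?thesis using k by (intro exI[of _ "k powr (1 / ?q)"]) auto
qed

section \<open>Bounded functionals on the space of controls\<close>

locale bounded_dual_function =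
  fixes T K :: real and \<psi> :: "real \<Rightarrow> 'u::real_normed_vector \<Rightarrow>\<^sub>L real"
  assumes T_pos: "T > 0" and K_nonneg: "K \<ge> 0"
    and \<psi>_meas: "strongly_measurable (Leb 0 T) \<psi>"
    and \<psi>_le: "AE t in Leb 0 T. norm (\<psi> t) \<le> K"
begin

definition pairing :: "(real \<Rightarrow> 'u) \<Rightarrow> real" where
  "pairing u = (LINT t|Leb 0 T. \<psi> t (u t))"

lemma integrable_pairing:
  assumes p: "1 < p" and u: "u \<in> Lp_space p T"
  shows "integrable (Leb 0 T) (\<lambda>t. \<psi> t (u t))"
    and "\<bar>pairing u\<bar> \<le> K * (LINT t|Leb 0 T. norm (u t))"
proof -
  have meas: "(\<lambda>t. \<psi> t (u t)) \<in> borel_measurable (Leb 0 T)"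
    by (intro strongly_measurable_real_imp_borel strongly_measurable_blinfun_apply \<psi>_meas
        Lp_strongly_measurable[OF u]) simp
  have le: "AE t in Leb 0 T. \<bar>\<psi> t (u t)\<bar> \<le> K * norm (u t)"
    using \<psi>_le by eventually_elim (metis norm_blinfun_apply_le order_refl real_norm_def)
  have int: "integrable (Leb 0 T) (\<lambda>t. K * norm (u t))"
    by (intro integrable_mult_right Lp_integrable_norm[OF p u])
  show 1: "integrable (Leb 0 T) (\<lambda>t. \<psi> t (u t))"
    by (rule Bochner_Integration.integrable_bound[OF int meas])
      (use le in \<open>auto elim!: eventually_mono\<close>)
  have "\<bar>pairing u\<bar> \<le> (LINT t|Leb 0 T. \<bar>\<psi> t (u t)\<bar>)"
    unfolding pairing_def using integral_norm_bound[of "Leb 0 T" "\<lambda>t. \<psi> t (u t)"] by simp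
  also have "\<dots> \<le> (LINT t|Leb 0 T. K * norm (u t))"
    using 1 int le by (intro integral_mono_AE) auto
  finally show "\<bar>pairing u\<bar> \<le> K * (LINT t|Leb 0 T. norm (u t))" by simp
qed

lemma pairing_linear:
  assumes p: "1 < p" and u: "u \<in> Lp_space p T" and v: "v \<in> Lp_space p T"
  shows "pairing (\<lambda>t. a *\<^sub>R u t + b *\<^sub>R v t) = a * pairing u + b * pairing v"
  unfolding pairing_def
  using integrable_pairing(1)[OF p u] integrable_pairing(1)[OF p v]
  by (simp add: blinfun.add_right blinfun.scaleR_right)

text \<open>The zero set of the functional is convex and closed under the \<open>L\<^sup>p\<close> seminorm, so it contains a
  ball around some \<open>u0\<close>.  Moving from \<open>u0\<close> a little in the directions \<open>w\<close> and \<open>- w\<close> stays inside the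
  ball, which forces the value at \<open>w\<close> to be zero.\<close>

lemma pairing_vanishes_everywhere:
  assumes p: "1 < p" and W: "W \<subseteq> Lp_space p T"
    and int: "Lp_interior p T (Lp_closure p T (convex hull W)) \<noteq> {}"
    and zero: "\<And>u. u \<in> W \<Longrightarrow> pairing u = 0"
    and w: "w \<in> Lp_space p T"
  shows "pairing w = 0"
proof -
  define Z where "Z = {u \<in> Lp_space p T. pairing u = 0}"
  have "convex Z"
    unfolding convex_def
  proof (intro ballI allI impI)
    fix u v and a b :: real assume "u \<in> Z" "v \<in> Z"
    moreover have "a *\<^sub>R u + b *\<^sub>R v = (\<lambda>t. a *\<^sub>R u t + b *\<^sub>R v t)"
      by (simp add: fun_eq_iff scaleR_fun_def)
    ultimately show "a *\<^sub>R u + b *\<^sub>R v \<in> Z"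
      using pairing_linear[OF p, of u v a b] by (auto simp: Z_def intro!: Lp_add[OF p] Lp_scaleR)
  qed
  then have hull: "convex hull W \<subseteq> Z" using W zero by (intro hull_minimal) (auto simp: Z_def)
  have clos: "pairing u = 0" if u: "u \<in> Lp_closure p T (convex hull W)" for u
  proof -
    have uL: "u \<in> Lp_space p T" using u by (simp add: Lp_closure_def)
    have "\<bar>pairing u\<bar> \<le> 0 + e" if e: "e > 0" for e
    proof -
      define \<eta> where "\<eta> = e / (K + 1)"
      have \<eta>: "\<eta> > 0" using e K_nonneg by (simp add: \<eta>_def)
      obtain d where d: "d > 0" "\<And>w :: real \<Rightarrow> 'u. w \<in> Lp_space p T \<Longrightarrow> Lp_norm p T w < d \<Longrightarrow>
          (LINT t|Leb 0 T. norm (w t)) \<le> \<eta>"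
        using Lp_norm_controls_L1_norm[OF T_pos p \<eta>] by blast
      obtain v where v: "v \<in> convex hull W" "Lp_norm p T (\<lambda>t. v t - u t) < d"
        using u d(1) by (auto simp: Lp_closure_def)
      have vZ: "v \<in> Lp_space p T" "pairing v = 0" using v(1) hull by (auto simp: Z_def)
      have diff: "(\<lambda>t. v t - u t) \<in> Lp_space p T" by (rule Lp_diff[OF p vZ(1) uL])
      have "pairing (\<lambda>t. v t - u t) = - pairing u"
        using pairing_linear[OF p vZ(1) uL, of 1 "-1"] vZ(2) by simp
      then have "\<bar>pairing u\<bar> \<le> K * (LINT t|Leb 0 T. norm (v t - u t))"
        using integrable_pairing(2)[OF p diff] by simp
      also have "\<dots> \<le> K * \<eta>" using d(2)[OF diff v(2)] K_nonneg by (intro mult_left_mono)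
      also have "\<dots> \<le> (K + 1) * \<eta>" using \<eta> by (intro mult_right_mono) auto
      also have "\<dots> = e" using K_nonneg by (simp add: \<eta>_def)
      finally show ?thesis by simp
    qed
    then have "\<bar>pairing u\<bar> \<le> 0" by (rule field_le_epsilon)
    then show ?thesis by simp
  qed
  obtain u0 e where u0: "u0 \<in> Lp_space p T" "e > 0"
    "\<And>v. v \<in> Lp_space p T \<Longrightarrow> Lp_norm p T (\<lambda>t. v t - u0 t) < e \<Longrightarrow> v \<in> Lp_closure p T (convex hull W)"
    using int by (auto simp: Lp_interior_def)
  have near: "\<exists>c>0. pairing u0 + c * pairing v = 0" if v: "v \<in> Lp_space p T" for v
  proof -
    obtain c where c: "c > 0" "Lp_norm p T (\<lambda>t. c *\<^sub>R v t) < e"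
      using Lp_norm_scaleR_small[OF p v u0(2)] .
    have "(\<lambda>t. u0 t + c *\<^sub>R v t) \<in> Lp_space p T" by (intro Lp_add[OF p] Lp_scaleR u0 v)
    then have "(\<lambda>t. u0 t + c *\<^sub>R v t) \<in> Lp_closure p T (convex hull W)" using c(2) by (intro u0(3)) auto
    then have "pairing (\<lambda>t. u0 t + c *\<^sub>R v t) = 0" by (rule clos)
    then show ?thesis using c(1) pairing_linear[OF p u0(1) v, of 1 c] by auto
  qed
  obtain c where c: "c > 0" "pairing u0 + c * pairing w = 0" using near[OF w] by blast
  obtain c' where c': "c' > 0" "pairing u0 + c' * pairing (\<lambda>t. (-1) *\<^sub>R w t) = 0"
    using near[OF Lp_scaleR[OF w, of "-1"]] by blast
  have "pairing (\<lambda>t. (-1) *\<^sub>R w t) = - pairing w" using pairing_linear[OF p w w, of "-1" 0] by simp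
  then have "(c + c') * pairing w = 0" using c c' by (simp add: algebra_simps)
  then show ?thesis using c(1) c'(1) by simp
qed

text \<open>Testing with \<open>sgn (\<psi> t x) x\<close> gives \<open>\<psi> t x = 0\<close> almost everywhere for each single \<open>x\<close>.  The null
  set depends on \<open>x\<close>, but \<open>\<psi>\<close> is a limit of simple functions: their countably many values
  have countably many almost norming vectors, and these suffice.\<close>

lemma vanishes_if_pairing_vanishes:
  assumes p: "1 < p" and zero: "\<And>u. u \<in> Lp_space p T \<Longrightarrow> pairing u = 0"
  shows "AE t in Leb 0 T. \<psi> t = 0"
proof -
  let ?M = "Leb 0 T"
  have point: "AE t in ?M. \<psi> t x = 0" for x
  proof -
    define u where "u t = sgn (\<psi> t x) *\<^sub>R x" for t
    have sm: "strongly_measurable ?M (\<lambda>t. \<psi> t x)"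
      by (rule strongly_measurable_blinfun_apply[OF \<psi>_meas strongly_measurable_const])
    have [measurable]: "(\<lambda>t. \<psi> t x) \<in> borel_measurable ?M"
      by (rule strongly_measurable_real_imp_borel[OF _ sm]) simp
    have "(\<lambda>t. sgn (\<psi> t x)) \<in> borel_measurable ?M" by measurable
    then have "strongly_measurable ?M (\<lambda>t. sgn (\<psi> t x))" by (rule borel_imp_strongly_measurable_real)
    then have u_sm: "strongly_measurable ?M u"
      unfolding u_def by (rule strongly_measurable_compose) (intro continuous_intros)
    have "norm (u t) \<le> norm x" for t by (simp add: u_def sgn_real_def)
    then have u: "u \<in> Lp_space p T" by (rule Lp_bounded_function[OF u_sm _ p])
    have "\<psi> t (u t) = \<bar>\<psi> t x\<bar>" for t by (simp add: u_def blinfun.scaleR_right abs_sgn mult.commute)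
    then have "integrable ?M (\<lambda>t. \<bar>\<psi> t x\<bar>)" "(LINT t|?M. \<bar>\<psi> t x\<bar>) = 0"
      using integrable_pairing(1)[OF p u] zero[OF u] by (simp_all add: pairing_def)
    then have "AE t in ?M. \<bar>\<psi> t x\<bar> = 0" by (subst (asm) integral_nonneg_eq_0_iff_AE) auto
    then show ?thesis by simp
  qed
  have "\<forall>v :: 'u \<Rightarrow>\<^sub>L real. \<exists>x. norm x \<le> 1 \<and> norm v \<le> 2 * blinfun_apply v x"
  proof (rule allI, rule ccontr)
    fix v :: "'u \<Rightarrow>\<^sub>L real"
    assume none: "\<not> (\<exists>x. norm x \<le> 1 \<and> norm v \<le> 2 * blinfun_apply v x)"
    have small: "v x < norm v / 2" if "norm x \<le> 1" for x
    proof -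
      have "\<not> norm v \<le> 2 * blinfun_apply v x" using none that by blast
      then show ?thesis by simp
    qed
    have "norm v \<le> norm v / 2"
    proof (rule norm_blinfun_bound)
      fix x
      show "norm (v x) \<le> norm v / 2 * norm x"
      proof (cases "x = 0")
        case False
        have "v (x /\<^sub>R norm x) < norm v / 2" "v ((- x) /\<^sub>R norm x) < norm v / 2"
          using False by (intro small, simp)+
        moreover have "v (x /\<^sub>R norm x) = v x / norm x" "v ((- x) /\<^sub>R norm x) = - (v x / norm x)"
          by (simp_all add: blinfun.scaleR_right blinfun.minus_right divide_inverse mult.commute)
        ultimately have "\<bar>v x / norm x\<bar> \<le> norm v / 2" by linarith
        then show ?thesis using False by (simp add: divide_le_eq)
      qed simp
    qed simp
    then have "norm v = 0" using norm_ge_zero[of v] by simp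
    then show False using small[of 0] by simp
  qed
  from choice[OF this] obtain x :: "('u \<Rightarrow>\<^sub>L real) \<Rightarrow> 'u"
    where "\<forall>v. norm (x v) \<le> 1 \<and> norm v \<le> 2 * blinfun_apply v (x v)" ..
  then have x: "\<And>v. norm (x v) \<le> 1" "\<And>v. norm v \<le> 2 * blinfun_apply v (x v)" by blast+
  obtain s where s: "\<And>n. simple_function ?M (s n)" "AE t in ?M. (\<lambda>n. s n t) \<longlonglongrightarrow> \<psi> t"
    using \<psi>_meas unfolding strongly_measurable_def by blast
  define Q where "Q = (\<Union>n::nat. s n ` space ?M)"
  have "countable Q" unfolding Q_def using simple_functionD(1)[OF s(1)] by (intro countable_UN) (auto intro: countable_finite)
  then have "AE t in ?M. \<forall>v\<in>Q. \<psi> t (x v) = 0" using point by (simp add: AE_ball_countable)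
  with s(2) AE_space show ?thesis
  proof eventually_elim
    fix t assume lim: "(\<lambda>n. s n t) \<longlonglongrightarrow> \<psi> t" and t: "t \<in> space ?M" and z: "\<forall>v\<in>Q. \<psi> t (x v) = 0"
    have "norm (s n t) \<le> 2 * norm (s n t - \<psi> t)" for n
    proof -
      let ?v = "s n t"
      have "?v \<in> Q" unfolding Q_def using t by blast
      then have "blinfun_apply ?v (x ?v) = blinfun_apply (?v - \<psi> t) (x ?v)" using z by (simp add: blinfun.diff_left)
      also have "\<dots> \<le> norm (?v - \<psi> t) * 1"
        using norm_blinfun_apply_le[OF order_refl x(1), of "?v - \<psi> t" ?v] by simp
      finally show ?thesis using x(2)[of ?v] by simp
    qed
    moreover have "(\<lambda>n. 2 * norm (s n t - \<psi> t)) \<longlonglongrightarrow> 2 * 0"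
      using lim by (intro tendsto_mult tendsto_const) (simp add: tendsto_norm_zero_iff LIM_zero_iff)
    ultimately have "(\<lambda>n. s n t) \<longlonglongrightarrow> 0"
      by (intro Lim_null_comparison[of "\<lambda>n. s n t" "\<lambda>n. 2 * norm (s n t - \<psi> t)"]) auto
    then show "\<psi> t = 0" using lim LIMSEQ_unique by blast
  qed
qed

end

section \<open>Reachable states\<close>

lemma AE_subinterval:
  assumes "AE s in Leb 0 T. P s" "t \<le> T"
  shows "AE s in Leb 0 t. P s"
  using assms unfolding AE_lebesgue_on_Ioo by (meson less_le_trans)

locale control_system = evolution_system G D A T C N F S
  for G :: "real \<Rightarrow> 'a::banach \<Rightarrow>\<^sub>L 'a" and D :: "'a set" and A :: "'a \<Rightarrow> 'a"
    and T C :: real and N :: "real set"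
    and F :: "real \<Rightarrow> 'a \<Rightarrow>\<^sub>L 'a" and S :: "real \<Rightarrow> real \<Rightarrow> 'a \<Rightarrow>\<^sub>L 'a" +
  fixes B :: "real \<Rightarrow> 'u::banach \<Rightarrow>\<^sub>L 'a" and p :: ennreal and K :: real
  assumes p: "1 < p" and K_nonneg: "K \<ge> 0"
    and B_meas: "strongly_measurable (Leb 0 T) B"
    and B_le: "AE t in Leb 0 T. norm (B t) \<le> K"
begin

lemma input_measurable:
  assumes u: "u \<in> Lp_space p T" and t: "0 \<le> t" "t \<le> T"
  shows "strongly_measurable (Leb 0 t) (\<lambda>s. S t s (B s (u s)))"
proof -
  have "strongly_measurable (Leb 0 t) (\<lambda>s. B s (u s))"
    using t strongly_measurable_subinterval[OF B_meas, of 0 t]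
      strongly_measurable_subinterval[OF Lp_strongly_measurable[OF u], of 0 t]
    by (intro strongly_measurable_blinfun_apply[of _ B]) auto
  then show ?thesis
    by (rule strongly_measurable_operator_family[of 0 t "S t" C, rotated 2])
      (use t in \<open>auto intro: continuous_on_S S_le\<close>)
qed

lemma mild_solution_exists:
  assumes u: "u \<in> Lp_space p T"
  shows "\<exists>y. mild_solution T S B u y"
proof -
  have "\<exists>I. has_strong_integral (Leb 0 t) (\<lambda>s. S t s (B s (u s))) I" if t: "t \<in> {0..T}" for t
  proof -
    have t': "0 \<le> t" "t \<le> T" using t by auto
    have "(\<integral>\<^sup>+ s. ennreal (norm (S t s (B s (u s)))) \<partial>Leb 0 t)
        \<le> (\<integral>\<^sup>+ s. ennreal (C * (K * norm (u s))) \<partial>Leb 0 t)"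
    proof (rule nn_integral_mono_AE)
      show "AE s in Leb 0 t. ennreal (norm (S t s (B s (u s)))) \<le> ennreal (C * (K * norm (u s)))"
        using AE_subinterval[OF B_le t'(2)] AE_space
      proof eventually_elim
        fix s assume s: "norm (B s) \<le> K" "s \<in> space (Leb 0 t)"
        then show "ennreal (norm (S t s (B s (u s)))) \<le> ennreal (C * (K * norm (u s)))"
          using t' by (intro ennreal_leI norm_blinfun_apply_le S_le order_refl) auto
      qed
    qed
    also have "\<dots> \<le> (\<integral>\<^sup>+ s. ennreal (C * (K * norm (u s))) \<partial>Leb 0 T)"
      using t' by (subst (1 2) nn_integral_restrict_space)
        (auto intro!: nn_integral_mono mult_left_mono simp: indicator_def)
    also have "\<dots> < \<infinity>"
    proof -
      have "integrable (Leb 0 T) (\<lambda>s. C * (K * norm (u s)))"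
        by (intro integrable_mult_right Lp_integrable_norm[OF p u])
      moreover have "norm (C * (K * norm (u s))) = C * (K * norm (u s))" for s
        using C_pos K_nonneg by simp
      ultimately show ?thesis by (simp only: integrable_iff_bounded)
    qed
    finally show ?thesis
      using has_strong_integral_exists[OF complete_measure_interval input_measurable[OF u t']] by blast
  qed
  then have "\<forall>t. \<exists>I. t \<in> {0..T} \<longrightarrow> has_strong_integral (Leb 0 t) (\<lambda>s. S t s (B s (u s))) I"
    by blast
  from choice[OF this] show ?thesis unfolding mild_solution_def by blast
qed

text \<open>The adjoint of the map from controls to final states, applied to \<open>\<phi>\<close>.\<close>

definition observation :: "('a \<Rightarrow>\<^sub>L real) \<Rightarrow> real \<Rightarrow> ('u \<Rightarrow>\<^sub>L real)" where
  "observation \<phi> t = dual_adjoint (B t) (dual_adjoint (S T t) \<phi>)"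

lemma observation_apply: "blinfun_apply (observation \<phi> t) x = blinfun_apply \<phi> (S T t (B t x))"
  by (simp add: observation_def)

lemma bounded_observation: "bounded_dual_function T (norm \<phi> * C * K) (observation \<phi>)"
proof
  show "T > 0" by (rule T_pos)
  show "0 \<le> norm \<phi> * C * K" using C_pos K_nonneg by simp
  have "continuous_on {0..T} (\<lambda>t. dual_adjoint (S T t) \<phi>)"
    using adjoint_mild_solution_exists[of \<phi>] by (simp add: adjoint_mild_solution_def)
  then have "strongly_measurable (Leb 0 T) (\<lambda>t. dual_adjoint (S T t) \<phi>)"
    by (rule strongly_measurable_continuous_on)
  then have "strongly_measurable (Leb 0 T) (\<lambda>t. dual_adjoint (S T t) \<phi> o\<^sub>L B t)"
    by (rule strongly_measurable_compose2[OF _ B_meas])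
      (rule bounded_bilinear.tendsto[OF bounded_bilinear_blinfun_compose])
  then show "strongly_measurable (Leb 0 T) (observation \<phi>)"
    by (simp add: observation_def[abs_def] dual_adjoint_def[of "B _"])
  show "AE t in Leb 0 T. norm (observation \<phi> t) \<le> norm \<phi> * C * K"
    using B_le AE_space
  proof eventually_elim
    fix t assume t: "norm (B t) \<le> K" "t \<in> space (Leb 0 T)"
    have "norm (observation \<phi> t) \<le> norm (dual_adjoint (S T t) \<phi>) * norm (B t)"
      unfolding observation_def by (rule norm_dual_adjoint)
    also have "\<dots> \<le> (norm \<phi> * norm (S T t)) * norm (B t)"
      by (intro mult_right_mono norm_dual_adjoint) simp
    also have "\<dots> \<le> (norm \<phi> * C) * K"
      using t C_pos by (intro mult_mono mult_left_mono S_le) auto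
    finally show "norm (observation \<phi> t) \<le> norm \<phi> * C * K" .
  qed
qed

lemma functional_final_state:
  assumes "has_strong_integral (Leb 0 T) (\<lambda>s. S T s (B s (u s))) y"
  shows "blinfun_apply \<phi> y = (LINT t|Leb 0 T. observation \<phi> t (u t))"
  using has_strong_integral_functional[OF complete_measure_interval assms blinfun.bounded_linear_right[of \<phi>]]
  by (simp add: observation_apply has_bochner_integral_iff)

lemma mild_solution_final: "mild_solution T S B u y \<Longrightarrow>
    has_strong_integral (Leb 0 T) (\<lambda>s. S T s (B s (u s))) (y T)"
  using T_pos by (auto simp: mild_solution_def)

lemma annihilator_final_states_iff:
  assumes W: "W \<subseteq> Lp_space p T"
  shows "\<phi> \<in> annihilator (final_states T S B W) \<longleftrightarrow>
    (\<forall>u\<in>W. (LINT t|Leb 0 T. observation \<phi> t (u t)) = 0)"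
proof
  assume ann: "\<phi> \<in> annihilator (final_states T S B W)"
  show "\<forall>u\<in>W. (LINT t|Leb 0 T. observation \<phi> t (u t)) = 0"
  proof
    fix u assume u: "u \<in> W"
    obtain y where y: "mild_solution T S B u y" using mild_solution_exists[of u] u W by blast
    then have "y T \<in> final_states T S B W" using u by (auto simp: final_states_def)
    then have "blinfun_apply \<phi> (y T) = 0" using ann by (simp add: annihilator_def)
    then show "(LINT t|Leb 0 T. observation \<phi> t (u t)) = 0"
      using functional_final_state[OF mild_solution_final[OF y]] by simp
  qed
next
  assume zero: "\<forall>u\<in>W. (LINT t|Leb 0 T. observation \<phi> t (u t)) = 0"
  show "\<phi> \<in> annihilator (final_states T S B W)"
    unfolding annihilator_def final_states_def
    using zero functional_final_state[OF mild_solution_final] by auto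
qed

text \<open>The controls in \<open>L\<^sup>p\<close> include the bounded measurable ones, which are enough to test whether the
  observation vanishes.\<close>

lemma annihilator_reachable_set:
  "\<phi> \<in> annihilator (reachable_set p T S B) \<longleftrightarrow> (AE t in Leb 0 T. observation \<phi> t = 0)"
proof -
  interpret bounded_dual_function T "norm \<phi> * C * K" "observation \<phi>" by (rule bounded_observation)
  have "\<phi> \<in> annihilator (reachable_set p T S B) \<longleftrightarrow> (\<forall>u\<in>Lp_space p T. pairing u = 0)"
    unfolding reachable_set_def annihilator_final_states_iff[OF order_refl] pairing_def ..
  also have "\<dots> \<longleftrightarrow> (AE t in Leb 0 T. observation \<phi> t = 0)"
  proof
    assume "\<forall>u\<in>Lp_space p T. pairing u = 0"
    then show "AE t in Leb 0 T. observation \<phi> t = 0"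
      by (intro vanishes_if_pairing_vanishes[OF p]) blast
  next
    assume "AE t in Leb 0 T. observation \<phi> t = 0"
    then have "pairing u = 0" for u
      unfolding pairing_def by (intro integral_eq_zero_AE) (auto elim!: eventually_mono)
    then show "\<forall>u\<in>Lp_space p T. pairing u = 0" by blast
  qed
  finally show ?thesis .
qed

lemma annihilator_restricted_controls:
  assumes W: "W \<subseteq> Lp_space p T"
    and int: "Lp_interior p T (Lp_closure p T (convex hull W)) \<noteq> {}"
  shows "annihilator (final_states T S B W) = annihilator (reachable_set p T S B)"
proof (rule set_eqI)
  fix \<phi>
  interpret bounded_dual_function T "norm \<phi> * C * K" "observation \<phi>" by (rule bounded_observation)
  have "(\<forall>u\<in>W. pairing u = 0) \<longleftrightarrow> (\<forall>u\<in>Lp_space p T. pairing u = 0)"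
    using pairing_vanishes_everywhere[OF p W int] W by blast
  then show "\<phi> \<in> annihilator (final_states T S B W) \<longleftrightarrow> \<phi> \<in> annihilator (reachable_set p T S B)"
    unfolding reachable_set_def annihilator_final_states_iff[OF W] annihilator_final_states_iff[OF order_refl]
      pairing_def .
qed

lemma reachable_setI: "u \<in> Lp_space p T \<Longrightarrow> mild_solution T S B u y \<Longrightarrow> y T \<in> reachable_set p T S B"
  unfolding reachable_set_def final_states_def by blast

text \<open>Functionals see the final state through the pairing, which is linear in the control.\<close>

lemma final_state_linear:
  assumes u: "u \<in> Lp_space p T" "v \<in> Lp_space p T"
    and y: "mild_solution T S B u y" "mild_solution T S B v z"
  shows "a *\<^sub>R y T + b *\<^sub>R z T \<in> reachable_set p T S B"
proof -
  let ?w = "\<lambda>t. a *\<^sub>R u t + b *\<^sub>R v t"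
  have w: "?w \<in> Lp_space p T" by (intro Lp_add[OF p] Lp_scaleR u)
  obtain x where x: "mild_solution T S B ?w x" using mild_solution_exists[OF w] by blast
  have "x T = a *\<^sub>R y T + b *\<^sub>R z T"
  proof (rule functionals_separate_points)
    fix \<phi> :: "'a \<Rightarrow>\<^sub>L real"
    interpret bounded_dual_function T "norm \<phi> * C * K" "observation \<phi>" by (rule bounded_observation)
    have "blinfun_apply \<phi> (x T) = pairing ?w" "blinfun_apply \<phi> (y T) = pairing u" "blinfun_apply \<phi> (z T) = pairing v"
      using functional_final_state[OF mild_solution_final] x y by (simp_all add: pairing_def)
    then show "blinfun_apply \<phi> (x T) = blinfun_apply \<phi> (a *\<^sub>R y T + b *\<^sub>R z T)"
      using pairing_linear[OF p u, of a b] by (simp add: blinfun.add_right blinfun.scaleR_right)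
  qed
  then show ?thesis using reachable_setI[OF w x] by simp
qed

lemma subspace_reachable_set: "subspace (reachable_set p T S B)"
proof -
  have comb: "a *\<^sub>R x + b *\<^sub>R x' \<in> reachable_set p T S B"
    if "x \<in> reachable_set p T S B" "x' \<in> reachable_set p T S B" for a b x x'
    using that final_state_linear by (auto simp: reachable_set_def[of p T S B] final_states_def)
  have "(\<lambda>t. 0) \<in> Lp_space p T"
    by (rule Lp_bounded_function[OF strongly_measurable_const, where C = 0]) (use p in auto)
  then obtain y where "y T \<in> reachable_set p T S B"
    using mild_solution_exists reachable_setI by blast
  then have "0 \<in> reachable_set p T S B" using comb[of "y T" "y T" 0 0] by simp
  then show ?thesis
    unfolding subspace_def using comb[of _ _ 1 1] comb[of _ _ _ 0] by (metis add.right_neutral scaleR_one scaleR_zero_left)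
qed

lemma finite_codim_approx_controllable_iff:
  "finite_codim_approx_controllable p T S B \<longleftrightarrow> finite_dim_subspace (annihilator (reachable_set p T S B))"
  unfolding finite_codim_approx_controllable_def
  by (simp add: finite_codim_iff_finite_dim_annihilator subspace_closure subspace_reachable_set annihilator_closure)

lemma observability_iff:
  "(\<forall>\<phi>T \<phi>. adjoint_mild_solution T D A F \<phi>T \<phi> \<longrightarrow>
      ((AE t in Leb 0 T. dual_adjoint (B t) (\<phi> t) = 0) \<longleftrightarrow> \<phi>T \<in> Y))
   \<longleftrightarrow> Y = annihilator (reachable_set p T S B)"
proof -
  have obs: "(AE t in Leb 0 T. dual_adjoint (B t) (\<phi> t) = 0)
      \<longleftrightarrow> \<phi>T \<in> annihilator (reachable_set p T S B)"
    if "adjoint_mild_solution T D A F \<phi>T \<phi>" for \<phi>T \<phi>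
    unfolding annihilator_reachable_set
  proof (rule AE_cong)
    fix t assume "t \<in> space (Leb 0 T)"
    then have "\<phi> t = dual_adjoint (S T t) \<phi>T"
      by (intro adjoint_mild_solution_unique[OF that]) auto
    then show "dual_adjoint (B t) (\<phi> t) = 0 \<longleftrightarrow> observation \<phi>T t = 0" by (simp add: observation_def)
  qed
  then show ?thesis using adjoint_mild_solution_exists by blast
qed

end

text \<open>Orbits are bounded on the compact triangle of time pairs, so uniform boundedness applies.\<close>

lemma evolution_operator_bounded:
  fixes S :: "real \<Rightarrow> real \<Rightarrow> 'a::banach \<Rightarrow>\<^sub>L 'a"
  assumes cont: "\<And>x. continuous_on {(t, s). 0 \<le> s \<and> s \<le> t \<and> t \<le> T} (\<lambda>(t, s). S t s x)"
  obtains C where "\<And>s t. 0 \<le> s \<Longrightarrow> s \<le> t \<Longrightarrow> t \<le> T \<Longrightarrow> norm (S t s) \<le> C"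
proof -
  let ?\<Delta> = "{(t, s). 0 \<le> s \<and> s \<le> t \<and> t \<le> T}"
  have "compact ?\<Delta>"
  proof -
    have "closed ?\<Delta>"
      unfolding case_prod_unfold
      by (intro closed_Collect_conj closed_Collect_le continuous_intros)
    moreover have "?\<Delta> \<subseteq> {0..T} \<times> {0..T}" by auto
    then have "bounded ?\<Delta>" by (rule bounded_subset[rotated]) (intro bounded_Times bounded_closed_interval)
    ultimately show ?thesis by (simp add: compact_eq_bounded_closed)
  qed
  have "\<exists>C. \<forall>i\<in>?\<Delta>. norm ((\<lambda>(t, s). S t s) i x) \<le> C" for x
  proof -
    have "bounded ((\<lambda>(t, s). S t s x) ` ?\<Delta>)"
      by (intro compact_imp_bounded compact_continuous_image cont \<open>compact ?\<Delta>\<close>)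
    then show ?thesis unfolding bounded_iff by (force simp: case_prod_unfold)
  qed
  from uniform_boundedness[of ?\<Delta> "\<lambda>(t, s). S t s", OF this]
  obtain C where C: "\<And>i. i \<in> ?\<Delta> \<Longrightarrow> norm ((\<lambda>(t, s). S t s) i) \<le> C" by blast
  have "norm (S t s) \<le> C" if "0 \<le> s" "s \<le> t" "t \<le> T" for s t
    using C[of "(t, s)"] that by simp
  then show thesis using that by blast
qed

theorem theorem4p1:
  fixes T :: real and p :: ennreal
    and D :: "'y::banach set" and A :: "'y \<Rightarrow> 'y"
    and F :: "real \<Rightarrow> 'y \<Rightarrow>\<^sub>L 'y"
    and B :: "real \<Rightarrow> 'u::banach \<Rightarrow>\<^sub>L 'y"
    and S :: "real \<Rightarrow> real \<Rightarrow> 'y \<Rightarrow>\<^sub>L 'y"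
    and W :: "(real \<Rightarrow> 'u) set" and M :: "'y set"
  assumes "T > 0" and "1 < p"
    and "reflexive_space TYPE('y)" and "reflexive_space TYPE('u)"
    and "\<exists>G. generates_C0_semigroup D A G"
    and "F \<in> Lp_space \<infinity> T" and "B \<in> Lp_space \<infinity> T"
    and "evolution_operator T D A F S"
    and "W \<noteq> {}" and "W \<subseteq> Lp_space p T" and "Lp_bounded p T W"
    and "Lp_interior p T (Lp_closure p T (convex hull W)) \<noteq> {}"
    and "M = final_states T S B W"
  shows "(finite_codim_approx_controllable p T S B \<longleftrightarrow> finite_codim_subspace (closure (span M)))
    \<and> (finite_codim_subspace (closure (span M)) \<longleftrightarrow>
        (\<exists>Yh :: ('y \<Rightarrow>\<^sub>L real) set. finite_dim_subspace Yh \<and>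
          (\<forall>\<phi>T \<phi>. adjoint_mild_solution T D A F \<phi>T \<phi> \<longrightarrow>
             ((AE t in lebesgue_on {0<..<T}. dual_adjoint (B t) (\<phi> t) = 0) \<longleftrightarrow> \<phi>T \<in> Yh))))"
proof -
  obtain G where G: "generates_C0_semigroup D A G"
    and duh: "\<And>s t x. 0 \<le> s \<Longrightarrow> s \<le> t \<Longrightarrow> t \<le> T \<Longrightarrow> has_strong_integral (Leb s t)
             (\<lambda>r. G (t - r) (F r (S r s x))) (S t s x - G (t - s) x)"
    using \<open>evolution_operator T D A F S\<close> unfolding evolution_operator_def by blast
  have same: "\<And>t. 0 \<le> t \<Longrightarrow> t \<le> T \<Longrightarrow> S t t = id_blinfun"
    and comp: "\<And>s r t. 0 \<le> s \<Longrightarrow> s \<le> r \<Longrightarrow> r \<le> t \<Longrightarrow> t \<le> T \<Longrightarrow> S t s = S t r o\<^sub>L S r s"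
    and cont: "\<And>x. continuous_on {(t, s). 0 \<le> s \<and> s \<le> t \<and> t \<le> T} (\<lambda>(t, s). S t s x)"
    using \<open>evolution_operator T D A F S\<close> unfolding evolution_operator_def
    by (meson atLeastAtMost_iff, blast+)
  interpret G: semigroup_generator G D A by unfold_locales (rule G)
  obtain C1 where C1: "\<And>t. 0 \<le> t \<Longrightarrow> t \<le> T \<Longrightarrow> norm (G t) \<le> C1" using G.G_bound[of T] by metis
  obtain C2 where C2: "\<And>s t. 0 \<le> s \<Longrightarrow> s \<le> t \<Longrightarrow> t \<le> T \<Longrightarrow> norm (S t s) \<le> C2"
    using evolution_operator_bounded[OF cont] by metis
  obtain C3 N where N: "negligible N" and C3: "\<And>t. 0 < t \<Longrightarrow> t < T \<Longrightarrow> t \<notin> N \<Longrightarrow> norm (F t) \<le> C3"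
    using \<open>F \<in> Lp_space \<infinity> T\<close> unfolding Linf_space_iff[OF refl] AE_lebesgue_on_Ioo by blast
  define C where "C = Max {1, C1, C2, C3}"
  have C: "1 \<le> C" "C1 \<le> C" "C2 \<le> C" "C3 \<le> C" by (auto simp: C_def)
  obtain K' where K': "AE t in Leb 0 T. norm (B t) \<le> K'"
    using \<open>B \<in> Lp_space \<infinity> T\<close> unfolding Linf_space_iff[OF refl] by blast
  interpret control_system G D A T C N F S B p "max K' 0"
  proof
    show "norm (G t) \<le> C" if "0 \<le> t" "t \<le> T" for t using C1[OF that] C(2) by simp
    show "norm (S t s) \<le> C" if "0 \<le> s" "s \<le> t" "t \<le> T" for s t using C2[OF that] C(3) by simp
    show "norm (F t) \<le> C" if "0 < t" "t < T" "t \<notin> N" for t using C3[OF that] C(4) by simp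
    show "AE t in Leb 0 T. norm (B t) \<le> max K' 0"
      using K' by (auto elim!: eventually_mono)
    show "strongly_measurable (Leb 0 T) F" "strongly_measurable (Leb 0 T) B"
      by (rule Lp_strongly_measurable[OF \<open>F \<in> Lp_space \<infinity> T\<close>],
          rule Lp_strongly_measurable[OF \<open>B \<in> Lp_space \<infinity> T\<close>])
    show "S t t = id_blinfun" if "0 \<le> t" "t \<le> T" for t using that by (rule same)
    show "S t s = S t r o\<^sub>L S r s" if "0 \<le> s" "s \<le> r" "r \<le> t" "t \<le> T" for s r t
      using that by (rule comp)
    show "continuous_on {(t, s). 0 \<le> s \<and> s \<le> t \<and> t \<le> T} (\<lambda>(t, s). S t s x)" for x by (rule cont)
    show "has_strong_integral (Leb s t) (\<lambda>r. G (t - r) (F r (S r s x))) (S t s x - G (t - s) x)"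
      if "0 \<le> s" "s \<le> t" "t \<le> T" for s t x using that by (rule duh)
  qed (use \<open>T > 0\<close> \<open>1 < p\<close> \<open>reflexive_space TYPE('y)\<close> C(1) N in auto)
  have "finite_codim_subspace (closure (span M)) \<longleftrightarrow> finite_dim_subspace (annihilator (reachable_set p T S B))"
    using annihilator_restricted_controls[OF \<open>W \<subseteq> Lp_space p T\<close>] assms
    by (simp add: finite_codim_iff_finite_dim_annihilator subspace_closure annihilator_closure annihilator_span)
  then show ?thesis
    unfolding finite_codim_approx_controllable_iff observability_iff by blast
qed

end
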